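(* Let $f:\mathbb N\to\mathbb N$ be a nondecreasing function, and let $d\ge 1$ be the dimension of the subshifts considered. (1) If $\sum_{n} \frac{f(n)}{n^2}$ converges at a computable rate, there exists an algorithm that computes the entropy of $f$-irreducible decidable ($d$-dimensional) subshifts. (2) If $\sum_{n}\frac{f(n)}{n^2}=+\infty$, the set of numbers that appear as the entropy of a decidable $f$-irreducible ($d$-dimensional) subshift is exactly the set of nonnegative $\Pi_1$-computable numbers, and there exists no algorithm that computes the entropy of these systems.
   Context: Sums over $n$ run over integers $n\ge 1$. For a finite alphabet $\mathcal A$, a $d$-dimensional subshift $\Sigma$ is a closed subset of $\mathcal A^{\mathbb Z^d}$ (product of the discrete topology) that is stable under the shift action of $\mathbb Z^d$. For a finite subset $\mathbb U\subset\mathbb Z^d$, a pattern with support $\mathbb U$ is an element of $\mathcal A^{\mathbb U}$; $\mathcal L_{\mathbb U}(\Sigma)$ is the set of patterns on $\mathbb U$ that are restrictions to $\mathbb U$ of configurations of $\Sigma$, and the language $\mathcal L(\Sigma)$ is the union of the $\mathcal L_{\mathbb U}(\Sigma)$ over all finite $\mathbb U$. Write $\mathcal L_n(\Sigma)=\mathcal L_{[0,n-1]^d}(\Sigma)$. The subshift $\Sigma$ is decidable if the function that sends a pattern $u$ to $1$ if $u\in\mathcal L(\Sigma)$ and to $0$ otherwise is computable (by a Turing machine). The entropy of $\Sigma$ is $h_{\mathrm{top}}(\Sigma)=\lim_{n\to\infty}\frac{\log_2\#\mathcal L_n(\Sigma)}{n^d}=\inf_n\frac{\log_2\#\mathcal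 L_n(\Sigma)}{n^d}$. On $\mathbb Z^d$ put $d(\vec i,\vec j)=\max_{1\le k\le d}|\vec i_k-\vec j_k|$. For finite subsets of $\mathbb Z^d$, the diameter is $\delta(\mathbb U)=\max_{i,j\in\mathbb U}d(i,j)$ and the distance is $d(\mathbb U,\mathbb V)=\min_{i\in\mathbb U,\,j\in\mathbb V}d(i,j)$. The subshift $\Sigma$ is $f$-irreducible when for all finite subsets $\mathbb U,\mathbb V$ of $\mathbb Z^d$, all $u\in\mathcal L_{\mathbb U}(\Sigma)$ and all $v\in\mathcal L_{\mathbb V}(\Sigma)$ such that $d(\mathbb U,\mathbb V)\ge f(\max(\delta(\mathbb U),\delta(\mathbb V)))$, there exists a configuration $x\in\Sigma$ with $x|_{\mathbb U}=u$ and $x|_{\mathbb V}=v$. A series $\sum a_n$ of nonnegative numbers converges at a computable rate when there is a computable function $n:\mathbb N\to\mathbb N$ such that $\left|\sum_{k\ge n(t)}a_k\right|\le 2^{-t}$ for all $t\in\mathbb N$. A real number $\alpha$ is $\Pi_1$-computable (upper-semi-computable) if there is a computable function $\varphi:\mathbb N\to\mathbb Q$ with $\alpha=\inf_{n\in\mathbb N}\varphi(n)$. There is an algorithm that computes the entropy of a class $\mathcal C$ of $d$-dimensional decidable subshifts when there is a Turing machine taking as input integers $(n,m)$ and outputting a rational number $r_{n,m}$ such that $|h_{\mathrm{top}}(\Sigma)-r_{n,m}|\le 2^{-m}$, where $\Sigma\in\mathcal C$ is the decidable subshift whose language is decided by the $n$th Turing machine; the behaviour is unspecified if $n$ does not correspond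 to such a machine.
   Formalization: In (2), f is additionally assumed computable with f(0)>0 (the claim fails for f(0)=0 and for some noncomputable f); subshifts are nonempty, and the algorithm is also given the alphabet size along with the index of the deciding machine. *)

theory Defs
  imports "HOL-Analysis.Analysis" "HOL-Library.Nat_Bijection"
begin

section \<open>Turing machines\<close>

datatype move = MoveLeft | Stay | MoveRight

fun offset :: "move \<Rightarrow> int" where
  "offset MoveLeft = -1"
| "offset Stay = 0"
| "offset MoveRight = 1"

text \<open>A deterministic one-tape machine is the finite table of its transition function, which
  sends a pair (state, scanned symbol) to a triple (new state, written symbol, move); the first
  matching entry counts. States and tape symbols are natural numbers, of which a table mentions
  only finitely many; the initial state is 0 and the blank symbol is 0. The machine halts when
  no entry applies.\<close>

type_synonym tm = "((nat \<times> nat) \<times> (nat \<times> nat \<times> move)) list"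

text \<open>State, content of the two-way infinite tape, head position.\<close>
type_synonym tm_config = "nat \<times> (int \<Rightarrow> nat) \<times> int"

fun tm_step :: "tm \<Rightarrow> tm_config \<Rightarrow> tm_config option" where
  "tm_step M (q, T, h) =
     (case map_of M (q, T h) of
        None \<Rightarrow> None
      | Some (q', b, mv) \<Rightarrow> Some (q', T(h := b), h + offset mv))"

text \<open>The input \<open>n\<close> is written in unary, as \<open>n\<close> consecutive symbols 1 on an otherwise blank tape.\<close>
definition tm_start :: "nat \<Rightarrow> tm_config" where
  "tm_start n = (0, (\<lambda>i. if 0 \<le> i \<and> i < int n then 1 else 0), 0)"

text \<open>The output is the total number of symbols 1 on the tape when the machine halts
  (Davis's convention).\<close>
definition tm_computes :: "tm \<Rightarrow> nat \<Rightarrow> nat \<Rightarrow> bool" where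
  "tm_computes M n m \<longleftrightarrow>
     (\<exists>q T h. (\<lambda>c c'. tm_step M c = Some c')\<^sup>*\<^sup>* (tm_start n) (q, T, h)
        \<and> tm_step M (q, T, h) = None
        \<and> card {i. T i = 1} = m)"

definition computable :: "(nat \<Rightarrow> nat) \<Rightarrow> bool" where
  "computable g \<longleftrightarrow> (\<exists>M. \<forall>n. tm_computes M n (g n))"

text \<open>An effective enumeration of all machines.\<close>

definition move_of_nat :: "nat \<Rightarrow> move" where
  "move_of_nat n = (if n = 0 then MoveLeft else if n = 1 then Stay else MoveRight)"

definition entry_of_nat :: "nat \<Rightarrow> (nat \<times> nat) \<times> (nat \<times> nat \<times> move)" where
  "entry_of_nat n =
     (let (l, r) = prod_decode n; (q', s) = prod_decode r; (b, mv) = prod_decode s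
      in (prod_decode l, (q', b, move_of_nat mv)))"

definition nth_tm :: "nat \<Rightarrow> tm" where
  "nth_tm n = map entry_of_nat (list_decode n)"

section \<open>Computability for rationals and reals\<close>

definition rat_of_code :: "nat \<Rightarrow> rat" where
  "rat_of_code c = (let (a, b) = prod_decode c in of_int (int_decode a) / of_nat (Suc b))"

definition computable_rat_seq :: "(nat \<Rightarrow> rat) \<Rightarrow> bool" where
  "computable_rat_seq \<phi> \<longleftrightarrow> (\<exists>g. computable g \<and> (\<forall>n. \<phi> n = rat_of_code (g n)))"

definition Pi1_computable :: "real \<Rightarrow> bool" where
  "Pi1_computable \<alpha> \<longleftrightarrow>
     (\<exists>\<phi>. computable_rat_seq \<phi> \<and> bdd_below (range (\<lambda>n. real_of_rat (\<phi> n)))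
        \<and> \<alpha> = (INF n. real_of_rat (\<phi> n)))"

definition converges_at_computable_rate :: "(nat \<Rightarrow> real) \<Rightarrow> bool" where
  "converges_at_computable_rate a \<longleftrightarrow>
     summable a \<and> (\<exists>N. computable N \<and> (\<forall>t. \<bar>\<Sum>k. a (k + N t)\<bar> \<le> 1 / 2 ^ t))"

section \<open>Subshifts\<close>

text \<open>Points of $\mathbb Z^d$ are integer lists of length \<open>d\<close>, so that patterns can be coded
  for a machine. Finite alphabets are the sets \<open>{..<k}\<close>.\<close>

definition Zd :: "nat \<Rightarrow> int list set" where
  "Zd d = {i. length i = d}"

definition shift :: "nat \<Rightarrow> int list \<Rightarrow> (int list \<Rightarrow> nat) \<Rightarrow> (int list \<Rightarrow> nat)" where
  "shift d v x = (\<lambda>i\<in>Zd d. x (map2 (+) i v))"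

definition subshift :: "nat \<Rightarrow> nat \<Rightarrow> (int list \<Rightarrow> nat) set \<Rightarrow> bool" where
  "subshift d k \<Sigma> \<longleftrightarrow>
     closedin (product_topology (\<lambda>_. discrete_topology {..<k}) (Zd d)) \<Sigma>
     \<and> (\<forall>v\<in>Zd d. \<forall>x\<in>\<Sigma>. shift d v x \<in> \<Sigma>)"

text \<open>A pattern is a finite map; its domain is its support.\<close>

definition pattern_at :: "(int list \<Rightarrow> nat) \<Rightarrow> int list set \<Rightarrow> (int list \<rightharpoonup> nat)" where
  "pattern_at x U = (\<lambda>i. Some (x i)) |` U"

definition lang_on :: "(int list \<Rightarrow> nat) set \<Rightarrow> int list set \<Rightarrow> (int list \<rightharpoonup> nat) set" where
  "lang_on \<Sigma> U = {pattern_at x U | x. x \<in> \<Sigma>}"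

definition language :: "nat \<Rightarrow> (int list \<Rightarrow> nat) set \<Rightarrow> (int list \<rightharpoonup> nat) set" where
  "language d \<Sigma> = (\<Union>U\<in>{U. finite U \<and> U \<subseteq> Zd d}. lang_on \<Sigma> U)"

definition box :: "nat \<Rightarrow> nat \<Rightarrow> int list set" where
  "box d n = {i \<in> Zd d. \<forall>a\<in>set i. 0 \<le> a \<and> a \<le> int n - 1}"

definition entropy :: "nat \<Rightarrow> (int list \<Rightarrow> nat) set \<Rightarrow> real" where
  "entropy d \<Sigma> = lim (\<lambda>n. log 2 (real (card (lang_on \<Sigma> (box d n)))) / real n ^ d)"

section \<open>Decidability\<close>

text \<open>A machine receives a pattern as an arbitrary repetition-free listing of its graph.\<close>

definition pattern_listing :: "nat \<Rightarrow> nat \<Rightarrow> (int list \<times> nat) list \<Rightarrow> bool" where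
  "pattern_listing d k ps \<longleftrightarrow> distinct (map fst ps) \<and> set ps \<subseteq> Zd d \<times> {..<k}"

definition listing_code :: "(int list \<times> nat) list \<Rightarrow> nat" where
  "listing_code ps =
     list_encode (map (\<lambda>(i, a). prod_encode (list_encode (map int_encode i), a)) ps)"

definition decides_language :: "nat \<Rightarrow> nat \<Rightarrow> tm \<Rightarrow> (int list \<Rightarrow> nat) set \<Rightarrow> bool" where
  "decides_language d k M \<Sigma> \<longleftrightarrow>
     (\<forall>ps. pattern_listing d k ps \<longrightarrow>
        tm_computes M (listing_code ps) (if map_of ps \<in> language d \<Sigma> then 1 else 0))"

definition decidable_subshift :: "nat \<Rightarrow> nat \<Rightarrow> (int list \<Rightarrow> nat) set \<Rightarrow> bool" where
  "decidable_subshift d k \<Sigma> \<longleftrightarrow> subshift d k \<Sigma> \<and> (\<exists>M. decides_language d k M \<Sigma>)"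

section \<open>Irreducibility\<close>

text \<open>Used only for points of the same positive length and for nonempty finite sets.\<close>

definition dist_max :: "int list \<Rightarrow> int list \<Rightarrow> nat" where
  "dist_max i j = Max ((\<lambda>l. nat \<bar>i ! l - j ! l\<bar>) ` {..<length i})"

definition diam :: "int list set \<Rightarrow> nat" where
  "diam U = Max {dist_max i j | i j. i \<in> U \<and> j \<in> U}"

definition set_dist :: "int list set \<Rightarrow> int list set \<Rightarrow> nat" where
  "set_dist U V = Min {dist_max i j | i j. i \<in> U \<and> j \<in> V}"

text \<open>\<open>U\<close> and \<open>V\<close> may intersect when \<open>f\<close> takes the value 0: if \<open>f 0 = 0\<close>, comparing two letters
  at the same site shows that only one letter can occur in \<open>\<Sigma>\<close>. The optimal gluing gap of a
  decidable subshift is lower semicomputable; below a noncomputable \<open>f\<close> that stays constant on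
  long enough intervals it is bounded, whatever the divergence of the series. Realising all
  entropies therefore needs \<open>f 0 > 0\<close> and \<open>f\<close> computable.\<close>
definition irreducible :: "nat \<Rightarrow> (nat \<Rightarrow> nat) \<Rightarrow> (int list \<Rightarrow> nat) set \<Rightarrow> bool" where
  "irreducible d f \<Sigma> \<longleftrightarrow>
     (\<forall>U V. finite U \<and> U \<noteq> {} \<and> U \<subseteq> Zd d \<and> finite V \<and> V \<noteq> {} \<and> V \<subseteq> Zd d \<longrightarrow>
        (\<forall>u\<in>lang_on \<Sigma> U. \<forall>v\<in>lang_on \<Sigma> V.
           set_dist U V \<ge> f (max (diam U) (diam V)) \<longrightarrow>
           (\<exists>x\<in>\<Sigma>. pattern_at x U = u \<and> pattern_at x V = v)))"

text \<open>Classes of subshifts are sets of pairs (alphabet size, subshift). The empty subshift, whose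
  entropy would be $-\infty$, is left out.\<close>
definition irreducible_decidable_class ::
    "nat \<Rightarrow> (nat \<Rightarrow> nat) \<Rightarrow> (nat \<times> (int list \<Rightarrow> nat) set) set" where
  "irreducible_decidable_class d f =
     {(k, \<Sigma>). decidable_subshift d k \<Sigma> \<and> \<Sigma> \<noteq> {} \<and> irreducible d f \<Sigma>}"

text \<open>The index of a deciding machine comes with the size of the alphabet its input patterns use:
  the alphabet could not be recovered from the transition table alone. Nothing is required, not
  even halting, on indices that do not correspond to a subshift of the class.\<close>
definition entropy_algorithm_exists :: "nat \<Rightarrow> (nat \<times> (int list \<Rightarrow> nat) set) set \<Rightarrow> bool" where
  "entropy_algorithm_exists d C \<longleftrightarrow>
     (\<exists>M. \<forall>(k, \<Sigma>)\<in>C. \<forall>e. decides_language d k (nth_tm e) \<Sigma> \<longrightarrow>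
        (\<forall>m. \<exists>c. tm_computes M (prod_encode (prod_encode (k, e), m)) c
              \<and> \<bar>entropy d \<Sigma> - real_of_rat (rat_of_code c)\<bar> \<le> 1 / 2 ^ m))"

end

theory Submission
  imports Defs
begin

text \<open>
  Gluing \<open>2\<^sup>d\<close> boxes of side \<open>n\<close> with gaps \<open>f(4n)\<close> shows that \<open>log #L(2n + f(4n)) \<ge> 2\<^sup>d log #L(n)\<close>.
  When this is iterated, the side exceeds \<open>2\<^sup>j n\<close> by a factor of at most
  \<open>exp (8 \<Sum>\<^sub>i f(i)/i\<^sup>2)\<close>, the sum being over \<open>i \<ge> 4n\<close>. Hence the tail of the series controls how far
  \<open>log #L(n) / n\<^sup>d\<close> is above the entropy, and the number of patterns can be computed with the help of a
  decision procedure for the language.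

  If the series diverges, consider the configurations in which any \<open>r + 1\<close> nonzero letters on a line
  parallel to the first axis spread over a distance of at least \<open>\<Sum>\<^sub>q g(q) \<lfloor>r/q\<rfloor>\<close>. Erasing letters
  preserves this condition, so that patterns may be completed by zeros, and the condition survives
  gluing across a gap of \<open>g(1) + \<dots> + g(r)\<close> because
  \<open>\<lfloor>(s+t+1)/q\<rfloor> \<le> \<lfloor>s/q\<rfloor> + \<lfloor>t/q\<rfloor> + 1\<close>. Since \<open>r + 1\<close> letters of two patterns force one of the diameters
  to be at least \<open>\<lfloor>r/2\<rfloor>\<close>, irreducibility only asks for \<open>g(1) + \<dots> + g(r) \<le> f(\<lfloor>r/2\<rfloor>)\<close>.
  The gaps are chosen one after the other, each as large as the known upper bounds of the target
  \<open>\<alpha>\<close> permit. If from some point on they are as large as \<open>f\<close> permits, then \<open>\<Sum> g(q)/q\<close> diverges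
  together with \<open>\<Sum> f(n)/n\<^sup>2\<close> and the entropy is \<open>0\<close>. Otherwise, infinitely often one more unit of gap
  would bring the entropy below an upper bound of \<open>\<alpha>\<close>, and a unit at level \<open>q\<close> changes the entropy by
  a factor of at most \<open>1 + 1/q\<close>. So the entropy is \<open>\<alpha>\<close>.

  An algorithm for the entropy would make each of these numbers computable, but a diagonal argument
  yields a \<open>\<Pi>\<^sub>1\<close>-computable number that is not.
\<close>

section \<open>Register programs on Turing machines\<close>

text \<open>The gaps have to be chosen by an algorithm, although no finite computation yields the
  entropy of the words that a given spacing rule admits. Each choice is therefore tested at one
  length \<open>m\<close>. If the words of length \<open>m\<close> number at least
  \<open>2 ^ (s * (m + G))\<close>, where \<open>G\<close> is the total gap, then concatenation
  secures the entropy \<open>s\<close> at every length. Conversely, a failed test bounds the entropy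
  by \<open>s\<close> up to the factor \<open>(m + G) / m\<close> and the cost of one more unit of
  gap. With \<open>m = (j + 1) * (f j + 1)\<close> at stage \<open>j\<close> both losses are at most
  \<open>1 + 1 / j\<close>, so they vanish along any infinite sequence of failures. The rule counts
  letters, through the floors of \<open>r / q\<close>, because a unit of gap at level
  \<open>q\<close> then amounts to one inserted zero per \<open>q\<close> letters. Machines being
  transition tables, recursive functions are compiled into them; the reverse translation, by a
  universal function, is what allows a given decision procedure, a given \<open>f\<close> or a given
  sequence of upper bounds to be used inside a construction.\<close>

datatype prog = Inc nat | Dec nat | Seq prog prog | While nat prog

inductive exec :: "prog \<Rightarrow> (nat \<Rightarrow> nat) \<Rightarrow> (nat \<Rightarrow> nat) \<Rightarrow> bool" where
  exec_Inc: "exec (Inc r) s (s(r := Suc (s r)))"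
| exec_Dec: "exec (Dec r) s (s(r := s r - 1))"
| exec_Seq: "exec a s t \<Longrightarrow> exec b t u \<Longrightarrow> exec (Seq a b) s u"
| exec_While_0: "s r = 0 \<Longrightarrow> exec (While r a) s s"
| exec_While_Suc: "s r \<noteq> 0 \<Longrightarrow> exec a s t \<Longrightarrow> exec (While r a) t u \<Longrightarrow> exec (While r a) s u"

fun regs_below :: "nat \<Rightarrow> prog \<Rightarrow> bool" where
  "regs_below K (Inc r) \<longleftrightarrow> r < K"
| "regs_below K (Dec r) \<longleftrightarrow> r < K"
| "regs_below K (Seq a b) \<longleftrightarrow> regs_below K a \<and> regs_below K b"
| "regs_below K (While r a) \<longleftrightarrow> r < K \<and> regs_below K a"

text \<open>The number of states: \<open>Inc\<close> scans to the end of its track and walks back,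
  \<open>Dec\<close> has a further state that erases the last cell, \<open>While\<close> adds a test
  in front of its body and a jump back behind it.\<close>

fun psize :: "prog \<Rightarrow> nat" where
  "psize (Inc r) = 2"
| "psize (Dec r) = 3"
| "psize (Seq a b) = psize a + psize b"
| "psize (While r a) = psize a + 2"

text \<open>A register is a track of the tape: cell \<open>i\<close> carries the set of the registers whose value
  exceeds \<open>i\<close>, coded by \<open>set_encode\<close>; the extra element \<open>K\<close> marks the origin. With only
  register 0 in use and no marker, this is the unary notation for inputs and outputs.\<close>

definition cell :: "nat \<Rightarrow> (nat \<Rightarrow> nat) \<Rightarrow> int \<Rightarrow> nat set" where
  "cell K s i = {r. r < K \<and> 0 \<le> i \<and> i < int (s r)} \<union> (if i = 0 then {K} else {})"

definition tape :: "nat \<Rightarrow> (nat \<Rightarrow> nat) \<Rightarrow> int \<Rightarrow> nat" where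
  "tape K s i = set_encode (cell K s i)"

text \<open>States of a program are numbered from 0; \<open>psize\<close> is its exit state.\<close>

fun act :: "nat \<Rightarrow> prog \<Rightarrow> nat \<Rightarrow> nat set \<Rightarrow> nat \<times> nat set \<times> move" where
  "act K (Inc r) q A =
     (if q = 0 then if r \<in> A then (0, A, MoveRight) else (1, insert r A, Stay)
      else if K \<in> A then (2, A, Stay) else (1, A, MoveLeft))"
| "act K (Dec r) q A =
     (if q = 0 then if r \<in> A then (0, A, MoveRight)
        else if K \<in> A then (3, A, Stay) else (1, A, MoveLeft)
      else if q = 1 then (2, A - {r}, Stay)
      else if K \<in> A then (3, A, Stay) else (2, A, MoveLeft))"
| "act K (Seq a b) q A =
     (if q < psize a then act K a q A
      else case act K b (q - psize a) A of (q', A', mv) \<Rightarrow> (psize a + q', A', mv))"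
| "act K (While r a) q A =
     (if q = 0 then if r \<in> A then (1, A, Stay) else (psize a + 2, A, Stay)
      else if q = Suc (psize a) then (0, A, Stay)
      else case act K a (q - 1) A of (q', A', mv) \<Rightarrow> (Suc q', A', mv))"

text \<open>A property of the table rather than a particular table: the parts of \<open>Seq\<close>
  and \<open>While\<close> run in the same machine at shifted state numbers, so that an induction
  over programs merely changes \<open>off\<close>.\<close>

definition runs :: "tm \<Rightarrow> nat \<Rightarrow> nat \<Rightarrow> prog \<Rightarrow> bool" where
  "runs M off K c \<longleftrightarrow> (\<forall>q A. q < psize c \<longrightarrow> A \<subseteq> {..K} \<longrightarrow>
     map_of M (off + q, set_encode A) =
       (case act K c q A of (q', A', mv) \<Rightarrow> Some (off + q', set_encode A', mv)))"

definition reach :: "tm \<Rightarrow> tm_config \<Rightarrow> tm_config \<Rightarrow> bool" where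
  "reach M = (\<lambda>c c'. tm_step M c = Some c')\<^sup>*\<^sup>*"

lemma reach_refl: "reach M c c"
  by (simp add: reach_def)

lemma reach_trans: "reach M a b \<Longrightarrow> reach M b c \<Longrightarrow> reach M a c"
  unfolding reach_def by (rule rtranclp_trans)

lemma reach_step:
  assumes "map_of M (q, T h) = Some (q', b, mv)" "reach M (q', T(h := b), h + offset mv) c"
  shows "reach M (q, T, h) c"
proof -
  have "tm_step M (q, T, h) = Some (q', T(h := b), h + offset mv)"
    using assms(1) by simp
  then show ?thesis
    using assms(2) unfolding reach_def by (rule converse_rtranclp_into_rtranclp)
qed

lemma reach_scan_right:
  assumes "\<And>i. 0 \<le> i \<Longrightarrow> i < int n \<Longrightarrow> map_of M (q, T i) = Some (q, T i, MoveRight)"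
  shows "reach M (q, T, 0) (q, T, int n)"
  using assms
proof (induction n)
  case (Suc n)
  have "reach M (q, T, int n) (q, T, int (Suc n))"
    using Suc.prems[of "int n"] by (intro reach_step[of M q T "int n"]) (auto intro: reach_refl simp: ac_simps)
  moreover have "reach M (q, T, 0) (q, T, int n)" using Suc by simp
  ultimately show ?case using reach_trans by blast
qed (auto intro: reach_refl)

lemma reach_scan_left:
  assumes "\<And>i. 0 < i \<Longrightarrow> i \<le> int n \<Longrightarrow> map_of M (q, T i) = Some (q, T i, MoveLeft)"
  shows "reach M (q, T, int n) (q, T, 0)"
  using assms
proof (induction n)
  case (Suc n)
  then have "reach M (q, T, int n) (q, T, 0)" by simp
  then show ?case
    using Suc.prems[of "int (Suc n)"] by (intro reach_step[of M q T "int (Suc n)"]) auto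
qed (auto intro: reach_refl)

lemma cell_subset: "cell K s i \<subseteq> {..K}"
  by (auto simp: cell_def)

lemma finite_cell [simp]: "finite (cell K s i)"
  by (rule finite_subset[OF cell_subset]) auto

lemma marker_in_cell [simp]: "K \<in> cell K s i \<longleftrightarrow> i = 0"
  by (auto simp: cell_def)

lemma reg_in_cell [simp]: "r < K \<Longrightarrow> r \<in> cell K s i \<longleftrightarrow> 0 \<le> i \<and> i < int (s r)"
  by (auto simp: cell_def)

lemma runs_tape:
  assumes "runs M off K c" "q < psize c" "act K c q (cell K s i) = (q', A', mv)"
  shows "map_of M (off + q, tape K s i) = Some (off + q', set_encode A', mv)"
  using assms(1)[unfolded runs_def, rule_format, OF assms(2) cell_subset[of K s i]] assms(3)
  by (simp add: tape_def)

lemma tape_upd: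
  "A = cell K t i \<Longrightarrow> (\<And>j. j \<noteq> i \<Longrightarrow> cell K s j = cell K t j) \<Longrightarrow>
    (tape K s)(i := set_encode A) = tape K t"
  by (auto simp: tape_def)

lemma tape_idem: "(tape K s)(i := set_encode (cell K s i)) = tape K s"
  by (rule tape_upd) auto

lemma reach_stay:
  assumes "runs M off K c" "q < psize c" "act K c q (cell K s i) = (q', cell K s i, Stay)"
  shows "reach M (off + q, tape K s, i) (off + q', tape K s, i)"
  using reach_step[where T = "tape K s" and h = i, OF runs_tape[OF assms], unfolded tape_idem]
  by (simp add: reach_refl)

lemma reach_Inc:
  assumes R: "runs M off K (Inc r)" and r: "r < K"
  shows "reach M (off, tape K s, 0) (off + 2, tape K (s(r := Suc (s r))), 0)"
proof -
  let ?t = "s(r := Suc (s r))" and ?p = "s r"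
  have 1: "reach M (off, tape K s, 0) (off, tape K s, int ?p)"
    using runs_tape[OF R, of 0] r by (intro reach_scan_right) (simp_all add: tape_def)
  have upd: "(tape K s)(int ?p := set_encode (insert r (cell K s (int ?p)))) = tape K ?t"
    using r by (intro tape_upd) (auto simp: cell_def split: if_splits)
  have 2: "reach M (off, tape K s, int ?p) (off + 1, tape K ?t, int ?p)"
    by (rule reach_step[where mv = Stay])
      (use runs_tape[OF R, of 0 s "int ?p"] r upd in \<open>auto intro: reach_refl\<close>)
  have 3: "reach M (off + 1, tape K ?t, int ?p) (off + 1, tape K ?t, 0)"
    using runs_tape[OF R, of 1 ?t] by (intro reach_scan_left) (simp_all add: tape_def)
  have 4: "reach M (off + 1, tape K ?t, 0) (off + 2, tape K ?t, 0)"
    using reach_stay[OF R, of 1 ?t 0 2] by simp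
  show ?thesis using 1 2 3 4 by (blast intro: reach_trans)
qed

lemma reach_Dec:
  assumes R: "runs M off K (Dec r)" and r: "r < K"
  shows "reach M (off, tape K s, 0) (off + 3, tape K (s(r := s r - 1)), 0)"
proof -
  let ?t = "s(r := s r - 1)" and ?p = "s r"
  have 1: "reach M (off, tape K s, 0) (off, tape K s, int ?p)"
    using runs_tape[OF R, of 0] r by (intro reach_scan_right) (simp_all add: tape_def)
  show ?thesis
  proof (cases "?p = 0")
    case True
    then have "?t = s" by auto
    with True have "reach M (off, tape K s, int ?p) (off + 3, tape K ?t, 0)"
      using reach_stay[OF R, of 0 s 0 3] r by simp
    with 1 show ?thesis by (blast intro: reach_trans)
  next
    case False
    then obtain p where p: "?p = Suc p" by (cases ?p) auto
    have 2: "reach M (off, tape K s, int ?p) (off + 1, tape K s, int p)"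
      by (rule reach_step[where mv = MoveLeft])
        (use runs_tape[OF R, of 0 s "int ?p"] r p in \<open>auto intro: reach_refl simp: tape_idem\<close>)
    have upd: "(tape K s)(int p := set_encode (cell K s (int p) - {r})) = tape K ?t"
      using p r by (intro tape_upd) (auto simp: cell_def split: if_splits)
    have 3: "reach M (off + 1, tape K s, int p) (off + 2, tape K ?t, int p)"
      by (rule reach_step[where mv = Stay])
        (use runs_tape[OF R, of 1 s "int p"] r upd in \<open>auto intro: reach_refl\<close>)
    have 4: "reach M (off + 2, tape K ?t, int p) (off + 2, tape K ?t, 0)"
      using runs_tape[OF R, of 2 ?t] by (intro reach_scan_left) (simp_all add: tape_def)
    have 5: "reach M (off + 2, tape K ?t, 0) (off + 3, tape K ?t, 0)"
      using reach_stay[OF R, of 2 ?t 0 3] by simp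
    show ?thesis using 1 2 3 4 5 by (blast intro: reach_trans)
  qed
qed

lemma runs_Seq:
  assumes "runs M off K (Seq a b)"
  shows "runs M off K a" "runs M (off + psize a) K b"
proof -
  show "runs M off K a"
    unfolding runs_def
  proof (intro allI impI)
    fix q A assume "q < psize a" "A \<subseteq> {..K}"
    with assms[unfolded runs_def, rule_format, of q A]
    show "map_of M (off + q, set_encode A) =
       (case act K a q A of (q', A', mv) \<Rightarrow> Some (off + q', set_encode A', mv))" by simp
  qed
  show "runs M (off + psize a) K b"
    unfolding runs_def
  proof (intro allI impI)
    fix q A assume "q < psize b" "A \<subseteq> {..K}"
    with assms[unfolded runs_def, rule_format, of "psize a + q" A]
    show "map_of M (off + psize a + q, set_encode A) =
       (case act K b q A of (q', A', mv) \<Rightarrow> Some (off + psize a + q', set_encode A', mv))"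
      by (simp add: ac_simps split: prod.splits)
  qed
qed

lemma runs_While:
  assumes "runs M off K (While r a)"
  shows "runs M (Suc off) K a"
  unfolding runs_def
proof (intro allI impI)
  fix q A assume "q < psize a" "A \<subseteq> {..K}"
  with assms[unfolded runs_def, rule_format, of "Suc q" A]
  show "map_of M (Suc off + q, set_encode A) =
     (case act K a q A of (q', A', mv) \<Rightarrow> Some (Suc off + q', set_encode A', mv))"
    by (simp split: prod.splits)
qed

text \<open>Every fragment starts and ends with the head on the marked cell 0, which is what allows
  the runs of its parts to be chained.\<close>

lemma exec_reach:
  "exec c s t \<Longrightarrow> runs M off K c \<Longrightarrow> regs_below K c \<Longrightarrow>
    reach M (off, tape K s, 0) (off + psize c, tape K t, 0)"
proof (induction arbitrary: off rule: exec.induct)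
  case (exec_Inc r s)
  then show ?case using reach_Inc[of M off K r s] by (simp del: fun_upd_apply add: numeral_2_eq_2)
next
  case (exec_Dec r s)
  then show ?case using reach_Dec[of M off K r s] by (simp del: fun_upd_apply)
next
  case (exec_Seq a s t b u)
  have "reach M (off, tape K s, 0) (off + psize a, tape K t, 0)"
    "reach M (off + psize a, tape K t, 0) (off + psize a + psize b, tape K u, 0)"
    using exec_Seq.IH runs_Seq[OF exec_Seq.prems(1)] exec_Seq.prems(2) by auto
  from reach_trans[OF this] show ?case by (simp add: add.assoc)
next
  case (exec_While_0 s r a)
  have "act K (While r a) 0 (cell K s 0) = (psize a + 2, cell K s 0, Stay)"
    using exec_While_0.hyps exec_While_0.prems(2) by simp
  from reach_stay[OF exec_While_0.prems(1) _ this] show ?case by simp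
next
  case (exec_While_Suc s r a t u)
  have r: "r < K" "regs_below K a" using exec_While_Suc.prems(2) by simp_all
  note R = exec_While_Suc.prems(1)
  have "act K (While r a) 0 (cell K s 0) = (1, cell K s 0, Stay)"
    using exec_While_Suc.hyps(1) r by simp
  from reach_stay[OF R _ this] have 1: "reach M (off, tape K s, 0) (Suc off, tape K s, 0)" by simp
  have 2: "reach M (Suc off, tape K s, 0) (Suc off + psize a, tape K t, 0)"
    using exec_While_Suc.IH(1)[OF runs_While[OF R] r(2)] .
  have "act K (While r a) (Suc (psize a)) (cell K t 0) = (0, cell K t 0, Stay)" by simp
  from reach_stay[OF R _ this] have 3: "reach M (Suc off + psize a, tape K t, 0) (off, tape K t, 0)"
    by simp
  show ?case using 1 2 3 exec_While_Suc.IH(2)[OF exec_While_Suc.prems] by (blast intro: reach_trans)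
qed

section \<open>Compilation of a program into a finite table\<close>

lemma regs_below_mono: "regs_below K c \<Longrightarrow> K \<le> L \<Longrightarrow> regs_below L c"
  by (induction c) auto

lemma ex_regs_below: "\<exists>K>0. regs_below K c"
proof (induction c)
  case (Inc r) show ?case by (intro exI[of _ "Suc r"]) simp
next
  case (Dec r) show ?case by (intro exI[of _ "Suc r"]) simp
next
  case (Seq a b)
  then obtain K L where "K > 0" "regs_below K a" "regs_below L b" by blast
  then show ?case by (intro exI[of _ "K + L"]) (auto intro: regs_below_mono)
next
  case (While r a)
  then obtain K where "K > 0" "regs_below K a" by blast
  then show ?case by (intro exI[of _ "K + Suc r"]) (auto intro: regs_below_mono)
qed

definition table_of :: "nat \<Rightarrow> nat \<Rightarrow> (nat \<Rightarrow> nat \<Rightarrow> nat \<times> nat \<times> move) \<Rightarrow> tm" where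
  "table_of Q S D = map (\<lambda>x. (x, D (fst x) (snd x))) (List.product [0..<Q] [0..<S])"

lemma map_of_table_of:
  "map_of (table_of Q S D) (q, s) = (if q < Q \<and> s < S then Some (D q s) else None)"
  unfolding table_of_def map_of_map_restrict by (auto simp: restrict_map_def)

text \<open>Subsets of \<open>{..K}\<close> have codes up to that of \<open>{..K}\<close> itself, so
  a table with finitely many symbols covers all cells.\<close>

lemma set_encode_mono: "finite B \<Longrightarrow> A \<subseteq> B \<Longrightarrow> set_encode A \<le> set_encode B"
  unfolding set_encode_def by (rule sum_mono2) auto

text \<open>State 0 writes the marker and the state before the last one erases it.\<close>

definition compile :: "nat \<Rightarrow> prog \<Rightarrow> tm" where
  "compile K c = table_of (psize c + 2) (Suc (set_encode {..K}))
     (\<lambda>q s. if q = 0 then (1, set_encode (insert K (set_decode s)), Stay)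
        else if q = Suc (psize c) then (q + 1, set_encode (set_decode s - {K}), Stay)
        else case act K c (q - 1) (set_decode s) of (q', A', mv) \<Rightarrow> (Suc q', set_encode A', mv))"

lemma runs_compile: "runs (compile K c) 1 K c"
  unfolding runs_def
proof (intro allI impI)
  fix q A assume "q < psize c" and A: "A \<subseteq> {..K}"
  moreover have "set_encode A \<le> set_encode {..K}" "finite A"
    using A by (auto intro: set_encode_mono finite_subset)
  ultimately show "map_of (compile K c) (1 + q, set_encode A) =
       (case act K c q A of (q', A', mv) \<Rightarrow> Some (1 + q', set_encode A', mv))"
    by (auto simp: compile_def map_of_table_of split: prod.splits)
qed

lemma tm_computes_compile:
  assumes "exec c (\<lambda>r. if r = 0 then n else 0) (\<lambda>r. if r = 0 then m else 0)"
    and K: "regs_below K c" "K > 0"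
  shows "tm_computes (compile K c) n m"
proof -
  let ?M = "compile K c"
  let ?s = "\<lambda>n r. if r = 0 then n else 0 :: nat"
  define U where "U n i = set_encode (cell K (?s n) i - {K})" for n i
  have U: "U n i = (if 0 \<le> i \<and> i < int n then 1 else 0)" for n i
  proof -
    have "cell K (?s n) i - {K} = (if 0 \<le> i \<and> i < int n then {0} else {})"
      using K(2) by (auto simp: cell_def split: if_splits)
    then show ?thesis by (simp add: U_def)
  qed
  have le: "set_encode A < Suc (set_encode {..K})" if "A \<subseteq> {..K}" for A
    using that by (simp add: set_encode_mono less_Suc_eq_le)
  have upd1: "(U n)(0 := set_encode (insert K (set_decode (U n 0)))) = tape K (?s n)"
    unfolding tape_def U_def
    by (rule ext) (auto intro!: arg_cong[where f = set_encode])
  have upd2: "(tape K (?s m))(0 := set_encode (set_decode (tape K (?s m) 0) - {K})) = U m"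
    unfolding tape_def U_def by (rule ext) (auto intro!: arg_cong[where f = set_encode])
  have "map_of ?M (0, U n 0) = Some (1, set_encode (insert K (set_decode (U n 0))), Stay)"
    using le[of "cell K (?s n) 0 - {K}"] cell_subset[of K "?s n" 0]
    by (auto simp: compile_def map_of_table_of U_def)
  from reach_step[where T = "U n" and h = 0, OF this, unfolded upd1]
  have 1: "reach ?M (0, U n, 0) (1, tape K (?s n), 0)" by (simp add: reach_refl)
  have 2: "reach ?M (1, tape K (?s n), 0) (1 + psize c, tape K (?s m), 0)"
    using exec_reach[OF assms(1) runs_compile K(1)] .
  have "map_of ?M (1 + psize c, tape K (?s m) 0)
      = Some (psize c + 2, set_encode (set_decode (tape K (?s m) 0) - {K}), Stay)"
    using le[OF cell_subset, of "?s m" 0] by (simp add: compile_def map_of_table_of tape_def)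
  from reach_step[where T = "tape K (?s m)" and h = 0, OF this, unfolded upd2]
  have 3: "reach ?M (1 + psize c, tape K (?s m), 0) (psize c + 2, U m, 0)" by (simp add: reach_refl)
  have start: "tm_start n = (0, U n, 0)" by (simp add: tm_start_def U fun_eq_iff)
  \<comment> \<open>The table only has states below \<open>psize c + 2\<close>, so no entry
    applies.\<close>
  have halt: "tm_step ?M (psize c + 2, U m, 0) = None"
    by (simp add: compile_def map_of_table_of)
  have "{i. U m i = 1} = {0..<int m}" by (auto simp: U)
  then have "card {i. U m i = 1} = m" by simp
  moreover have "reach ?M (tm_start n) (psize c + 2, U m, 0)"
    unfolding start using 1 2 3 by (blast intro: reach_trans)
  ultimately show ?thesis
    unfolding tm_computes_def reach_def using halt by blast
qed

section \<open>Recursive functions\<close>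

text \<open>A program for \<open>P\<close> at base \<open>m\<close> replaces the content of register \<open>m\<close>; the lower registers are a
  protected stack and the higher ones are scratch space, zero before and after.\<close>

definition prog_on :: "nat \<Rightarrow> prog \<Rightarrow> (nat \<Rightarrow> nat \<Rightarrow> bool) \<Rightarrow> bool" where
  "prog_on m c P \<longleftrightarrow> (\<forall>s y. (\<forall>r>m. s r = 0) \<longrightarrow> P (s m) y \<longrightarrow> exec c s (s(m := y)))"

text \<open>A relation instead of a function: on arguments without a value nothing is required, not
  even halting, as in the specification of an entropy algorithm. A program is demanded for every
  base, so that it can be called above a stack of any height.\<close>

definition partial_rec :: "(nat \<Rightarrow> nat \<Rightarrow> bool) \<Rightarrow> bool" where
  "partial_rec P \<longleftrightarrow> (\<forall>m. \<exists>c. prog_on m c P)"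

definition recf :: "(nat \<Rightarrow> nat) \<Rightarrow> bool" where
  "recf f \<longleftrightarrow> partial_rec (\<lambda>x y. y = f x)"

lemma partial_rec_tm:
  assumes "partial_rec P"
  obtains M where "\<And>x y. P x y \<Longrightarrow> tm_computes M x y"
proof -
  obtain c where c: "prog_on 0 c P" using assms unfolding partial_rec_def by blast
  obtain K where K: "K > 0" "regs_below K c" using ex_regs_below by blast
  show thesis
  proof (rule that)
    fix x y assume "P x y"
    then have "exec c (\<lambda>r. if r = 0 then x else 0) ((\<lambda>r. if r = 0 then x else 0)(0 := y))"
      using c unfolding prog_on_def by simp
    also have "(\<lambda>r. if r = 0 then x else 0)(0 := y) = (\<lambda>r. if r = 0 then y else 0)" by auto
    finally show "tm_computes (compile K c) x y" using K by (intro tm_computes_compile)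
  qed
qed

lemma recf_computable:
  assumes "recf f" shows "computable f"
proof -
  obtain M where "\<And>x y. y = f x \<Longrightarrow> tm_computes M x y"
    using partial_rec_tm[OF assms[unfolded recf_def]] by blast
  then show ?thesis unfolding computable_def by blast
qed

lemma recf_prog:
  assumes "recf f"
  obtains c where "\<And>s. (\<And>r. r > m \<Longrightarrow> s r = 0) \<Longrightarrow> exec c s (s(m := f (s m)))"
  using assms unfolding recf_def partial_rec_def prog_on_def by metis

lemma recfI:
  assumes "\<And>m. \<exists>c. \<forall>s. (\<forall>r>m. s r = 0) \<longrightarrow> exec c s (s(m := f (s m)))"
  shows "recf f"
  using assms unfolding recf_def partial_rec_def prog_on_def by metis

subsection \<open>Program fragments\<close>

lemma exec_Inc': "t = s(r := Suc (s r)) \<Longrightarrow> exec (Inc r) s t"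
  by (simp only: exec_Inc)

lemma exec_Dec': "t = s(r := s r - 1) \<Longrightarrow> exec (Dec r) s t"
  by (simp only: exec_Dec)

lemma exec_Seq_Dec: "exec c (s(r := s r - 1)) t \<Longrightarrow> exec (Seq (Dec r) c) s t"
  by (rule exec_Seq[OF exec_Dec])

lemma exec_Seq_Inc: "exec c (s(r := Suc (s r))) t \<Longrightarrow> exec (Seq (Inc r) c) s t"
  by (rule exec_Seq[OF exec_Inc])

text \<open>The trace of the loop is given beforehand as a sequence of states; in the fragments
  below such explicit traces play the part of loop invariants.\<close>

lemma exec_While_seq:
  assumes "\<And>i. i < n \<Longrightarrow> S i a \<noteq> 0" "\<And>i. i < n \<Longrightarrow> exec b (S i) (S (Suc i))" "S n a = 0"
  shows "exec (While a b) (S 0) (S n)"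
proof -
  have "exec (While a b) (S i) (S n)" if "i \<le> n" for i
    using that
  proof (induction rule: inc_induct)
    case base
    then show ?case using assms(3) by (rule exec_While_0)
  next
    case (step i)
    then show ?case using assms(1,2)[of i] by (blast intro: exec_While_Suc)
  qed
  then show ?thesis by simp
qed

definition move :: "nat \<Rightarrow> nat \<Rightarrow> prog" where
  "move a b = While a (Seq (Dec a) (Inc b))"

definition dup :: "nat \<Rightarrow> nat \<Rightarrow> nat \<Rightarrow> prog" where
  "dup a b c = While a (Seq (Dec a) (Seq (Inc b) (Inc c)))"

definition clear :: "nat \<Rightarrow> prog" where
  "clear a = While a (Dec a)"

definition copy :: "nat \<Rightarrow> nat \<Rightarrow> nat \<Rightarrow> prog" where
  "copy a b t = Seq (dup a b t) (move t a)"

lemma exec_move: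
  assumes "a \<noteq> b" "t = s(a := 0, b := s b + s a)"
  shows "exec (move a b) s t"
proof -
  define S where "S i = s(a := s a - i, b := s b + i)" for i
  have "exec (While a (Seq (Dec a) (Inc b))) (S 0) (S (s a))"
  proof (rule exec_While_seq)
    fix i assume "i < s a"
    show "exec (Seq (Dec a) (Inc b)) (S i) (S (Suc i))"
      using assms(1) by (intro exec_Seq_Dec exec_Inc') (auto simp: S_def fun_eq_iff)
  qed (use assms in \<open>auto simp: S_def\<close>)
  moreover have "S 0 = s" "S (s a) = t" using assms by (auto simp: S_def fun_eq_iff)
  ultimately show ?thesis by (simp add: move_def)
qed

lemma exec_dup:
  assumes "a \<noteq> b" "a \<noteq> c" "b \<noteq> c" "t = s(a := 0, b := s b + s a, c := s c + s a)"
  shows "exec (dup a b c) s t"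
proof -
  define S where "S i = s(a := s a - i, b := s b + i, c := s c + i)" for i
  have "exec (While a (Seq (Dec a) (Seq (Inc b) (Inc c)))) (S 0) (S (s a))"
  proof (rule exec_While_seq)
    fix i assume "i < s a"
    show "exec (Seq (Dec a) (Seq (Inc b) (Inc c))) (S i) (S (Suc i))"
      using assms(1-3) by (intro exec_Seq_Dec exec_Seq_Inc exec_Inc') (auto simp: S_def fun_eq_iff)
  qed (use assms in \<open>auto simp: S_def\<close>)
  moreover have "S 0 = s" "S (s a) = t" using assms by (auto simp: S_def fun_eq_iff)
  ultimately show ?thesis by (simp add: dup_def)
qed

lemma exec_clear:
  assumes "t = s(a := 0)"
  shows "exec (clear a) s t"
proof -
  define S where "S i = s(a := s a - i)" for i
  have "exec (While a (Dec a)) (S 0) (S (s a))"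
  proof (rule exec_While_seq)
    fix i assume "i < s a"
    show "exec (Dec a) (S i) (S (Suc i))"
      by (intro exec_Dec') (auto simp: S_def fun_eq_iff)
  qed (auto simp: S_def)
  moreover have "S 0 = s" "S (s a) = t" using assms by (auto simp: S_def fun_eq_iff)
  ultimately show ?thesis by (simp add: clear_def)
qed

lemma exec_copy:
  assumes "a \<noteq> b" "a \<noteq> c" "b \<noteq> c" "s c = 0" "t = s(b := s b + s a)"
  shows "exec (copy a b c) s t"
  unfolding copy_def
proof (rule exec_Seq)
  show "exec (dup a b c) s (s(a := 0, b := s b + s a, c := s a))"
    using assms by (intro exec_dup) auto
  show "exec (move c a) (s(a := 0, b := s b + s a, c := s a)) t"
    using assms by (intro exec_move) (auto simp: fun_eq_iff)
qed

text \<open>Branching has to be simulated by loops that run at most once. Register \<open>f\<close>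
  receives a copy of the tested value and \<open>e\<close> starts at 1; the first branch clears both
  before it runs, so that exactly one of the two loops is entered.\<close>

definition cond :: "nat \<Rightarrow> nat \<Rightarrow> nat \<Rightarrow> nat \<Rightarrow> prog \<Rightarrow> prog \<Rightarrow> prog" where
  "cond r f e t c1 c2 = Seq (copy r f t) (Seq (Inc e)
     (Seq (While f (Seq (clear f) (Seq (Dec e) c1))) (While e (Seq (Dec e) c2))))"

lemma exec_cond:
  assumes d: "r \<noteq> f" "r \<noteq> t" "f \<noteq> e" "f \<noteq> t" "e \<noteq> t" "r \<noteq> e"
    and z: "s f = 0" "s e = 0" "s t = 0" "u f = 0" "u e = 0"
    and c: "s r \<noteq> 0 \<Longrightarrow> exec c1 s u" "s r = 0 \<Longrightarrow> exec c2 s u"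
  shows "exec (cond r f e t c1 c2) s u"
proof -
  have 1: "exec (copy r f t) s (s(f := s r))"
    using d z by (intro exec_copy) auto
  have 2: "exec (Inc e) (s(f := s r)) (s(f := s r, e := 1))"
    using d z by (intro exec_Inc') (auto simp: fun_eq_iff)
  show ?thesis
  proof (cases "s r = 0")
    case True
    have 3: "exec (While f (Seq (clear f) (Seq (Dec e) c1))) (s(f := s r, e := 1)) (s(f := s r, e := 1))"
      using d True by (intro exec_While_0) auto
    have "exec (Dec e) (s(f := s r, e := 1)) s"
      using d z True by (intro exec_Dec') (auto simp: fun_eq_iff)
    from exec_Seq[OF this c(2)[OF True]]
    have 4: "exec (While e (Seq (Dec e) c2)) (s(f := s r, e := 1)) u"
      by (rule exec_While_Suc[rotated]) (use z in \<open>auto intro: exec_While_0\<close>)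
    show ?thesis unfolding cond_def by (rule exec_Seq[OF 1 exec_Seq[OF 2 exec_Seq[OF 3 4]]])
  next
    case False
    have "exec (clear f) (s(f := s r, e := 1)) (s(e := 1))"
      using d z by (intro exec_clear) (auto simp: fun_eq_iff)
    moreover have "exec (Dec e) (s(e := 1)) s"
      using d z by (intro exec_Dec') (auto simp: fun_eq_iff)
    ultimately have "exec (Seq (clear f) (Seq (Dec e) c1)) (s(f := s r, e := 1)) u"
      using exec_Seq c(1)[OF False] by blast
    then have 3: "exec (While f (Seq (clear f) (Seq (Dec e) c1))) (s(f := s r, e := 1)) u"
      by (rule exec_While_Suc[rotated]) (use d False z in \<open>auto intro: exec_While_0\<close>)
    have 4: "exec (While e (Seq (Dec e) c2)) u u"
      using z by (intro exec_While_0)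
    show ?thesis unfolding cond_def by (rule exec_Seq[OF 1 exec_Seq[OF 2 exec_Seq[OF 3 4]]])
  qed
qed

section \<open>Cantor pairing on registers\<close>

lemma prod_decode_0: "prod_decode 0 = (0, 0)"
proof -
  have "prod_encode (0, 0) = 0" by (simp add: prod_encode_def)
  then show ?thesis by (metis prod_encode_inverse)
qed

text \<open>Cantor's enumeration proceeds along the diagonals, from \<open>(a, b + 1)\<close> to
  \<open>(a + 1, b)\<close> and from \<open>(a, 0)\<close> to \<open>(0, a + 1)\<close>. Decoding is
  therefore a loop that counts up to the code.\<close>

lemma prod_decode_Suc:
  "prod_decode (Suc n) =
     (if snd (prod_decode n) = 0 then (0, Suc (fst (prod_decode n)))
      else (Suc (fst (prod_decode n)), snd (prod_decode n) - 1))"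
proof -
  obtain a b where ab: "prod_decode n = (a, b)" by fastforce
  then have n: "n = prod_encode (a, b)" by (metis prod_decode_inverse)
  have "Suc n = prod_encode (if b = 0 then (0, Suc a) else (Suc a, b - 1))"
    unfolding n by (cases b) (auto simp: prod_encode_def)
  then show ?thesis by (simp add: ab)
qed

definition unpack :: "nat \<Rightarrow> prog" where
  "unpack m = While m (Seq (Dec m) (cond (m+2) (m+3) (m+4) (m+5)
     (Seq (Dec (m+2)) (Inc (m+1))) (Seq (move (m+1) (m+2)) (Inc (m+2)))))"

lemma exec_unpack:
  assumes s: "\<And>r. r > m \<Longrightarrow> s r = 0"
    and t: "t = s(m := 0, m+1 := fst (prod_decode (s m)), m+2 := snd (prod_decode (s m)))"
  shows "exec (unpack m) s t"
proof -
  define S where "S i = s(m := s m - i, m+1 := fst (prod_decode i), m+2 := snd (prod_decode i))" for i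
  have "exec (unpack m) (S 0) (S (s m))"
    unfolding unpack_def
  proof (rule exec_While_seq)
    fix i assume i: "i < s m"
    show "S i m \<noteq> 0" using i by (simp add: S_def)
    show "exec (Seq (Dec m) (cond (m+2) (m+3) (m+4) (m+5)
     (Seq (Dec (m+2)) (Inc (m+1))) (Seq (move (m+1) (m+2)) (Inc (m+2))))) (S i) (S (Suc i))"
    proof (rule exec_Seq)
      let ?T = "(S i)(m := S i m - 1)"
      show "exec (Dec m) (S i) ?T" by (rule exec_Dec)
      show "exec (cond (m+2) (m+3) (m+4) (m+5)
        (Seq (Dec (m+2)) (Inc (m+1))) (Seq (move (m+1) (m+2)) (Inc (m+2)))) ?T (S (Suc i))"
      proof (rule exec_cond)
        assume "?T (m+2) \<noteq> 0"
        then show "exec (Seq (Dec (m+2)) (Inc (m+1))) ?T (S (Suc i))"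
          by (intro exec_Seq_Dec exec_Inc') (auto simp: S_def fun_eq_iff prod_decode_Suc)
      next
        assume a: "?T (m+2) = 0"
        show "exec (Seq (move (m+1) (m+2)) (Inc (m+2))) ?T (S (Suc i))"
        proof (rule exec_Seq)
          show "exec (move (m+1) (m+2)) ?T (?T(m+1 := 0, m+2 := ?T (m+2) + ?T (m+1)))"
            by (rule exec_move) auto
          show "exec (Inc (m+2)) (?T(m+1 := 0, m+2 := ?T (m+2) + ?T (m+1))) (S (Suc i))"
            using a by (intro exec_Inc') (auto simp: S_def fun_eq_iff prod_decode_Suc)
        qed
      qed (auto simp: S_def s)
    qed
  qed (auto simp: S_def)
  moreover have "S 0 = s" "S (s m) = t" using s by (auto simp: S_def t fun_eq_iff prod_decode_0)
  ultimately show ?thesis by simp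
qed

text \<open>Since \<open>prod_encode (a, b) = triangle (a + b) + a\<close>, it suffices to add
  \<open>a + b\<close>, \<open>a + b - 1\<close>, ..., 1 to \<open>a\<close>.\<close>

definition pack :: "nat \<Rightarrow> prog" where
  "pack m = Seq (dup (m+1) m (m+2))
     (While (m+2) (Seq (dup (m+2) m (m+3)) (Seq (move (m+3) (m+2)) (Dec (m+2)))))"

lemma triangle_mono: "a \<le> b \<Longrightarrow> triangle a \<le> triangle b"
  by (induction b) (auto simp: le_Suc_eq)

lemma exec_pack:
  assumes s: "s m = 0" "s (m+3) = 0"
    and t: "t = s(m := prod_encode (s (m+1), s (m+2)), m+1 := 0, m+2 := 0)"
  shows "exec (pack m) s t"
proof -
  define n where "n = s (m+1) + s (m+2)"
  define S where "S i = s(m := s (m+1) + (triangle n - triangle (n - i)), m+1 := 0, m+2 := n - i)" for i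
  have "exec (dup (m+1) m (m+2)) s (S 0)"
    using s by (intro exec_dup) (auto simp: S_def n_def fun_eq_iff)
  moreover have "exec (While (m+2) (Seq (dup (m+2) m (m+3)) (Seq (move (m+3) (m+2)) (Dec (m+2))))) (S 0) (S n)"
  proof (rule exec_While_seq)
    fix i assume i: "i < n"
    show "S i (m+2) \<noteq> 0" using i by (simp add: S_def)
    let ?T = "(S i)(m := S i m + (n - i), m+2 := 0, m+3 := n - i)"
    let ?U = "(S i)(m := S i m + (n - i))"
    have 1: "exec (dup (m+2) m (m+3)) (S i) ?T"
      using s by (intro exec_dup) (auto simp: S_def fun_eq_iff)
    have 2: "exec (move (m+3) (m+2)) ?T ?U"
      using s by (intro exec_move) (auto simp: S_def fun_eq_iff)
    obtain j where j: "n - i = Suc j" using i by (metis Suc_diff_Suc)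
    then have "n - Suc i = j" "triangle (Suc j) \<le> triangle n"
      using i triangle_mono[of "Suc j" n] by auto
    with j have 3: "exec (Dec (m+2)) ?U (S (Suc i))"
      by (intro exec_Dec') (auto simp: S_def fun_eq_iff)
    show "exec (Seq (dup (m+2) m (m+3)) (Seq (move (m+3) (m+2)) (Dec (m+2)))) (S i) (S (Suc i))"
      by (rule exec_Seq[OF 1 exec_Seq[OF 2 3]])
  qed (auto simp: S_def)
  moreover have "S n = t" by (auto simp: S_def t n_def prod_encode_def fun_eq_iff)
  ultimately show ?thesis unfolding pack_def by (auto intro: exec_Seq)
qed

subsection \<open>Closure properties\<close>

definition ppair :: "nat \<Rightarrow> nat \<Rightarrow> nat" where "ppair a b = prod_encode (a, b)"
definition pfst :: "nat \<Rightarrow> nat" where "pfst z = fst (prod_decode z)"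
definition psnd :: "nat \<Rightarrow> nat" where "psnd z = snd (prod_decode z)"

lemma pfst_ppair [simp]: "pfst (ppair a b) = a" by (simp add: pfst_def ppair_def)
lemma psnd_ppair [simp]: "psnd (ppair a b) = b" by (simp add: psnd_def ppair_def)

lemma recf_id: "recf (\<lambda>x. x)"
proof (rule recfI)
  fix m
  have "exec (clear (m+1)) s (s(m := s m))" if "\<forall>r>m. s r = 0" for s
    using that by (intro exec_clear) (auto simp: fun_eq_iff)
  then show "\<exists>c. \<forall>s. (\<forall>r>m. s r = 0) \<longrightarrow> exec c s (s(m := s m))" by blast
qed

lemma recf_comp:
  assumes "recf g" "recf f"
  shows "recf (\<lambda>x. g (f x))"
proof (rule recfI)
  fix m
  obtain G where G: "\<And>s. (\<And>r. r > m \<Longrightarrow> s r = 0) \<Longrightarrow> exec G s (s(m := g (s m)))"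
    using recf_prog[OF assms(1), of m] by blast
  obtain F where F: "\<And>s. (\<And>r. r > m \<Longrightarrow> s r = 0) \<Longrightarrow> exec F s (s(m := f (s m)))"
    using recf_prog[OF assms(2), of m] by blast
  have "exec (Seq F G) s (s(m := g (f (s m))))" if "\<forall>r>m. s r = 0" for s
    using exec_Seq[OF F[of s] G[of "s(m := f (s m))"]] that by simp
  then show "\<exists>c. \<forall>s. (\<forall>r>m. s r = 0) \<longrightarrow> exec c s (s(m := g (f (s m))))" by blast
qed

lemma recf_Suc:
  assumes "recf f" shows "recf (\<lambda>x. Suc (f x))"
proof -
  have "recf Suc" by (rule recfI) (blast intro: exec_Inc)
  from recf_comp[OF this assms] show ?thesis .
qed

lemma recf_const: "recf (\<lambda>x. k)"
proof (induction k)
  case 0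
  show ?case by (rule recfI) (blast intro: exec_clear)
next
  case (Suc k)
  then show ?case by (rule recf_Suc)
qed

lemma recf_ppair:
  assumes "recf f" "recf g"
  shows "recf (\<lambda>x. ppair (f x) (g x))"
proof (rule recfI)
  fix m
  obtain F where F: "\<And>s. (\<And>r. r > m+1 \<Longrightarrow> s r = 0) \<Longrightarrow> exec F s (s(m+1 := f (s (m+1))))"
    using recf_prog[OF assms(1), of "m+1"] by blast
  obtain G where G: "\<And>s. (\<And>r. r > m+2 \<Longrightarrow> s r = 0) \<Longrightarrow> exec G s (s(m+2 := g (s (m+2))))"
    using recf_prog[OF assms(2), of "m+2"] by blast
  have "exec (Seq (copy m (m+1) (m+2)) (Seq F (Seq (copy m (m+2) (m+3)) (Seq G (Seq (clear m) (pack m))))))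
     s (s(m := ppair (f (s m)) (g (s m))))" if z: "\<forall>r>m. s r = 0" for s
  proof -
    let ?x = "s m"
    have 1: "exec (copy m (m+1) (m+2)) s (s(m+1 := ?x))"
      using z by (intro exec_copy) auto
    have 2: "exec F (s(m+1 := ?x)) (s(m+1 := f ?x))"
      using F[of "s(m+1 := ?x)"] z by auto
    have 3: "exec (copy m (m+2) (m+3)) (s(m+1 := f ?x)) (s(m+1 := f ?x, m+2 := ?x))"
      using z by (intro exec_copy) auto
    have 4: "exec G (s(m+1 := f ?x, m+2 := ?x)) (s(m+1 := f ?x, m+2 := g ?x))"
      using G[of "s(m+1 := f ?x, m+2 := ?x)"] z by auto
    let ?t = "s(m := 0, m+1 := f ?x, m+2 := g ?x)"
    have 5: "exec (clear m) (s(m+1 := f ?x, m+2 := g ?x)) ?t"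
      by (intro exec_clear) (auto simp: fun_eq_iff)
    have 6: "exec (pack m) ?t (s(m := ppair (f ?x) (g ?x)))"
      using z by (intro exec_pack) (auto simp: fun_eq_iff ppair_def)
    show ?thesis by (rule exec_Seq[OF 1 exec_Seq[OF 2 exec_Seq[OF 3 exec_Seq[OF 4 exec_Seq[OF 5 6]]]]])
  qed
  then show "\<exists>c. \<forall>s. (\<forall>r>m. s r = 0) \<longrightarrow> exec c s (s(m := ppair (f (s m)) (g (s m))))" by blast
qed

lemma recf_pfst:
  assumes "recf f" shows "recf (\<lambda>x. pfst (f x))"
proof -
  have "recf pfst"
  proof (rule recfI)
    fix m
    have "exec (Seq (unpack m) (Seq (clear (m+2)) (move (m+1) m))) s (s(m := pfst (s m)))"
      if z: "\<forall>r>m. s r = 0" for s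
    proof -
      let ?t = "s(m := 0, m+1 := fst (prod_decode (s m)), m+2 := snd (prod_decode (s m)))"
      have 1: "exec (unpack m) s ?t" using z by (intro exec_unpack) auto
      have 2: "exec (clear (m+2)) ?t (s(m := 0, m+1 := fst (prod_decode (s m))))"
        using z by (intro exec_clear) (auto simp: fun_eq_iff)
      have 3: "exec (move (m+1) m) (s(m := 0, m+1 := fst (prod_decode (s m)))) (s(m := pfst (s m)))"
        using z by (intro exec_move) (auto simp: fun_eq_iff pfst_def)
      show ?thesis by (rule exec_Seq[OF 1 exec_Seq[OF 2 3]])
    qed
    then show "\<exists>c. \<forall>s. (\<forall>r>m. s r = 0) \<longrightarrow> exec c s (s(m := pfst (s m)))" by blast
  qed
  from recf_comp[OF this assms] show ?thesis .
qed

lemma recf_psnd: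
  assumes "recf f" shows "recf (\<lambda>x. psnd (f x))"
proof -
  have "recf psnd"
  proof (rule recfI)
    fix m
    have "exec (Seq (unpack m) (Seq (clear (m+1)) (move (m+2) m))) s (s(m := psnd (s m)))"
      if z: "\<forall>r>m. s r = 0" for s
    proof -
      let ?t = "s(m := 0, m+1 := fst (prod_decode (s m)), m+2 := snd (prod_decode (s m)))"
      have 1: "exec (unpack m) s ?t" using z by (intro exec_unpack) auto
      have 2: "exec (clear (m+1)) ?t (s(m := 0, m+2 := snd (prod_decode (s m))))"
        using z by (intro exec_clear) (auto simp: fun_eq_iff)
      have 3: "exec (move (m+2) m) (s(m := 0, m+2 := snd (prod_decode (s m)))) (s(m := psnd (s m)))"
        using z by (intro exec_move) (auto simp: fun_eq_iff psnd_def)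
      show ?thesis by (rule exec_Seq[OF 1 exec_Seq[OF 2 3]])
    qed
    then show "\<exists>c. \<forall>s. (\<forall>r>m. s r = 0) \<longrightarrow> exec c s (s(m := psnd (s m)))" by blast
  qed
  from recf_comp[OF this assms] show ?thesis .
qed

lemma recf_iterate:
  assumes "recf f"
  shows "recf (\<lambda>z. (f ^^ pfst z) (psnd z))"
proof (rule recfI)
  fix m
  obtain F where F: "\<And>s. (\<And>r. r > m+2 \<Longrightarrow> s r = 0) \<Longrightarrow> exec F s (s(m+2 := f (s (m+2))))"
    using recf_prog[OF assms, of "m+2"] by blast
  have "exec (Seq (unpack m) (Seq (While (m+1) (Seq (Dec (m+1)) F)) (move (m+2) m)))
      s (s(m := (f ^^ pfst (s m)) (psnd (s m))))" if z: "\<forall>r>m. s r = 0" for s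
  proof -
    let ?n = "pfst (s m)" and ?x = "psnd (s m)"
    define S where "S i = s(m := 0, m+1 := ?n - i, m+2 := (f ^^ i) ?x)" for i
    have 1: "exec (unpack m) s (S 0)"
      using z by (intro exec_unpack) (auto simp: S_def pfst_def psnd_def)
    have 2: "exec (While (m+1) (Seq (Dec (m+1)) F)) (S 0) (S ?n)"
    proof (rule exec_While_seq)
      fix i assume i: "i < ?n"
      let ?T = "(S i)(m+1 := S i (m+1) - 1)"
      have "exec F ?T (?T(m+2 := f (?T (m+2))))" using z by (intro F) (auto simp: S_def)
      also have "?T(m+2 := f (?T (m+2))) = S (Suc i)" by (auto simp: S_def fun_eq_iff)
      finally show "exec (Seq (Dec (m+1)) F) (S i) (S (Suc i))" by (rule exec_Seq_Dec)
    qed (auto simp: S_def)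
    have 3: "exec (move (m+2) m) (S ?n) (s(m := (f ^^ ?n) ?x))"
      using z by (intro exec_move) (auto simp: S_def fun_eq_iff)
    show ?thesis by (rule exec_Seq[OF 1 exec_Seq[OF 2 3]])
  qed
  then show "\<exists>c. \<forall>s. (\<forall>r>m. s r = 0) \<longrightarrow> exec c s (s(m := (f ^^ pfst (s m)) (psnd (s m))))" by blast
qed

text \<open>All unbounded searches below reduce to this loop: iterate \<open>f\<close> until the
  test \<open>c\<close> vanishes, and return the point reached.\<close>

lemma partial_rec_while:
  assumes "recf f" "recf c"
  shows "partial_rec (\<lambda>z y. \<exists>n. y = (f ^^ n) z \<and> c y = 0 \<and> (\<forall>i<n. c ((f ^^ i) z) \<noteq> 0))"
  unfolding partial_rec_def
proof
  fix m
  obtain F where F: "\<And>s. (\<And>r. r > m \<Longrightarrow> s r = 0) \<Longrightarrow> exec F s (s(m := f (s m)))"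
    using recf_prog[OF assms(1), of "m"] by blast
  obtain C where C: "\<And>s. (\<And>r. r > m+1 \<Longrightarrow> s r = 0) \<Longrightarrow> exec C s (s(m+1 := c (s (m+1))))"
    using recf_prog[OF assms(2), of "m+1"] by blast
  let ?T = "Seq (copy m (m+1) (m+2)) C"
  have T: "exec ?T s (s(m+1 := c (s m)))" if z: "\<forall>r>m. s r = 0" for s
  proof -
    have "exec (copy m (m+1) (m+2)) s (s(m+1 := s m))"
      using z by (intro exec_copy) auto
    moreover have "exec C (s(m+1 := s m)) (s(m+1 := c (s m)))"
      using C[of "s(m+1 := s m)"] z by auto
    ultimately show ?thesis by (rule exec_Seq)
  qed
  have "exec (Seq ?T (While (m+1) (Seq (clear (m+1)) (Seq F ?T)))) s (s(m := y))"
    if z: "\<forall>r>m. s r = 0" and y: "y = (f ^^ n) (s m)" "c y = 0"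
      and n: "\<forall>i<n. c ((f ^^ i) (s m)) \<noteq> 0" for s y n
  proof -
    let ?x = "s m"
    define S where "S i = s(m := (f ^^ i) ?x, m+1 := c ((f ^^ i) ?x))" for i
    have 1: "exec ?T s (S 0)" using T[OF z] by (simp add: S_def)
    have 2: "exec (While (m+1) (Seq (clear (m+1)) (Seq F ?T))) (S 0) (S n)"
    proof (rule exec_While_seq)
      fix i assume i: "i < n"
      show "S i (m+1) \<noteq> 0" using n i by (simp add: S_def)
      let ?U = "s(m := (f ^^ i) ?x)" and ?V = "s(m := (f ^^ Suc i) ?x)"
      have a: "exec (clear (m+1)) (S i) ?U"
        using z by (intro exec_clear) (auto simp: S_def fun_eq_iff)
      have b: "exec F ?U ?V" using F[of ?U] z by simp
      have c: "exec ?T ?V (S (Suc i))" using T[of ?V] z by (simp add: S_def)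
      show "exec (Seq (clear (m+1)) (Seq F ?T)) (S i) (S (Suc i))"
        by (rule exec_Seq[OF a exec_Seq[OF b c]])
    qed (use y in \<open>auto simp: S_def\<close>)
    have "S n = s(m := y)" using y z by (auto simp: S_def fun_eq_iff)
    with 1 2 show ?thesis by (metis exec_Seq)
  qed
  then show "\<exists>p. prog_on m p (\<lambda>z y. \<exists>n. y = (f ^^ n) z \<and> c y = 0 \<and> (\<forall>i<n. c ((f ^^ i) z) \<noteq> 0))"
    unfolding prog_on_def by blast
qed

lemma partial_rec_comp:
  assumes "partial_rec P" "recf f" "recf g"
  shows "partial_rec (\<lambda>x y. \<exists>z. P (f x) z \<and> y = g z)"
  unfolding partial_rec_def
proof
  fix m
  obtain F where F: "\<And>s. (\<And>r. r > m \<Longrightarrow> s r = 0) \<Longrightarrow> exec F s (s(m := f (s m)))"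
    using recf_prog[OF assms(2), of "m"] by blast
  obtain G where G: "\<And>s. (\<And>r. r > m \<Longrightarrow> s r = 0) \<Longrightarrow> exec G s (s(m := g (s m)))"
    using recf_prog[OF assms(3), of "m"] by blast
  obtain p where p: "prog_on m p P" using assms(1) unfolding partial_rec_def by blast
  have "exec (Seq F (Seq p G)) s (s(m := g z))" if z: "\<forall>r>m. s r = 0" and "P (f (s m)) z" for s z
  proof -
    have "exec p (s(m := f (s m))) (s(m := z))"
      using p[unfolded prog_on_def, rule_format, of "s(m := f (s m))" z] that by simp
    moreover have "exec F s (s(m := f (s m)))" "exec G (s(m := z)) (s(m := g z))"
      using F[of s] G[of "s(m := z)"] z by auto
    ultimately show ?thesis using exec_Seq by blast
  qed
  then show "\<exists>c. prog_on m c (\<lambda>x y. \<exists>z. P (f x) z \<and> y = g z)"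
    unfolding prog_on_def by blast
qed

lemma partial_rec_mono: "partial_rec P \<Longrightarrow> (\<And>x y. Q x y \<Longrightarrow> P x y) \<Longrightarrow> partial_rec Q"
  unfolding partial_rec_def prog_on_def by meson

lemma partial_rec_total: "partial_rec P \<Longrightarrow> (\<And>x. P x (f x)) \<Longrightarrow> recf f"
  unfolding recf_def by (erule partial_rec_mono) simp

text \<open>A function of several arguments is presented as a function of a pair code; substitution
  of recursive arguments is then a composition.\<close>

lemma recf_comp2:
  assumes "recf (\<lambda>z. F (pfst z) (psnd z))" "recf f" "recf g"
  shows "recf (\<lambda>x. F (f x) (g x))"
  using recf_comp[OF assms(1) recf_ppair[OF assms(2,3)]] by simp

lemma recf_comp3:
  assumes "recf (\<lambda>z. F (pfst z) (pfst (psnd z)) (psnd (psnd z)))" "recf f" "recf g" "recf h"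
  shows "recf (\<lambda>x. F (f x) (g x) (h x))"
  using recf_comp[OF assms(1) recf_ppair[OF assms(2) recf_ppair[OF assms(3,4)]]] by simp

lemma recf_comp4:
  assumes "recf (\<lambda>z. F (pfst z) (pfst (psnd z)) (pfst (psnd (psnd z))) (psnd (psnd (psnd z))))"
    "recf f" "recf g" "recf h" "recf i"
  shows "recf (\<lambda>x. F (f x) (g x) (h x) (i x))"
  using recf_comp[OF assms(1) recf_ppair[OF assms(2) recf_ppair[OF assms(3) recf_ppair[OF assms(4,5)]]]]
  by simp

text \<open>Iteration on triples \<open>(x, i, y)\<close>: the parameter \<open>x\<close> is carried
  along because \<open>h\<close> may consult it at every step.\<close>

lemma recf_rec_nat:
  assumes n: "recf n" and a: "recf a"
    and h: "recf (\<lambda>z. h (pfst z) (pfst (psnd z)) (psnd (psnd z)))"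
  shows "recf (\<lambda>x. rec_nat (a x) (\<lambda>i y. h x i y) (n x))"
proof -
  define G where "G z = ppair (pfst z) (ppair (Suc (pfst (psnd z)))
    (h (pfst z) (pfst (psnd z)) (psnd (psnd z))))" for z
  have G: "recf G"
    unfolding G_def by (intro recf_ppair recf_Suc recf_pfst recf_psnd recf_id h)
  have it: "(G ^^ k) (ppair x (ppair 0 b)) = ppair x (ppair k (rec_nat b (h x) k))" for k x b
    by (induction k) (auto simp: G_def)
  have "recf (\<lambda>x. psnd (psnd ((G ^^ pfst (ppair (n x) (ppair x (ppair 0 (a x)))))
     (psnd (ppair (n x) (ppair x (ppair 0 (a x))))))))"
    by (intro recf_psnd recf_comp[OF recf_iterate[OF G]] recf_ppair n a recf_id recf_const)
  then show ?thesis by (simp add: it)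
qed

section \<open>Arithmetic and decidable predicates\<close>

lemma recf_add: assumes "recf f" "recf g" shows "recf (\<lambda>x. f x + g x)"
proof -
  have "a + b = rec_nat a (\<lambda>i y. Suc y) b" for a b :: nat by (induction b) auto
  then show ?thesis
    by (simp only:) (intro recf_rec_nat recf_Suc recf_psnd recf_id assms)
qed

lemma recf_diff: assumes "recf f" "recf g" shows "recf (\<lambda>x. f x - g x)"
proof -
  have 1: "b - 1 = rec_nat 0 (\<lambda>i y. i) b" for b :: nat by (cases b) auto
  have "a - b = rec_nat a (\<lambda>i y. y - 1) b" for a b :: nat by (induction b) auto
  then have "a - b = rec_nat a (\<lambda>i y. rec_nat 0 (\<lambda>i y. i) y) b" for a b :: nat
    unfolding 1 .
  then show ?thesis
    by (simp only:) (intro recf_rec_nat recf_const recf_psnd recf_pfst recf_id assms)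
qed

lemma recf_mult: assumes "recf f" "recf g" shows "recf (\<lambda>x. f x * g x)"
proof -
  have "a * b = rec_nat 0 (\<lambda>i y. y + a) b" for a b :: nat by (induction b) auto
  then show ?thesis
    by (simp only:) (intro recf_rec_nat recf_const recf_add recf_psnd recf_pfst recf_id assms
      recf_comp[OF assms(1)])
qed

lemma recf_power: assumes "recf f" "recf g" shows "recf (\<lambda>x. f x ^ g x)"
proof -
  have "a ^ b = rec_nat 1 (\<lambda>i y. y * a) b" for a b :: nat by (induction b) auto
  then show ?thesis
    by (simp only:) (intro recf_rec_nat recf_const recf_mult recf_psnd recf_pfst recf_id assms
      recf_comp[OF assms(1)])
qed

abbreviation recp :: "(nat \<Rightarrow> bool) \<Rightarrow> bool" where
  "recp P \<equiv> recf (\<lambda>x. of_bool (P x))"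

lemma recp_le: assumes "recf f" "recf g" shows "recp (\<lambda>x. f x \<le> g x)"
proof -
  have "of_bool (a \<le> b) = 1 - (a - b)" for a b :: nat by auto
  then show ?thesis by (simp only:) (intro recf_diff recf_const assms)
qed

lemma recp_less: assumes "recf f" "recf g" shows "recp (\<lambda>x. f x < g x)"
  unfolding less_eq_Suc_le by (intro recp_le recf_Suc assms)

lemma recp_not: assumes "recp P" shows "recp (\<lambda>x. \<not> P x)"
proof -
  have "of_bool (\<not> b) = 1 - (of_bool b :: nat)" for b by auto
  then show ?thesis by (simp only:) (intro recf_diff recf_const assms)
qed

lemma recp_conj: assumes "recp P" "recp Q" shows "recp (\<lambda>x. P x \<and> Q x)"
  unfolding of_bool_conj by (intro recf_mult assms)

lemma recp_disj: assumes "recp P" "recp Q" shows "recp (\<lambda>x. P x \<or> Q x)"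
proof -
  have "(b \<or> c) = (\<not> (\<not> b \<and> \<not> c))" for b c by auto
  then show ?thesis by (simp only:) (intro recp_not recp_conj assms)
qed

lemma recp_imp: assumes "recp P" "recp Q" shows "recp (\<lambda>x. P x \<longrightarrow> Q x)"
proof -
  have "(b \<longrightarrow> c) = (\<not> b \<or> c)" for b c by auto
  then show ?thesis by (simp only:) (intro recp_not recp_disj assms)
qed

lemma recp_eq: assumes "recf f" "recf g" shows "recp (\<lambda>x. f x = g x)"
  unfolding order_eq_iff[where 'a = nat] by (intro recp_conj recp_le assms)

lemma recf_if: assumes "recp P" "recf f" "recf g" shows "recf (\<lambda>x. if P x then f x else g x)"
proof -
  have "(if b then c else d) = of_bool b * c + (1 - of_bool b) * d" for b and c d :: nat by auto
  then show ?thesis by (simp only:) (intro recf_add recf_mult recf_diff recf_const assms)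
qed

lemma recf_sum:
  assumes "recf n" "recf (\<lambda>z. h (pfst z) (psnd z))"
  shows "recf (\<lambda>x. sum (\<lambda>i. h x i) {..<n x})"
proof -
  have "sum g {..<k} = rec_nat 0 (\<lambda>i y. y + g i) k" for g :: "nat \<Rightarrow> nat" and k
    by (induction k) auto
  then show ?thesis
    by (simp only:) (intro recf_rec_nat recf_const recf_add recf_psnd recf_pfst recf_id assms(1)
      recf_comp2[OF assms(2)])
qed

lemma recp_all_less:
  assumes "recf n" "recp (\<lambda>z. P (pfst z) (psnd z))"
  shows "recp (\<lambda>x. \<forall>i<n x. P x i)"
proof -
  have "(\<forall>i<k. Q i) = ((\<Sum>i<k. of_bool (\<not> Q i)) = (0::nat))" for Q and k :: nat by auto
  then show ?thesis
    by (simp only:) (intro recp_eq recf_sum recf_const recp_not assms)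
qed

lemma recp_ex_less:
  assumes "recf n" "recp (\<lambda>z. P (pfst z) (psnd z))"
  shows "recp (\<lambda>x. \<exists>i<n x. P x i)"
proof -
  have "(\<exists>i<k. Q i) = (\<not> (\<forall>i<k. \<not> Q i))" for Q and k :: nat by auto
  then show ?thesis
    by (simp only:) (intro recp_not recp_all_less assms)
qed

lemma recf_div: assumes "recf f" "recf g" shows "recf (\<lambda>x. f x div g x)"
proof -
  \<comment> \<open>The quotient counts the positive multiples of \<open>b\<close> up to
    \<open>a\<close>; for \<open>b = 0\<close> it is 0 by convention.\<close>
  have "a div b = (if b = 0 then 0 else \<Sum>i<a. of_bool (Suc i * b \<le> a))" for a b :: nat
  proof (cases "b = 0")
    case False
    have "(\<Sum>i<a. of_bool (Suc i * b \<le> a)) = card ({..<a} \<inter> {i. Suc i * b \<le> a})"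
      by (simp add: Int_def)
    also have "{..<a} \<inter> {i. Suc i * b \<le> a} = {..<a div b}"
    proof (intro equalityI subsetI)
      fix i assume "i \<in> {..<a div b}"
      then have "Suc i \<le> a div b" by auto
      moreover from this have "Suc i * b \<le> a" using False less_eq_div_iff_mult_less_eq[of b] by simp
      moreover have "Suc i \<le> a"
        using \<open>Suc i \<le> a div b\<close> div_le_dividend by (rule order_trans)
      ultimately show "i \<in> {..<a} \<inter> {i. Suc i * b \<le> a}" by auto
    next
      fix i assume "i \<in> {..<a} \<inter> {i. Suc i * b \<le> a}"
      then have "Suc i \<le> a div b" using False less_eq_div_iff_mult_less_eq[of b] by simp
      then show "i \<in> {..<a div b}" by simp
    qed
    finally show ?thesis using False by simp
  qed simp
  then show ?thesis
    by (simp only:) (intro recf_if recp_eq recf_const recf_sum recp_le recf_mult recf_Suc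
      recf_pfst recf_psnd recf_id assms recf_comp[OF assms(1)] recf_comp[OF assms(2)])
qed

lemma recf_mod: assumes "recf f" "recf g" shows "recf (\<lambda>x. f x mod g x)"
  unfolding modulo_nat_def by (intro recf_diff recf_mult recf_div assms)

lemmas recf_intros = recf_id recf_const recf_Suc recf_ppair recf_pfst recf_psnd recf_add recf_diff
  recf_mult recf_power recp_le recp_less recp_not recp_conj recp_disj recp_imp recp_eq recf_if
  recf_sum recp_all_less recp_ex_less recf_div recf_mod recf_rec_nat

text \<open>The search walks through the pairs \<open>(x, T)\<close>; keeping \<open>x\<close> lets
  \<open>g\<close> use both the argument and the witness found. No value is claimed where there is
  no witness.\<close>

lemma partial_rec_Least:
  assumes P: "recp (\<lambda>z. P (pfst z) (psnd z))" and g: "recf (\<lambda>z. g (pfst z) (psnd z))"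
  shows "partial_rec (\<lambda>x y. (\<exists>T. P x T) \<and> y = g x (LEAST T. P x T))"
proof (rule partial_rec_mono)
  define F where "F z = ppair (pfst z) (Suc (psnd z))" for z
  define C where "C z = (of_bool (\<not> P (pfst z) (psnd z)) :: nat)" for z
  have F: "recf F" and C: "recf C"
    unfolding F_def C_def by (intro recf_intros P)+
  have Fn: "(F ^^ n) (ppair x 0) = ppair x n" for n x
    by (induction n) (auto simp: F_def)
  let ?Q = "\<lambda>x y. \<exists>z. (\<exists>n. z = (F ^^ n) (ppair x 0) \<and> C z = 0 \<and> (\<forall>i<n. C ((F ^^ i) (ppair x 0)) \<noteq> 0))
     \<and> y = g (pfst z) (psnd z)"
  show "partial_rec ?Q"
    using partial_rec_comp[OF partial_rec_while[OF F C] recf_ppair[OF recf_id recf_const[of 0]] g] .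
  fix x y assume a: "(\<exists>T. P x T) \<and> y = g x (LEAST T. P x T)"
  define T where "T = (LEAST T. P x T)"
  have "P x T" using a unfolding T_def by (blast intro: LeastI)
  moreover have "\<not> P x i" if "i < T" for i using that unfolding T_def by (rule not_less_Least)
  ultimately have "ppair x T = (F ^^ T) (ppair x 0) \<and> C (ppair x T) = 0
      \<and> (\<forall>i<T. C ((F ^^ i) (ppair x 0)) \<noteq> 0)"
    by (simp add: Fn C_def)
  moreover have "y = g (pfst (ppair x T)) (psnd (ppair x T))" using a by (simp add: T_def)
  ultimately show "?Q x y" by blast
qed

lemma recf_Least:
  assumes "recp (\<lambda>z. P (pfst z) (psnd z))" "\<And>x. \<exists>T. P x T"
  shows "recf (\<lambda>x. LEAST T. P x T)"
proof (rule partial_rec_total)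
  show "partial_rec (\<lambda>x y. (\<exists>T. P x T) \<and> y = (LEAST T. P x T))"
    by (rule partial_rec_Least[where g = "\<lambda>x T. T"]) (intro recf_intros assms(1))+
qed (simp add: assms(2))

subsection \<open>Lists\<close>

definition lcons :: "nat \<Rightarrow> nat \<Rightarrow> nat" where "lcons a c = Suc (ppair a c)"
definition lhd :: "nat \<Rightarrow> nat" where "lhd c = pfst (c - 1)"
definition ltl :: "nat \<Rightarrow> nat" where "ltl c = psnd (c - 1)"
text \<open>Positions beyond the end read 0, the blank symbol, so that a finite list can stand for a
  half-infinite tape.\<close>

definition lnth :: "nat \<Rightarrow> nat \<Rightarrow> nat" where "lnth c i = lhd ((ltl ^^ i) c)"
definition llen :: "nat \<Rightarrow> nat" where "llen c = length (list_decode c)"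

lemma lhd_0 [simp]: "lhd 0 = 0" and ltl_0 [simp]: "ltl 0 = 0"
  by (simp_all add: lhd_def ltl_def pfst_def psnd_def prod_decode_0)

lemma lhd_lcons [simp]: "lhd (lcons a c) = a" and ltl_lcons [simp]: "ltl (lcons a c) = c"
  by (simp_all add: lhd_def ltl_def lcons_def)

lemma list_encode_lcons: "list_encode (a # xs) = lcons a (list_encode xs)"
  by (simp add: lcons_def ppair_def)

lemma ltl_list_encode [simp]: "ltl (list_encode xs) = list_encode (tl xs)"
  by (cases xs) (simp_all add: list_encode_lcons del: list_encode.simps(2))

lemma ltl_funpow: "(ltl ^^ i) (list_encode xs) = list_encode (drop i xs)"
  by (induction i) (auto simp: drop_Suc tl_drop)

lemma lhd_list_encode: "lhd (list_encode xs) = (if xs = [] then 0 else hd xs)"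
  by (cases xs) (simp_all add: list_encode_lcons del: list_encode.simps(2))

lemma lnth_list_encode: "lnth (list_encode xs) i = (if i < length xs then xs ! i else 0)"
  by (simp add: lnth_def ltl_funpow lhd_list_encode hd_drop_conv_nth)

lemma llen_list_encode [simp]: "llen (list_encode xs) = length xs"
  by (simp add: llen_def)

lemma lnth_0: "lnth c 0 = lhd c" and lnth_Suc: "lnth c (Suc i) = lnth (ltl c) i"
  by (simp_all add: lnth_def funpow_swap1)

lemma lnth_lcons: "lnth (lcons a c) i = (case i of 0 \<Rightarrow> a | Suc j \<Rightarrow> lnth c j)"
  by (cases i) (simp_all add: lnth_0 lnth_Suc)

lemma lnth_llen: "llen c \<le> i \<Longrightarrow> lnth c i = 0"
  by (metis list_decode_inverse lnth_list_encode llen_list_encode not_le)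

lemma length_le_list_encode: "length xs \<le> list_encode xs"
  by (induction xs) (auto intro: order_trans[OF _ le_prod_encode_2])

text \<open>The length is the number of nonempty iterated tails. A code is at least as large as the
  length of its list, so \<open>c\<close> itself bounds the sum.\<close>

lemma llen_sum: "llen c = (\<Sum>i<c. of_bool ((ltl ^^ i) c \<noteq> 0))"
proof -
  obtain xs where c: "c = list_encode xs" by (metis list_decode_inverse)
  have ne: "list_encode ys = 0 \<longleftrightarrow> ys = []" for ys by (cases ys) auto
  have "(\<Sum>i<c. of_bool ((ltl ^^ i) c \<noteq> 0)) = card ({..<c} \<inter> {i. (ltl ^^ i) c \<noteq> 0})"
    by (simp add: Int_def)
  also have "{..<c} \<inter> {i. (ltl ^^ i) c \<noteq> 0} = {..<length xs}"
    using length_le_list_encode[of xs] by (auto simp: c ltl_funpow ne)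
  finally show ?thesis by (simp add: c)
qed

lemma recf_lcons: "recf f \<Longrightarrow> recf g \<Longrightarrow> recf (\<lambda>x. lcons (f x) (g x))"
  unfolding lcons_def by (intro recf_intros)

lemma recf_lhd: "recf f \<Longrightarrow> recf (\<lambda>x. lhd (f x))"
  unfolding lhd_def by (intro recf_intros)

lemma recf_ltl: "recf f \<Longrightarrow> recf (\<lambda>x. ltl (f x))"
  unfolding ltl_def by (intro recf_intros)

lemma funpow_rec_nat: "(f ^^ i) c = rec_nat c (\<lambda>_ y. f y) i"
  by (induction i) auto

lemma recf_lnth: "recf f \<Longrightarrow> recf g \<Longrightarrow> recf (\<lambda>x. lnth (f x) (g x))"
  unfolding lnth_def funpow_rec_nat by (intro recf_intros recf_lhd recf_ltl)

lemma recf_llen: assumes "recf f" shows "recf (\<lambda>x. llen (f x))"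
  unfolding llen_sum funpow_rec_nat by (intro recf_intros recf_ltl recf_comp[OF assms] assms)

lemma recf_map_upt:
  assumes "recf n" "recf (\<lambda>z. h (pfst z) (psnd z))"
  shows "recf (\<lambda>x. list_encode (map (\<lambda>i. h x i) [0..<n x]))"
proof -
  \<comment> \<open>Lists grow at their head, so the recursion starts from the last entry.\<close>
  have "rec_nat 0 (\<lambda>i y. lcons (g (k - Suc i)) y) j = list_encode (map g [k - j..<k])"
    if "j \<le> k" for g and j k :: nat
    using that
  proof (induction j)
    case (Suc j)
    then have "[k - Suc j..<k] = (k - Suc j) # [k - j..<k]"
      by (simp add: upt_rec[of "k - Suc j"] Suc_diff_Suc)
    with Suc show ?case by (simp add: list_encode_lcons del: list_encode.simps(2))
  qed simp
  from this[of k k for k]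
  have "list_encode (map g [0..<k]) = rec_nat 0 (\<lambda>i y. lcons (g (k - Suc i)) y) k" for g k
    by simp
  then show ?thesis
    by (simp only:) (intro recf_intros recf_lcons recf_comp2[OF assms(2)] recf_comp[OF assms(1)] assms(1))
qed

lemmas recf_list_intros = recf_lcons recf_lhd recf_ltl recf_lnth recf_llen recf_map_upt

section \<open>A universal function\<close>

text \<open>The table is read from its last entry to its first, so that an earlier match overwrites
  a later one, in agreement with \<open>map_of\<close>. The successor of the entry is returned,
  which leaves 0 for the absence of a match.\<close>

definition lookup :: "nat \<Rightarrow> nat \<Rightarrow> nat" where
  "lookup e key = rec_nat 0 (\<lambda>i y. if pfst (lnth e (llen e - Suc i)) = key
     then Suc (lnth e (llen e - Suc i)) else y) (llen e)"

lemma lookup_list_encode: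
  "lookup (list_encode xs) key = (case find (\<lambda>c. pfst c = key) xs of None \<Rightarrow> 0 | Some c \<Rightarrow> Suc c)"
proof -
  let ?n = "length xs"
  have "rec_nat 0 (\<lambda>i y. if pfst (lnth (list_encode xs) (?n - Suc i)) = key
     then Suc (lnth (list_encode xs) (?n - Suc i)) else y) j
     = (case find (\<lambda>c. pfst c = key) (drop (?n - j) xs) of None \<Rightarrow> 0 | Some c \<Rightarrow> Suc c)"
    if "j \<le> ?n" for j
    using that
  proof (induction j)
    case (Suc j)
    then have "drop (?n - Suc j) xs = xs ! (?n - Suc j) # drop (?n - j) xs"
      by (metis Cons_nth_drop_Suc Suc_diff_Suc Suc_le_lessD diff_less zero_less_Suc order.strict_trans2 less_le_trans)
    moreover have "?n - Suc j < ?n" using Suc.prems by auto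
    ultimately show ?case using Suc by (simp add: lnth_list_encode)
  qed simp
  from this[of ?n] show ?thesis unfolding lookup_def llen_list_encode by simp
qed

lemma map_of_nth_tm:
  "map_of (nth_tm e) (q, s) = (if lookup e (ppair q s) = 0 then None
     else Some (snd (entry_of_nat (lookup e (ppair q s) - 1))))"
proof -
  have key: "fst (entry_of_nat c) = (q, s) \<longleftrightarrow> pfst c = ppair q s" for c
  proof -
    have "fst (entry_of_nat c) = prod_decode (pfst c)"
      by (simp add: entry_of_nat_def pfst_def split: prod.splits)
    then show ?thesis by (metis ppair_def prod_decode_inverse prod_encode_inverse)
  qed
  have "map_of (map entry_of_nat xs) (q, s)
      = map_option (\<lambda>c. snd (entry_of_nat c)) (find (\<lambda>c. pfst c = ppair q s) xs)" for xs
  proof (induction xs)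
    case (Cons c xs)
    then show ?case using key[of c] by (cases "entry_of_nat c") auto
  qed simp
  moreover obtain xs where "e = list_encode xs" by (metis list_decode_inverse)
  ultimately show ?thesis by (auto simp: nth_tm_def lookup_list_encode split: option.splits)
qed

lemma nth_tm_surj: "\<exists>e. nth_tm e = M"
proof -
  have "\<exists>c. entry_of_nat c = x" for x
  proof -
    obtain q s q' b mv where x: "x = ((q, s), (q', b, mv))" by (metis prod.exhaust)
    obtain k where "move_of_nat k = mv"
      by (cases mv) (auto simp: move_of_nat_def intro: that[of 0] that[of 1] that[of 2])
    then have "entry_of_nat (ppair (ppair q s) (ppair q' (ppair b k))) = x"
      by (simp add: entry_of_nat_def ppair_def x)
    then show ?thesis by blast
  qed
  then obtain g where g: "\<And>x. entry_of_nat (g x) = x" by metis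
  have "nth_tm (list_encode (map g M)) = M" by (simp add: nth_tm_def g map_idI)
  then show ?thesis by blast
qed

text \<open>A configuration is coded as \<open>(q, l, r)\<close>, where \<open>r\<close> lists the tape from the head on to the
  right and \<open>l\<close> from the left neighbour of the head on to the left; blanks may be missing at
  the ends.\<close>

definition ulook :: "nat \<Rightarrow> nat \<Rightarrow> nat" where
  "ulook e z = lookup e (ppair (pfst z) (lhd (psnd (psnd z))))"

definition umove :: "nat \<Rightarrow> nat \<Rightarrow> nat \<Rightarrow> nat \<Rightarrow> nat" where
  "umove b mv l r = (if mv = 0 then ppair (ltl l) (lcons (lhd l) (lcons b (ltl r)))
     else if mv = 1 then ppair l (lcons b (ltl r)) else ppair (lcons b l) (ltl r))"

definition ustep :: "nat \<Rightarrow> nat \<Rightarrow> nat" where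
  "ustep e z = (if ulook e z = 0 then z else
     ppair (pfst (psnd (ulook e z - 1)))
       (umove (pfst (psnd (psnd (ulook e z - 1)))) (psnd (psnd (psnd (ulook e z - 1))))
         (pfst (psnd z)) (psnd (psnd z))))"

definition ustart :: "nat \<Rightarrow> nat" where
  "ustart x = ppair 0 (ppair 0 (list_encode (map (\<lambda>_. 1) [0..<x])))"

definition urun :: "nat \<Rightarrow> nat \<Rightarrow> nat \<Rightarrow> nat" where
  "urun e x T = rec_nat (ustart x) (\<lambda>_ z. ustep e z) T"

definition uhalt :: "nat \<Rightarrow> nat \<Rightarrow> nat \<Rightarrow> bool" where
  "uhalt e x T \<longleftrightarrow> ulook e (urun e x T) = 0"

definition ones :: "nat \<Rightarrow> nat" where
  "ones c = (\<Sum>i<llen c. of_bool (lnth c i = 1))"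

definition uout :: "nat \<Rightarrow> nat \<Rightarrow> nat \<Rightarrow> nat" where
  "uout e x T = ones (pfst (psnd (urun e x T))) + ones (psnd (psnd (urun e x T)))"

lemma recf_lookup: "recf f \<Longrightarrow> recf g \<Longrightarrow> recf (\<lambda>x. lookup (f x) (g x))"
  by (rule recf_comp2[of lookup]) (unfold lookup_def, intro recf_intros recf_list_intros)

lemma recf_ulook: "recf f \<Longrightarrow> recf g \<Longrightarrow> recf (\<lambda>x. ulook (f x) (g x))"
  unfolding ulook_def by (intro recf_intros recf_list_intros recf_lookup)

lemma recf_umove: "recf f \<Longrightarrow> recf g \<Longrightarrow> recf h \<Longrightarrow> recf i \<Longrightarrow> recf (\<lambda>x. umove (f x) (g x) (h x) (i x))"
  unfolding umove_def by (intro recf_intros recf_list_intros)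

lemma recf_ustep: "recf f \<Longrightarrow> recf g \<Longrightarrow> recf (\<lambda>x. ustep (f x) (g x))"
  unfolding ustep_def by (intro recf_intros recf_ulook recf_umove)

lemma recf_urun: "recf f \<Longrightarrow> recf g \<Longrightarrow> recf h \<Longrightarrow> recf (\<lambda>x. urun (f x) (g x) (h x))"
  by (rule recf_comp3[of urun])
    (unfold urun_def ustart_def, intro recf_intros recf_list_intros recf_ustep)

lemma recp_uhalt: "recf f \<Longrightarrow> recf g \<Longrightarrow> recf h \<Longrightarrow> recp (\<lambda>x. uhalt (f x) (g x) (h x))"
  unfolding uhalt_def by (intro recf_intros recf_ulook recf_urun)

lemma recf_ones: "recf f \<Longrightarrow> recf (\<lambda>x. ones (f x))"
  by (rule recf_comp[of ones]) (unfold ones_def, intro recf_intros recf_list_intros)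

lemma recf_uout: "recf f \<Longrightarrow> recf g \<Longrightarrow> recf h \<Longrightarrow> recf (\<lambda>x. uout (f x) (g x) (h x))"
  unfolding uout_def by (intro recf_intros recf_ones recf_urun)

section \<open>Correctness of the simulation\<close>

fun represents :: "nat \<Rightarrow> tm_config \<Rightarrow> bool" where
  "represents z (q, T, h) \<longleftrightarrow> pfst z = q \<and> (\<forall>i. T (h + int i) = lnth (psnd (psnd z)) i)
     \<and> (\<forall>i. T (h - 1 - int i) = lnth (pfst (psnd z)) i)"

lemma represents_look:
  assumes "represents z (q, T, h)"
  shows "ulook e z = lookup e (ppair q (T h))"
proof -
  have "T (h + int 0) = lnth (psnd (psnd z)) 0" using assms by (simp del: of_nat_0)
  then show ?thesis using assms by (simp add: ulook_def lnth_0)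
qed

lemma represents_halt:
  assumes "represents z c"
  shows "tm_step (nth_tm e) c = None \<longleftrightarrow> ulook e z = 0"
proof -
  obtain q T h where c: "c = (q, T, h)" by (metis prod.exhaust)
  then have "ulook e z = lookup e (ppair q (T h))" using represents_look assms by blast
  then show ?thesis by (auto simp: c map_of_nth_tm split: option.splits prod.splits)
qed

lemma represents_move:
  assumes r: "\<And>i. T (h + int i) = lnth r i" and l: "\<And>i. T (h - 1 - int i) = lnth l i"
  shows "represents (ppair q (umove b k l r)) (q, T(h := b), h + offset (move_of_nat k))"
proof -
  have r': "T (h + 1 + int i) = lnth (ltl r) i" for i
    using r[of "Suc i"] by (simp add: lnth_Suc algebra_simps)
  have l': "T (h - 2 - int i) = lnth (ltl l) i" for i
    using l[of "Suc i"] by (simp add: lnth_Suc algebra_simps)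
  consider "k = 0" | "k = 1" | "k \<noteq> 0" "k \<noteq> 1" by blast
  then show ?thesis
  proof cases
    case 1
    have a: "(T(h := b)) (h - 1 + int i) = lnth (lcons (lhd l) (lcons b (ltl r))) i" for i
    proof (cases i)
      case 0
      then show ?thesis using l[of 0] by (simp add: lnth_0)
    next
      case (Suc j)
      then show ?thesis using r'[of "j - 1"] by (cases j) (auto simp: lnth_lcons algebra_simps)
    qed
    have b: "(T(h := b)) (h - 1 - 1 - int i) = lnth (ltl l) i" for i using l'[of i] by (simp add: algebra_simps)
    show ?thesis using 1 a b by (simp add: umove_def move_of_nat_def del: fun_upd_apply)
  next
    case 2
    have a: "(T(h := b)) (h + int i) = lnth (lcons b (ltl r)) i" for i
      using r'[of "i - 1"] by (cases i) (auto simp: lnth_lcons algebra_simps)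
    have b: "(T(h := b)) (h - 1 - int i) = lnth l i" for i using l[of i] by simp
    show ?thesis using 2 a b by (simp add: umove_def move_of_nat_def del: fun_upd_apply)
  next
    case 3
    have a: "(T(h := b)) (h + 1 + int i) = lnth (ltl r) i" for i using r'[of i] by simp
    have b: "(T(h := b)) (h + 1 - 1 - int i) = lnth (lcons b l) i" for i
      using l[of "i - 1"] by (cases i) (auto simp: lnth_lcons algebra_simps)
    show ?thesis using 3 a b by (simp add: umove_def move_of_nat_def del: fun_upd_apply)
  qed
qed

lemma represents_step:
  assumes "represents z c" "tm_step (nth_tm e) c = Some c'"
  shows "represents (ustep e z) c'"
proof -
  obtain q T h where c: "c = (q, T, h)" by (metis prod.exhaust)
  let ?u = "ulook e z"
  have u: "?u = lookup e (ppair q (T h))" using represents_look assms(1) c by blast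
  have nz: "?u \<noteq> 0" using represents_halt[OF assms(1), of e] assms(2) by auto
  let ?v = "psnd (?u - 1)"
  have "snd (entry_of_nat (?u - 1)) = (pfst ?v, pfst (psnd ?v), move_of_nat (psnd (psnd ?v)))"
    by (simp add: entry_of_nat_def pfst_def psnd_def split: prod.splits)
  with assms(2) nz have c': "c' = (pfst ?v, T(h := pfst (psnd ?v)), h + offset (move_of_nat (psnd (psnd ?v))))"
    by (simp add: c map_of_nth_tm u)
  have "T (h + int i) = lnth (psnd (psnd z)) i" "T (h - 1 - int i) = lnth (pfst (psnd z)) i" for i
    using assms(1) by (simp_all add: c)
  from represents_move[OF this] show ?thesis
    using nz by (simp add: ustep_def c' del: represents.simps)
qed

lemma ones_card: "ones c = card {i. lnth c i = 1}" "finite {i. lnth c i = 1}"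
proof -
  have "{i. lnth c i = 1} = {..<llen c} \<inter> {i. lnth c i = 1}"
    using lnth_llen[of c] by (auto simp: not_le[symmetric])
  moreover have "ones c = card ({..<llen c} \<inter> {i. lnth c i = 1})"
    by (simp add: ones_def Int_def)
  ultimately show "ones c = card {i. lnth c i = 1}" "finite {i. lnth c i = 1}"
    by (metis, metis finite_Int finite_lessThan)
qed

lemma represents_output:
  assumes "represents z (q, T, h)"
  shows "card {i. T i = 1} = ones (pfst (psnd z)) + ones (psnd (psnd z))"
proof -
  let ?l = "pfst (psnd z)" and ?r = "psnd (psnd z)"
  let ?A = "(\<lambda>i. h + int i) ` {i. lnth ?r i = 1}" and ?B = "(\<lambda>i. h - 1 - int i) ` {i. lnth ?l i = 1}"
  have r: "T (h + int i) = lnth ?r i" and l: "T (h - 1 - int i) = lnth ?l i" for i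
    using assms by auto
  have "{i. T i = 1} = ?A \<union> ?B"
  proof (intro equalityI subsetI)
    fix i assume i: "i \<in> {i. T i = 1}"
    show "i \<in> ?A \<union> ?B"
    proof (cases "h \<le> i")
      case True
      then show ?thesis
        using i r[of "nat (i - h)"] by (intro UnI1 image_eqI[of _ _ "nat (i - h)"]) auto
    next
      case False
      then show ?thesis
        using i l[of "nat (h - 1 - i)"] by (intro UnI2 image_eqI[of _ _ "nat (h - 1 - i)"]) auto
    qed
  qed (use r l in auto)
  also have "card (?A \<union> ?B) = card ?A + card ?B"
    using ones_card(2) by (intro card_Un_disjoint) auto
  also have "card ?A = ones ?r" by (simp add: ones_card card_image inj_on_def)
  also have "card ?B = ones ?l" by (simp add: ones_card card_image inj_on_def)
  finally show ?thesis by simp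
qed

lemma represents_start: "represents (urun e n 0) (tm_start n)"
  by (auto simp: urun_def ustart_def tm_start_def lnth_list_encode)
    (metis lnth_list_encode list.size(3) list_encode.simps(1) not_less_zero)

lemma urun_stable:
  assumes "uhalt e x T" "T \<le> T'"
  shows "urun e x T' = urun e x T" "uhalt e x T'" "uout e x T' = uout e x T"
proof -
  show "urun e x T' = urun e x T"
    using assms(2)
  proof (induction rule: dec_induct)
    case (step n)
    then show ?case using assms(1) by (simp add: urun_def uhalt_def ustep_def)
  qed simp
  then show "uhalt e x T'" "uout e x T' = uout e x T" using assms(1) by (simp_all add: uhalt_def uout_def)
qed

lemma tm_computes_uhalt:
  assumes "tm_computes (nth_tm e) n m"
  shows "\<exists>T. uhalt e n T" "uhalt e n T \<Longrightarrow> uout e n T = m"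
proof -
  obtain q T h where run: "(\<lambda>c c'. tm_step (nth_tm e) c = Some c')\<^sup>*\<^sup>* (tm_start n) (q, T, h)"
    and halt: "tm_step (nth_tm e) (q, T, h) = None" and m: "card {i. T i = 1} = m"
    using assms unfolding tm_computes_def by blast
  from run have "\<exists>k. represents (urun e n k) (q, T, h)"
  proof (induction rule: rtranclp_induct)
    case base
    show ?case using represents_start by blast
  next
    case (step c c')
    then obtain k where "represents (urun e n k) c" by blast
    with step represents_step have "represents (ustep e (urun e n k)) c'" by blast
    then have "represents (urun e n (Suc k)) c'" by (simp add: urun_def)
    then show ?case by blast
  qed
  then obtain k where k: "represents (urun e n k) (q, T, h)" by blast
  then have hk: "uhalt e n k" using represents_halt[OF k] halt by (simp add: uhalt_def)
  have ok: "uout e n k = m" using represents_output[OF k] m by (simp add: uout_def)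
  show "\<exists>T. uhalt e n T" using hk by blast
  show "uout e n T = m" if "uhalt e n T" for T
    using urun_stable(3)[OF hk, of "max k T"] urun_stable(3)[OF that, of "max k T"] ok by simp
qed

text \<open>Kleene's normal form: the output of the simulated machine at its least halting time.
  With \<open>recf_computable\<close> the two notions coincide.\<close>

lemma computable_recf:
  assumes "computable f"
  shows "recf f"
proof -
  obtain e where e: "\<And>n. tm_computes (nth_tm e) n (f n)"
    using assms nth_tm_surj unfolding computable_def by metis
  show ?thesis
  proof (rule partial_rec_total)
    show "partial_rec (\<lambda>x y. (\<exists>T. uhalt e x T) \<and> y = uout e x (LEAST T. uhalt e x T))"
      by (rule partial_rec_Least) (intro recf_intros recp_uhalt recf_uout)+
    show "(\<exists>T. uhalt e x T) \<and> f x = uout e x (LEAST T. uhalt e x T)" for x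
      using tm_computes_uhalt[OF e[of x]] by (metis LeastI)
  qed
qed

section \<open>Entropy of subshifts\<close>

lemma subshift_PiE: "subshift d k \<Sigma> \<Longrightarrow> x \<in> \<Sigma> \<Longrightarrow> x \<in> Zd d \<rightarrow>\<^sub>E {..<k}"
  unfolding subshift_def using closedin_subset by fastforce

lemma subshift_less: "subshift d k \<Sigma> \<Longrightarrow> x \<in> \<Sigma> \<Longrightarrow> i \<in> Zd d \<Longrightarrow> x i < k"
  using subshift_PiE by fastforce

lemma subshift_shift: "subshift d k \<Sigma> \<Longrightarrow> x \<in> \<Sigma> \<Longrightarrow> v \<in> Zd d \<Longrightarrow> shift d v x \<in> \<Sigma>"
  unfolding subshift_def by blast

lemma pattern_at_eq_iff: "pattern_at x U = pattern_at y U \<longleftrightarrow> (\<forall>i\<in>U. x i = y i)"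
  by (auto simp: pattern_at_def restrict_map_def fun_eq_iff)

lemma restrict_pattern_at: "U \<subseteq> V \<Longrightarrow> pattern_at x V |` U = pattern_at x U"
  by (auto simp: pattern_at_def restrict_map_def fun_eq_iff)

lemma lang_on_subset: "U \<subseteq> V \<Longrightarrow> lang_on \<Sigma> U = (\<lambda>p. p |` U) ` lang_on \<Sigma> V"
  by (auto simp: lang_on_def restrict_pattern_at intro!: image_eqI)

lemma lang_on_bound:
  assumes "subshift d k \<Sigma>" "finite U" "U \<subseteq> Zd d"
  shows "finite (lang_on \<Sigma> U)" "card (lang_on \<Sigma> U) \<le> k ^ card U"
proof -
  have sub: "lang_on \<Sigma> U \<subseteq> (\<lambda>g. pattern_at g U) ` (U \<rightarrow>\<^sub>E {..<k})"
  proof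
    fix p assume "p \<in> lang_on \<Sigma> U"
    then obtain x where x: "x \<in> \<Sigma>" "p = pattern_at x U" by (auto simp: lang_on_def)
    have "p = pattern_at (restrict x U) U" by (simp add: x pattern_at_eq_iff)
    moreover have "restrict x U \<in> U \<rightarrow>\<^sub>E {..<k}" using subshift_less[OF assms(1) x(1)] assms(3) by auto
    ultimately show "p \<in> (\<lambda>g. pattern_at g U) ` (U \<rightarrow>\<^sub>E {..<k})" by blast
  qed
  have fin: "finite (U \<rightarrow>\<^sub>E {..<k})" using assms(2) by (intro finite_PiE) auto
  then show "finite (lang_on \<Sigma> U)" using sub finite_subset by blast
  have "card (lang_on \<Sigma> U) \<le> card ((\<lambda>g. pattern_at g U) ` (U \<rightarrow>\<^sub>E {..<k}))"
    using fin sub by (intro card_mono) auto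
  also have "\<dots> \<le> card (U \<rightarrow>\<^sub>E {..<k})" using fin by (rule card_image_le)
  also have "\<dots> = k ^ card U" using assms(2) by (simp add: card_PiE)
  finally show "card (lang_on \<Sigma> U) \<le> k ^ card U" .
qed

lemma card_lang_on_pos:
  assumes "subshift d k \<Sigma>" "finite U" "U \<subseteq> Zd d" "\<Sigma> \<noteq> {}"
  shows "card (lang_on \<Sigma> U) > 0"
  using lang_on_bound(1)[OF assms(1-3)] assms(4) by (auto simp: card_gt_0_iff lang_on_def)

lemma card_lang_on_mono:
  assumes "subshift d k \<Sigma>" "finite V" "V \<subseteq> Zd d" "U \<subseteq> V"
  shows "card (lang_on \<Sigma> U) \<le> card (lang_on \<Sigma> V)"
  using lang_on_bound(1)[OF assms(1-3)] lang_on_subset[OF assms(4)] by (metis card_image_le)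

lemma box_lists: "box d n = {xs. set xs \<subseteq> {0..int n - 1} \<and> length xs = d}"
  by (auto simp: box_def Zd_def)

lemma finite_box [simp]: "finite (box d n)"
  by (simp add: box_lists finite_lists_length_eq)

lemma card_box: "card (box d n) = n ^ d"
  by (simp add: box_lists card_lists_length_eq)

lemma box_subset_Zd: "box d n \<subseteq> Zd d"
  by (auto simp: box_def)

lemma mem_box: "i \<in> box d n \<longleftrightarrow> length i = d \<and> (\<forall>l<d. 0 \<le> i ! l \<and> i ! l < int n)"
  by (auto simp: box_def Zd_def all_set_conv_all_nth)

lemma box_mono: "n \<le> m \<Longrightarrow> box d n \<subseteq> box d m"
  by (force simp: mem_box)

lemma shift_apply: "i \<in> Zd d \<Longrightarrow> shift d v x i = x (map2 (+) i v)"
  by (simp add: shift_def)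

lemma map2_in_Zd: "i \<in> Zd d \<Longrightarrow> v \<in> Zd d \<Longrightarrow> map2 (+) i v \<in> Zd d"
  by (simp add: Zd_def)

text \<open>A box of side \<open>n * q\<close> is tiled by \<open>q ^ d\<close> translates of the
  box of side \<open>n\<close>, and a pattern is determined by what it shows on the tiles. Quotient
  and remainder of the coordinates give the tile and the place in it.\<close>

lemma card_lang_box_mult:
  assumes S: "subshift d k \<Sigma>" and n: "n \<ge> 1"
  shows "card (lang_on \<Sigma> (box d (n * q))) \<le> card (lang_on \<Sigma> (box d n)) ^ (q ^ d)"
proof -
  let ?B = "box d (n * q)"
  define tr where "tr v i = map2 (+) i (map ((*) (int n)) v)" for v i :: "int list"
  define \<Phi> where "\<Phi> p = (\<lambda>v\<in>box d q. (\<lambda>i. p (tr v i)) |` box d n)" for p :: "int list \<rightharpoonup> nat"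
  have tr: "tr v i \<in> ?B" if "v \<in> box d q" "i \<in> box d n" for v i
  proof -
    have "i ! l + int n * v ! l < int (n * q)" if "l < d" for l
    proof -
      have "i ! l < int n" "v ! l \<le> int q - 1"
        using \<open>v \<in> box d q\<close> \<open>i \<in> box d n\<close> that by (auto simp: mem_box)
      then have "i ! l + int n * v ! l < int n + int n * (int q - 1)"
        by (intro add_less_le_mono mult_left_mono) auto
      then show ?thesis by (simp add: algebra_simps)
    qed
    then show ?thesis using that by (auto simp: tr_def mem_box)
  qed
  have \<Phi>: "\<Phi> (pattern_at x ?B) v = pattern_at (shift d (map ((*) (int n)) v) x) (box d n)"
    if "v \<in> box d q" for x v
  proof
    fix i
    show "\<Phi> (pattern_at x ?B) v i = pattern_at (shift d (map ((*) (int n)) v) x) (box d n) i"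
      using that tr[of v i] box_subset_Zd[of d n]
      by (auto simp: \<Phi>_def pattern_at_def restrict_map_def shift_apply tr_def)
  qed
  have "inj_on \<Phi> (lang_on \<Sigma> ?B)"
  proof (rule inj_onI)
    fix p p' assume pp: "p \<in> lang_on \<Sigma> ?B" "p' \<in> lang_on \<Sigma> ?B" and e: "\<Phi> p = \<Phi> p'"
    then obtain x y where x: "p = pattern_at x ?B" and y: "p' = pattern_at y ?B"
      by (auto simp: lang_on_def)
    have "x j = y j" if j: "j \<in> ?B" for j
    proof -
      let ?v = "map (\<lambda>a. a div int n) j" and ?i = "map (\<lambda>a. a mod int n) j"
      have i: "?i \<in> box d n" using j n by (auto simp: mem_box)
      have v: "?v \<in> box d q"
      proof -
        have "(j ! l) div int n < int q" if "l < d" for l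
        proof -
          have "j ! l < int q * int n" using j that by (auto simp: mem_box mult.commute)
          moreover have "(j ! l) div int n * int n \<le> j ! l"
            using div_mult_mod_eq[of "j ! l" "int n"] pos_mod_sign[of "int n" "j ! l"] n by linarith
          ultimately have "(j ! l) div int n * int n < int q * int n" by linarith
          then show ?thesis using n mult_right_less_imp_less by fastforce
        qed
        then show ?thesis using j n by (auto simp: mem_box pos_imp_zdiv_nonneg_iff)
      qed
      have t: "tr ?v ?i = j"
        by (rule nth_equalityI) (use j in \<open>auto simp: tr_def mem_box\<close>)
      have "\<Phi> p ?v ?i = \<Phi> p' ?v ?i" using e by simp
      then show ?thesis using i v t j by (simp add: \<Phi>_def x y pattern_at_def)
    qed
    then show "p = p'" by (simp add: x y pattern_at_eq_iff)
  qed
  moreover have "\<Phi> ` lang_on \<Sigma> ?B \<subseteq> box d q \<rightarrow>\<^sub>E lang_on \<Sigma> (box d n)"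
  proof
    fix g assume "g \<in> \<Phi> ` lang_on \<Sigma> ?B"
    then obtain x where x: "x \<in> \<Sigma>" "g = \<Phi> (pattern_at x ?B)" by (auto simp: lang_on_def)
    have "g v \<in> lang_on \<Sigma> (box d n)" if v: "v \<in> box d q" for v
    proof -
      have "map ((*) (int n)) v \<in> Zd d" using v by (auto simp: box_def Zd_def)
      from subshift_shift[OF S x(1) this] show ?thesis
        unfolding x(2) \<Phi>[OF v] lang_on_def by blast
    qed
    then show "g \<in> box d q \<rightarrow>\<^sub>E lang_on \<Sigma> (box d n)" by (auto simp: x(2) \<Phi>_def)
  qed
  moreover have "finite (box d q \<rightarrow>\<^sub>E lang_on \<Sigma> (box d n))"
    using lang_on_bound(1)[OF S finite_box box_subset_Zd] by (intro finite_PiE) auto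
  ultimately have "card (lang_on \<Sigma> ?B) \<le> card (box d q \<rightarrow>\<^sub>E lang_on \<Sigma> (box d n))"
    by (rule card_inj_on_le)
  also have "\<dots> = card (lang_on \<Sigma> (box d n)) ^ (q ^ d)"
    by (simp add: card_PiE card_box)
  finally show ?thesis .
qed

text \<open>A form of Fekete's lemma. Subadditivity is only available along multiples; monotonicity
  settles the other indices by rounding \<open>N\<close> up to \<open>n * (N div n + 1)\<close>, at
  the price of a factor \<open>(1 + n / N) ^ d\<close>.\<close>

lemma fekete_power:
  fixes a :: "nat \<Rightarrow> real"
  assumes "mono a" and nonneg: "\<And>n. 0 \<le> a n"
    and sub: "\<And>n q. n \<ge> 1 \<Longrightarrow> a (n * q) \<le> real q ^ d * a n"
  obtains h where "(\<lambda>n. a n / real n ^ d) \<longlonglongrightarrow> h" "0 \<le> h" "\<And>n. n \<ge> 1 \<Longrightarrow> h \<le> a n / real n ^ d"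
proof
  let ?r = "\<lambda>n. a n / real n ^ d"
  define h where "h = (INF n\<in>{1..}. ?r n)"
  have bdd: "bdd_below (?r ` {1..})" by (rule bdd_belowI[of _ 0]) (auto simp: nonneg)
  show le: "h \<le> ?r n" if "n \<ge> 1" for n
    unfolding h_def using bdd that by (intro cINF_lower) auto
  show "0 \<le> h" unfolding h_def by (intro cINF_greatest) (auto simp: nonneg)
  show "?r \<longlonglongrightarrow> h"
  proof (rule order_tendstoI)
    fix l assume "l < h"
    then show "eventually (\<lambda>n. l < ?r n) sequentially"
      using le by (intro eventually_sequentiallyI[of 1]) (meson less_le_trans)
  next
    fix u assume "h < u"
    then obtain n where n: "n \<ge> 1" "?r n < u"
      unfolding h_def using bdd by (subst (asm) cINF_less_iff) auto
    have "(\<lambda>N. (1 + real n / real N) ^ d * ?r n) \<longlonglongrightarrow> (1 + 0) ^ d * ?r n"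
      by (intro tendsto_intros lim_const_over_n)
    then have ev: "eventually (\<lambda>N. (1 + real n / real N) ^ d * ?r n < u) sequentially"
      using n(2) by (intro order_tendstoD) auto
    have bnd: "?r N \<le> (1 + real n / real N) ^ d * ?r n" if N: "N \<ge> 1" for N
    proof -
      have "N \<le> n * (N div n + 1)"
        using dividend_less_times_div[of n N] n by (simp add: algebra_simps)
      then have "a N \<le> a (n * (N div n + 1))" using \<open>mono a\<close> by (rule monoD[rotated])
      also have "\<dots> \<le> real (N div n + 1) ^ d * a n" using n(1) by (rule sub)
      also have "\<dots> \<le> (real N / real n + 1) ^ d * a n"
        using of_nat_div_le_of_nat[of N n, where 'a = real] by (intro mult_right_mono power_mono nonneg) auto
      also have "real N / real n + 1 = real N / real n * (1 + real n / real N)"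
        using n N by (simp add: field_simps)
      also have "(real N / real n * (1 + real n / real N)) ^ d * a n
          = (1 + real n / real N) ^ d * ?r n * real N ^ d"
        unfolding power_mult_distrib power_divide by simp
      finally show ?thesis using N by (simp add: pos_divide_le_eq)
    qed
    show "eventually (\<lambda>N. ?r N < u) sequentially"
      using eventually_conj[OF ev eventually_ge_at_top[of 1]]
      by (rule eventually_mono) (blast intro: le_less_trans[OF bnd])
  qed
qed

lemma entropy_limit:
  assumes S: "subshift d k \<Sigma>" and ne: "\<Sigma> \<noteq> {}"
  shows "(\<lambda>n. log 2 (real (card (lang_on \<Sigma> (box d n)))) / real n ^ d) \<longlonglongrightarrow> entropy d \<Sigma>"
    and "0 \<le> entropy d \<Sigma>"
    and "n \<ge> 1 \<Longrightarrow> entropy d \<Sigma> \<le> log 2 (real (card (lang_on \<Sigma> (box d n)))) / real n ^ d"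
proof -
  let ?c = "\<lambda>n. card (lang_on \<Sigma> (box d n))"
  let ?a = "\<lambda>n. log 2 (real (?c n))"
  have pos: "?c n > 0" for n using card_lang_on_pos[OF S finite_box box_subset_Zd ne] .
  have "mono ?a"
  proof (rule monoI)
    fix m n :: nat assume "m \<le> n"
    then have "?c m \<le> ?c n"
      by (intro card_lang_on_mono[OF S finite_box box_subset_Zd] box_mono)
    then show "?a m \<le> ?a n" using pos[of m] by simp
  qed
  moreover have "0 \<le> ?a n" for n
    using pos[of n] by simp
  moreover have "?a (n * q) \<le> real q ^ d * ?a n" if "n \<ge> 1" for n q
  proof -
    have "real (?c (n * q)) \<le> real (?c n) ^ (q ^ d)"
      using card_lang_box_mult[OF S that] by (metis of_nat_le_iff of_nat_power)
    then have "?a (n * q) \<le> log 2 (real (?c n) ^ (q ^ d))"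
      by (subst log_le_cancel_iff) (use pos in auto)
    then show ?thesis using pos[of n] by (simp add: log_nat_power)
  qed
  ultimately obtain h where h: "(\<lambda>n. ?a n / real n ^ d) \<longlonglongrightarrow> h" "0 \<le> h"
    "\<And>n. n \<ge> 1 \<Longrightarrow> h \<le> ?a n / real n ^ d"
    using fekete_power[of ?a d] by blast
  have "entropy d \<Sigma> = h" unfolding entropy_def using h(1) by (rule limI)
  with h show "(\<lambda>n. ?a n / real n ^ d) \<longlonglongrightarrow> entropy d \<Sigma>" "0 \<le> entropy d \<Sigma>"
    "n \<ge> 1 \<Longrightarrow> entropy d \<Sigma> \<le> ?a n / real n ^ d" by auto
qed

subsection \<open>Distances\<close>

lemma dist_max_ge: "l < length i \<Longrightarrow> nat \<bar>i ! l - j ! l\<bar> \<le> dist_max i j"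
  unfolding dist_max_def by (rule Max_ge) auto

lemma dist_max_le:
  assumes "length i > 0" "\<And>l. l < length i \<Longrightarrow> \<bar>i ! l - j ! l\<bar> \<le> int B"
  shows "dist_max i j \<le> B"
proof -
  have "nat \<bar>i ! l - j ! l\<bar> \<le> B" if "l < length i" for l using assms(2)[OF that] by linarith
  moreover have "{..<length i} \<noteq> {}" using assms(1) by auto
  ultimately show ?thesis unfolding dist_max_def by (subst Max_le_iff) auto
qed

lemma dist_max_set: "{dist_max i j | i j. i \<in> U \<and> j \<in> V} = (\<lambda>(i, j). dist_max i j) ` (U \<times> V)"
  by auto

lemma diam_ge: "finite U \<Longrightarrow> i \<in> U \<Longrightarrow> j \<in> U \<Longrightarrow> dist_max i j \<le> diam U"
  unfolding diam_def dist_max_set by (rule Max_ge) auto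

lemma diam_le: "finite U \<Longrightarrow> U \<noteq> {} \<Longrightarrow> (\<And>i j. i \<in> U \<Longrightarrow> j \<in> U \<Longrightarrow> dist_max i j \<le> B) \<Longrightarrow> diam U \<le> B"
  unfolding diam_def dist_max_set by (subst Max_le_iff) auto

lemma set_dist_le: "finite U \<Longrightarrow> finite V \<Longrightarrow> i \<in> U \<Longrightarrow> j \<in> V \<Longrightarrow> set_dist U V \<le> dist_max i j"
  unfolding set_dist_def dist_max_set by (rule Min_le) auto

lemma set_dist_ge:
  "finite U \<Longrightarrow> U \<noteq> {} \<Longrightarrow> finite V \<Longrightarrow> V \<noteq> {} \<Longrightarrow>
    (\<And>i j. i \<in> U \<Longrightarrow> j \<in> V \<Longrightarrow> B \<le> dist_max i j) \<Longrightarrow> B \<le> set_dist U V"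
  unfolding set_dist_def dist_max_set by (subst Min_ge_iff) auto

subsection \<open>Lower bounds from irreducibility\<close>

lemma map2_add_uminus:
  fixes i v :: "int list"
  assumes "length i = length v"
  shows "map2 (+) (map2 (+) i v) (map uminus v) = i"
  by (rule nth_equalityI) (use assms in auto)

lemma card_lang_translate:
  assumes S: "subshift d k \<Sigma>" and U: "finite U" "U \<subseteq> Zd d" and v: "v \<in> Zd d"
  shows "card (lang_on \<Sigma> U) \<le> card (lang_on \<Sigma> ((\<lambda>i. map2 (+) i v) ` U))"
proof -
  let ?V = "(\<lambda>i. map2 (+) i v) ` U"
  have "lang_on \<Sigma> U \<subseteq> (\<lambda>p. (\<lambda>i. p (map2 (+) i v)) |` U) ` lang_on \<Sigma> ?V"
  proof
    fix p assume "p \<in> lang_on \<Sigma> U"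
    then obtain x where x: "x \<in> \<Sigma>" "p = pattern_at x U" by (auto simp: lang_on_def)
    let ?y = "shift d (map uminus v) x"
    have "?y \<in> \<Sigma>" using v by (intro subshift_shift[OF S x(1)]) (simp add: Zd_def)
    moreover have "?y (map2 (+) i v) = x i" if "i \<in> U" for i
    proof -
      have i: "i \<in> Zd d" using that U by auto
      then show ?thesis
        using v by (simp add: shift_apply map2_in_Zd map2_add_uminus Zd_def)
    qed
    then have "p = (\<lambda>i. pattern_at ?y ?V (map2 (+) i v)) |` U"
      by (auto simp: x pattern_at_def restrict_map_def fun_eq_iff)
    ultimately show "p \<in> (\<lambda>p. (\<lambda>i. p (map2 (+) i v)) |` U) ` lang_on \<Sigma> ?V"
      by (auto simp: lang_on_def)
  qed
  moreover have "finite (lang_on \<Sigma> ?V)"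
    using U v by (intro lang_on_bound(1)[OF S]) (auto simp: map2_in_Zd subset_iff)
  ultimately show ?thesis by (meson card_image_le card_mono finite_imageI order_trans)
qed

text \<open>The box is doubled one coordinate at a time.\<close>

lemma irreducible_card_double:
  assumes S: "subshift d k \<Sigma>" and irr: "irreducible d f \<Sigma>" and f: "mono f"
    and n: "n \<ge> 1" and g: "f (2 * n + g - 1) \<le> g + 1"
  shows "card (lang_on \<Sigma> (box d n)) ^ (2 ^ d) \<le> card (lang_on \<Sigma> (box d (2 * n + g)))"
proof -
  define N where "N = 2 * n + g"
  \<comment> \<open>These boxes interpolate between side \<open>n\<close> and side \<open>N\<close>:
    the first \<open>j\<close> coordinates have been doubled already.\<close>
  define U where "U j = {i \<in> Zd d. \<forall>l<d. 0 \<le> i ! l \<and> i ! l < int (if l < j then N else n)}" for j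
  have U_box: "U j \<subseteq> box d N" for j
  proof
    fix i assume i: "i \<in> U j"
    have "0 \<le> i ! l \<and> i ! l < int N" if "l < d" for l
    proof -
      have "0 \<le> i ! l \<and> i ! l < int (if l < j then N else n)" using i that by (auto simp: U_def)
      then show ?thesis by (auto simp: N_def split: if_splits)
    qed
    with i show "i \<in> box d N" by (simp add: U_def mem_box Zd_def)
  qed
  have fin: "finite (U j)" for j by (rule finite_subset[OF U_box finite_box])
  have Zd: "U j \<subseteq> Zd d" for j by (auto simp: U_def)
  have ne: "replicate d 0 \<in> U j" for j using n by (auto simp: U_def Zd_def N_def)
  have ne': "U j \<noteq> {}" for j using ne by blast
  have step: "card (lang_on \<Sigma> (U j)) ^ 2 \<le> card (lang_on \<Sigma> (U (Suc j)))" if j: "j < d" for j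
  proof -
    define v where "v = (replicate d 0)[j := int (n + g)]"
    have v: "v \<in> Zd d" by (simp add: v_def Zd_def)
    define V where "V = (\<lambda>i. map2 (+) i v) ` U j"
    have nth: "map2 (+) i v ! l = i ! l + (if l = j then int (n + g) else 0)"
      if "i \<in> U j" "l < d" for i l
      using that by (auto simp: v_def U_def Zd_def nth_list_update)
    have len: "length i = d" if "i \<in> U j" for i using that by (simp add: U_def Zd_def)
    have V: "finite V" "V \<subseteq> Zd d" "V \<noteq> {}"
      using fin Zd v ne' by (auto simp: V_def map2_in_Zd subset_iff)
    have VU: "V \<subseteq> U (Suc j)"
    proof
      fix w assume "w \<in> V"
      then obtain i where i: "i \<in> U j" "w = map2 (+) i v" by (auto simp: V_def)
      have "0 \<le> w ! l \<and> w ! l < int (if l < Suc j then N else n)" if l: "l < d" for l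
      proof -
        have "0 \<le> i ! l \<and> i ! l < int (if l < j then N else n)" using i(1) l by (auto simp: U_def)
        then show ?thesis using nth[OF i(1) l] i(2) by (auto simp: N_def split: if_splits)
      qed
      then show "w \<in> U (Suc j)" using V(2) \<open>w \<in> V\<close> by (auto simp: U_def)
    qed
    have UU: "U j \<subseteq> U (Suc j)"
    proof
      fix i assume i: "i \<in> U j"
      have "0 \<le> i ! l \<and> i ! l < int (if l < Suc j then N else n)" if "l < d" for l
      proof -
        have "0 \<le> i ! l \<and> i ! l < int (if l < j then N else n)" using i that by (auto simp: U_def)
        then show ?thesis by (auto simp: N_def split: if_splits)
      qed
      with i show "i \<in> U (Suc j)" by (simp add: U_def)
    qed
    have bd: "\<bar>i ! l - i' ! l\<bar> \<le> int (N - 1)" if "i \<in> U (Suc j)" "i' \<in> U (Suc j)" "l < d" for i i' l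
    proof -
      have "0 \<le> i ! l" "i ! l < int N" "0 \<le> i' ! l" "i' ! l < int N"
        using that U_box[of "Suc j"] by (auto simp: mem_box subset_iff)
      then show ?thesis by (simp add: abs_le_iff of_nat_diff N_def)
    qed
    have dm: "dist_max i i' \<le> N - 1" if "i \<in> U (Suc j)" "i' \<in> U (Suc j)" for i i'
      using bd[OF that] that j by (intro dist_max_le) (auto simp: U_def Zd_def)
    have "diam (U j) \<le> N - 1" using dm UU fin ne' by (intro diam_le) auto
    moreover have "diam V \<le> N - 1" using dm VU V by (intro diam_le) auto
    ultimately have "f (max (diam (U j)) (diam V)) \<le> f (N - 1)"
      using f by (intro monoD[OF f]) auto
    \<comment> \<open>Off by one on both sides: \<open>g\<close> empty layers mean distance
      \<open>g + 1\<close>, and a box of side \<open>N\<close> has diameter at most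
      \<open>N - 1\<close>.\<close>
    also have "\<dots> \<le> g + 1" using g by (simp add: N_def)
    also have "\<dots> \<le> set_dist (U j) V"
    proof (rule set_dist_ge[OF fin _ V(1,3)])
      fix i i' assume i: "i \<in> U j" and "i' \<in> V"
      then obtain i2 where i2: "i2 \<in> U j" "i' = map2 (+) i2 v" by (auto simp: V_def)
      have "i ! j < int n" "0 \<le> i2 ! j" using i i2(1) j by (auto simp: U_def)
      then have "g + 1 \<le> nat \<bar>i ! j - i' ! j\<bar>" using nth[OF i2(1) j] i2(2) by auto
      also have "\<dots> \<le> dist_max i i'" using i j by (intro dist_max_ge) (simp add: len)
      finally show "g + 1 \<le> dist_max i i'" .
    qed (use ne in auto)
    finally have sep: "f (max (diam (U j)) (diam V)) \<le> set_dist (U j) V" .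
    have "lang_on \<Sigma> (U j) \<times> lang_on \<Sigma> V \<subseteq> (\<lambda>p. (p |` U j, p |` V)) ` lang_on \<Sigma> (U (Suc j))"
    proof clarify
      fix p q assume "p \<in> lang_on \<Sigma> (U j)" "q \<in> lang_on \<Sigma> V"
      then obtain x where x: "x \<in> \<Sigma>" "pattern_at x (U j) = p" "pattern_at x V = q"
        using irr[unfolded irreducible_def, rule_format, of "U j" V p q] sep V fin Zd ne by blast
      then have "(p, q) = (pattern_at x (U (Suc j)) |` U j, pattern_at x (U (Suc j)) |` V)"
        using UU VU by (simp add: restrict_pattern_at)
      then show "(p, q) \<in> (\<lambda>p. (p |` U j, p |` V)) ` lang_on \<Sigma> (U (Suc j))"
        using x(1) by (auto simp: lang_on_def)
    qed
    then have "card (lang_on \<Sigma> (U j) \<times> lang_on \<Sigma> V) \<le> card (lang_on \<Sigma> (U (Suc j)))"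
      using lang_on_bound(1)[OF S fin Zd] by (meson card_image_le card_mono finite_imageI order_trans)
    moreover have "card (lang_on \<Sigma> (U j)) \<le> card (lang_on \<Sigma> V)"
      unfolding V_def by (rule card_lang_translate[OF S fin Zd v])
    ultimately show ?thesis
      by (metis card_cartesian_product mult_le_mono2 order_trans power2_eq_square)
  qed
  have "card (lang_on \<Sigma> (U 0)) ^ (2 ^ j) \<le> card (lang_on \<Sigma> (U j))" if "j \<le> d" for j
    using that
  proof (induction j)
    case (Suc j)
    have "card (lang_on \<Sigma> (U 0)) ^ (2 ^ Suc j) = (card (lang_on \<Sigma> (U 0)) ^ (2 ^ j)) ^ 2"
      by (simp add: power_mult[symmetric] mult.commute)
    also have "\<dots> \<le> card (lang_on \<Sigma> (U j)) ^ 2" using Suc by (intro power_mono) auto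
    also have "\<dots> \<le> card (lang_on \<Sigma> (U (Suc j)))" using step Suc by auto
    finally show ?case .
  qed simp
  moreover have "U 0 = box d n" "U d = box d N"
    by (auto simp: U_def mem_box Zd_def)
  ultimately show ?thesis by (metis N_def order_refl)
qed

text \<open>On the \<open>4 * m\<close> indices from \<open>4 * m\<close> on, \<open>f i\<close> is
  at least \<open>f (4 * m)\<close> and \<open>i ^ 2\<close> is at most \<open>64 * m ^ 2\<close>,
  so the sum is at least \<open>f (4 * m) / (16 * m)\<close>. The left side is the relative growth
  caused by the gap when a box of side \<open>m\<close> is doubled.\<close>

lemma double_gap:
  fixes f :: "nat \<Rightarrow> nat"
  assumes "mono f" "m \<ge> 1"
  shows "real (f (4 * m)) / (2 * real m) \<le> 8 * (\<Sum>i=4*m..<8*m. real (f i) / real i ^ 2)"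
proof -
  have "real (f (4 * m)) / (64 * real m ^ 2) \<le> real (f i) / real i ^ 2" if "i \<in> {4*m..<8*m}" for i
  proof (rule frac_le)
    show "real (f (4 * m)) \<le> real (f i)" using that assms(1) by (auto dest: monoD)
    have "real i ^ 2 \<le> (8 * real m) ^ 2" using that by (intro power_mono) auto
    then show "real i ^ 2 \<le> 64 * real m ^ 2" by (simp add: power2_eq_square)
  qed (use that assms in auto)
  then have "(\<Sum>i=4*m..<8*m. real (f (4 * m)) / (64 * real m ^ 2)) \<le> (\<Sum>i=4*m..<8*m. real (f i) / real i ^ 2)"
    by (rule sum_mono)
  moreover have "(\<Sum>i=4*m..<8*m. real (f (4 * m)) / (64 * real m ^ 2)) = real (f (4 * m)) / (16 * real m)"
    using assms(2) by (simp add: power2_eq_square field_simps)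
  moreover have "real (f (4 * m)) / (2 * real m) = 8 * (real (f (4 * m)) / (16 * real m))" by simp
  ultimately show ?thesis by linarith
qed

text \<open>All sides are at least \<open>n\<close>, so only the values of \<open>f\<close> from
  \<open>4 * n\<close> on enter, which lie in the tail from \<open>N\<close> on. The factor
  \<open>8 * d * \<delta>\<close> comes from \<open>1 - exp (- t) \<le> t\<close>; the factor
  \<open>k\<close> bounds the logarithm of the number of patterns per site, through
  \<open>log 2 k \<le> k\<close>.\<close>

lemma entropy_rate:
  assumes S: "subshift d k \<Sigma>" and ne: "\<Sigma> \<noteq> {}" and irr: "irreducible d f \<Sigma>" and f: "mono f"
    and d: "d \<ge> 1" and n: "n \<ge> 1" "N \<le> 4 * n"
    and sm: "summable (\<lambda>i. real (f i) / real i ^ 2)"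
    and tail: "(\<Sum>i. real (f (i + N)) / real (i + N) ^ 2) \<le> \<delta>" and \<delta>: "8 * \<delta> \<le> 1"
  shows "log 2 (real (card (lang_on \<Sigma> (box d n)))) / real n ^ d - entropy d \<Sigma> \<le> real k * (8 * real d * \<delta>)"
proof -
  let ?a = "\<lambda>i. real (f i) / real i ^ 2"
  let ?c = "\<lambda>n. card (lang_on \<Sigma> (box d n))"
  let ?b = "\<lambda>n. log 2 (real (?c n))"
  define s where "s = rec_nat n (\<lambda>_ m. 2 * m + f (4 * m))"
  have s0: "s 0 = n" and sS: "s (Suc j) = 2 * s j + f (4 * s j)" for j by (simp_all add: s_def)
  have pos: "?c m > 0" for m using card_lang_on_pos[OF S finite_box box_subset_Zd ne] .
  have part: "(\<Sum>i=4*n..<M. ?a i) \<le> \<delta>" for M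
  proof -
    have "(\<Sum>i=4*n..<M. ?a i) \<le> (\<Sum>i=N..<M. ?a i)" using n(2) by (intro sum_mono2) auto
    also have "\<dots> = (\<Sum>i<M - N. ?a (i + N))"
    proof (cases "N \<le> M")
      case True
      then show ?thesis
        using sum.shift_bounds_nat_ivl[of ?a 0 N "M - N"] by (simp add: atLeast0LessThan)
    qed simp
    also have "\<dots> \<le> (\<Sum>i. ?a (i + N))"
      using summable_ignore_initial_segment[OF sm, of N] by (intro sum_le_suminf) auto
    also have "\<dots> \<le> \<delta>" using tail by simp
    finally show ?thesis .
  qed
  have inv: "n * 2 ^ j \<le> s j \<and> ?b (s j) \<ge> 2 ^ (d * j) * ?b n \<and>
      real (s j) \<le> 2 ^ j * real n * exp (8 * (\<Sum>i=4*n..<4 * s j. ?a i))" for j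
  proof (induction j)
    case (Suc j)
    let ?m = "s j"
    have nm: "n \<le> n * 2 ^ j" by simp
    then have m: "n \<le> ?m" "?m \<ge> 1" using Suc n(1) by linarith+
    have gap: "real (f (4 * ?m)) / (2 * real ?m) \<le> 8 * (\<Sum>i=4*?m..<8*?m. ?a i)"
      by (rule double_gap[OF f m(2)])
    also have "(\<Sum>i=4*?m..<8*?m. ?a i) \<le> (\<Sum>i=4*n..<8*?m. ?a i)" using m by (intro sum_mono2) auto
    also have "\<dots> \<le> \<delta>" by (rule part)
    finally have "real (f (4 * ?m)) / (2 * real ?m) \<le> 1" using \<delta> by simp
    then have small: "f (4 * ?m) \<le> 2 * ?m" using m(2) by (simp add: field_simps)
    \<comment> \<open>The required gap depends on the side, which depends on the gap. Because
      \<open>f (4 * s j) \<le> 2 * s j\<close>, the new side is at most \<open>4 * s j\<close>, so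
      that the gap \<open>f (4 * s j)\<close> is large enough.\<close>
    have "f (2 * ?m + f (4 * ?m) - 1) \<le> f (4 * ?m)" using small by (intro monoD[OF f]) auto
    then have "?c ?m ^ (2 ^ d) \<le> ?c (s (Suc j))"
      unfolding sS by (intro irreducible_card_double[OF S irr f m(2)]) auto
    then have "real (?c ?m) ^ (2 ^ d) \<le> real (?c (s (Suc j)))" by (metis of_nat_le_iff of_nat_power)
    then have "log 2 (real (?c ?m) ^ (2 ^ d)) \<le> ?b (s (Suc j))"
      using pos[of ?m] pos[of "s (Suc j)"] by (subst log_le_cancel_iff) auto
    then have "2 ^ d * ?b ?m \<le> ?b (s (Suc j))" using pos[of ?m] by (simp add: log_nat_power)
    moreover have "2 ^ d * (2 ^ (d * j) * ?b n) \<le> 2 ^ d * ?b ?m" using Suc by (intro mult_left_mono) auto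
    moreover have "2 ^ (d * Suc j) * ?b n = 2 ^ d * (2 ^ (d * j) * ?b n)" by (simp add: power_add)
    ultimately have b: "2 ^ (d * Suc j) * ?b n \<le> ?b (s (Suc j))" by linarith
    have "real (s (Suc j)) = 2 * real ?m * (1 + real (f (4 * ?m)) / (2 * real ?m))"
      using m(2) by (simp add: sS field_simps)
    also have "\<dots> \<le> 2 * real ?m * (1 + 8 * (\<Sum>i=4*?m..<8*?m. ?a i))"
      using gap by (intro mult_left_mono add_left_mono) auto
    \<comment> \<open>The inequality \<open>1 + t \<le> exp t\<close> turns the product of the
      growth factors into the exponential of a sum. The ranges of indices do not overlap, because
      the next one starts at \<open>4 * s (Suc j)\<close>, which is at least
      \<open>8 * s j\<close>.\<close>
    also have "\<dots> \<le> 2 * real ?m * exp (8 * (\<Sum>i=4*?m..<8*?m. ?a i))"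
      by (intro mult_left_mono exp_ge_add_one_self) auto
    also have "\<dots> \<le> 2 * (2 ^ j * real n * exp (8 * (\<Sum>i=4*n..<4*?m. ?a i))) * exp (8 * (\<Sum>i=4*?m..<8*?m. ?a i))"
      using Suc by (intro mult_right_mono mult_left_mono) auto
    also have "\<dots> = 2 ^ Suc j * real n * exp (8 * (\<Sum>i=4*n..<8*?m. ?a i))"
      using m(1) by (simp add: exp_add[symmetric] distrib_left[symmetric] sum.atLeastLessThan_concat)
    also have "\<dots> \<le> 2 ^ Suc j * real n * exp (8 * (\<Sum>i=4*n..<4 * s (Suc j). ?a i))"
    proof -
      have "(\<Sum>i=4*n..<8*?m. ?a i) \<le> (\<Sum>i=4*n..<4 * s (Suc j). ?a i)"
        by (rule sum_mono2) (auto simp: sS)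
      then show ?thesis by (intro mult_left_mono) auto
    qed
    finally show ?case using b Suc sS[of j] by auto
  qed (simp add: s0)
  let ?E = "exp (8 * \<delta>)"
  have low: "?b n / (real n * ?E) ^ d \<le> ?b (s j) / real (s j) ^ d" for j
  proof -
    have "n * 1 \<le> n * 2 ^ j" by (intro mult_le_mono2) simp
    then have sp: "s j > 0" using inv[of j] n(1) by linarith
    have "real (s j) \<le> 2 ^ j * real n * exp (8 * (\<Sum>i=4*n..<4 * s j. ?a i))" using inv by blast
    also have "\<dots> \<le> 2 ^ j * real n * ?E" using part by (intro mult_left_mono) auto
    finally have "real (s j) ^ d \<le> (2 ^ j * real n * ?E) ^ d" by (intro power_mono) auto
    also have "\<dots> = 2 ^ (d * j) * (real n * ?E) ^ d"
      by (simp add: power_mult_distrib power_mult[symmetric] mult.commute)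
    finally have *: "real (s j) ^ d \<le> 2 ^ (d * j) * (real n * ?E) ^ d" .
    have bn: "0 \<le> ?b n" using pos[of n] by simp
    have "?b n / (real n * ?E) ^ d = (2 ^ (d * j) * ?b n) / (2 ^ (d * j) * (real n * ?E) ^ d)" by simp
    also have "\<dots> \<le> (2 ^ (d * j) * ?b n) / real (s j) ^ d"
      using * sp bn n by (intro divide_left_mono mult_nonneg_nonneg mult_pos_pos) auto
    also have "\<dots> \<le> ?b (s j) / real (s j) ^ d" using inv[of j] by (intro divide_right_mono) auto
    finally show ?thesis .
  qed
  have "strict_mono s"
  proof (rule strict_mono_Suc_iff[THEN iffD2], rule allI)
    fix j
    have "n * 1 \<le> n * 2 ^ j" by (intro mult_le_mono2) simp
    then have "s j > 0" using inv[of j] n(1) by linarith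
    then show "s j < s (Suc j)" by (simp add: sS)
  qed
  from LIMSEQ_subseq_LIMSEQ[OF entropy_limit(1)[OF S ne] this]
  have "(\<lambda>j. ?b (s j) / real (s j) ^ d) \<longlonglongrightarrow> entropy d \<Sigma>" by (simp add: o_def)
  then have h: "?b n / (real n * ?E) ^ d \<le> entropy d \<Sigma>"
    using low by (intro LIMSEQ_le_const) auto
  have bk: "?b n / real n ^ d \<le> real k"
  proof -
    have "real (?c n) \<le> real (k ^ n ^ d)"
      using lang_on_bound(2)[OF S finite_box box_subset_Zd, of n] by (simp only: of_nat_le_iff card_box)
    moreover have k: "k > 0"
    proof (rule ccontr)
      assume "\<not> k > 0"
      then have "?c n \<le> 0" using lang_on_bound(2)[OF S finite_box box_subset_Zd, of n] n
        by (simp add: card_box power_0_left)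
      then show False using pos[of n] by simp
    qed
    ultimately have "?b n \<le> real (n ^ d) * log 2 (real k)"
      using pos[of n] by (subst log_nat_power[symmetric]) auto
    also have "log 2 (real k) \<le> real k"
      using log2_of_power_le[of k k] k less_exp[of k] by (simp add: less_imp_le)
    finally show ?thesis using n by (simp add: field_simps mult_left_mono)
  qed
  have "?b n / real n ^ d * exp (- (8 * real d * \<delta>)) = ?b n / (real n * ?E) ^ d"
    by (simp add: power_mult_distrib exp_minus field_simps exp_of_nat_mult[symmetric])
  then have "?b n / real n ^ d - entropy d \<Sigma> \<le> ?b n / real n ^ d - ?b n / real n ^ d * exp (- (8 * real d * \<delta>))"
    using h by linarith
  also have "\<dots> = ?b n / real n ^ d * (1 - exp (- (8 * real d * \<delta>)))"
    by (simp only: right_diff_distrib mult_1_right)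
  also have "\<dots> \<le> ?b n / real n ^ d * (8 * real d * \<delta>)"
  proof (rule mult_left_mono)
    show "1 - exp (- (8 * real d * \<delta>)) \<le> 8 * real d * \<delta>"
      using exp_ge_add_one_self[of "- (8 * real d * \<delta>)"] by simp
    show "0 \<le> ?b n / real n ^ d" using pos[of n] by simp
  qed
  also have "\<dots> \<le> real k * (8 * real d * \<delta>)"
  proof (rule mult_right_mono[OF bk])
    show "0 \<le> 8 * real d * \<delta>" using part[of 0] by simp
  qed
  finally show ?thesis .
qed

section \<open>Computing the number of patterns\<close>

text \<open>Used in two ways: base \<open>k\<close> digits of the numbers below
  \<open>k ^ (n ^ d)\<close> list the candidate patterns on a box, base \<open>n\<close> digits of
  the numbers below \<open>n ^ d\<close> list its sites.\<close>

definition digit :: "nat \<Rightarrow> nat \<Rightarrow> nat \<Rightarrow> nat" where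
  "digit k c i = c div k ^ i mod k"

lemma recf_digit: "recf f \<Longrightarrow> recf g \<Longrightarrow> recf h \<Longrightarrow> recf (\<lambda>x. digit (f x) (g x) (h x))"
  unfolding digit_def by (intro recf_intros)

lemma digit_less: "k > 0 \<Longrightarrow> digit k c i < k"
  by (simp add: digit_def)

lemma digits_inj:
  assumes "k > 0" "c < k ^ n" "c' < k ^ n" "\<And>i. i < n \<Longrightarrow> digit k c i = digit k c' i"
  shows "c = c'"
  using assms(2-4)
proof (induction n arbitrary: c c')
  case (Suc n)
  have "digit k (c div k) i = digit k (c' div k) i" if "i < n" for i
    using Suc.prems(3)[of "Suc i"] that by (simp add: digit_def div_mult2_eq)
  moreover have "c div k < k ^ n" "c' div k < k ^ n"
    using Suc.prems assms(1) by (auto simp: div_less_iff_less_mult mult.commute)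
  ultimately have "c div k = c' div k" using Suc.IH by blast
  moreover have "c mod k = c' mod k" using Suc.prems(3)[of 0] by (simp add: digit_def)
  ultimately show ?case by (metis div_mult_mod_eq)
qed simp

lemma digits_bij:
  assumes "k > 0"
  shows "bij_betw (\<lambda>c. \<lambda>i\<in>{..<n}. digit k c i) {..<k ^ n} ({..<n} \<rightarrow>\<^sub>E {..<k})"
proof -
  let ?f = "\<lambda>c. \<lambda>i\<in>{..<n}. digit k c i"
  have inj: "inj_on ?f {..<k ^ n}"
  proof (rule inj_onI)
    fix c c' assume c: "c \<in> {..<k ^ n}" "c' \<in> {..<k ^ n}" and e: "?f c = ?f c'"
    have "digit k c i = digit k c' i" if "i < n" for i using fun_cong[OF e, of i] that by simp
    then show "c = c'" using digits_inj[OF assms] c by blast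
  qed
  moreover have "?f ` {..<k ^ n} = {..<n} \<rightarrow>\<^sub>E {..<k}"
  proof (rule card_subset_eq)
    show "finite ({..<n} \<rightarrow>\<^sub>E {..<k})" by (intro finite_PiE) auto
    show "?f ` {..<k ^ n} \<subseteq> {..<n} \<rightarrow>\<^sub>E {..<k}"
      using digit_less[OF assms] by (intro image_subsetI) (simp add: restrict_PiE_iff)
    show "card (?f ` {..<k ^ n}) = card ({..<n} \<rightarrow>\<^sub>E {..<k})"
      using inj by (simp add: card_image card_PiE)
  qed
  ultimately show ?thesis by (simp add: bij_betw_def)
qed

lemma ex_digits:
  assumes "k > 0" "\<And>i. i < n \<Longrightarrow> g i < k"
  shows "\<exists>c<k ^ n. \<forall>i<n. digit k c i = g i"
proof -
  have "(\<lambda>i\<in>{..<n}. g i) \<in> {..<n} \<rightarrow>\<^sub>E {..<k}" using assms(2) by auto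
  then have "(\<lambda>i\<in>{..<n}. g i) \<in> (\<lambda>c. \<lambda>i\<in>{..<n}. digit k c i) ` {..<k ^ n}"
    using digits_bij[OF assms(1), of n] by (simp add: bij_betw_def)
  then obtain c where c: "c < k ^ n" "(\<lambda>i\<in>{..<n}. g i) = (\<lambda>i\<in>{..<n}. digit k c i)" by blast
  have "digit k c i = g i" if "i < n" for i using fun_cong[OF c(2), of i] that by simp
  with c(1) show ?thesis by blast
qed

definition cell_at :: "nat \<Rightarrow> nat \<Rightarrow> nat \<Rightarrow> int list" where
  "cell_at d n i = map (\<lambda>j. int (digit n i j)) [0..<d]"

lemma bij_cell_at:
  assumes "n > 0"
  shows "bij_betw (cell_at d n) {..<n ^ d} (box d n)"
proof -
  have inj: "inj_on (cell_at d n) {..<n ^ d}"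
  proof (rule inj_onI)
    fix i i' assume i: "i \<in> {..<n ^ d}" "i' \<in> {..<n ^ d}" and e: "cell_at d n i = cell_at d n i'"
    have "digit n i j = digit n i' j" if "j < d" for j
      using arg_cong[OF e, of "\<lambda>xs. xs ! j"] that by (simp add: cell_at_def)
    then show "i = i'" using digits_inj[OF assms] i by blast
  qed
  moreover have "cell_at d n ` {..<n ^ d} = box d n"
  proof (rule card_subset_eq)
    show "cell_at d n ` {..<n ^ d} \<subseteq> box d n"
      using digit_less[OF assms] by (auto simp: cell_at_def mem_box)
    show "card (cell_at d n ` {..<n ^ d}) = card (box d n)"
      using inj by (simp add: card_image card_box)
  qed simp
  ultimately show ?thesis by (simp add: bij_betw_def)
qed

definition listing :: "nat \<Rightarrow> nat \<Rightarrow> nat \<Rightarrow> nat \<Rightarrow> (int list \<times> nat) list" where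
  "listing d k n c = map (\<lambda>i. (cell_at d n i, digit k c i)) [0..<n ^ d]"

text \<open>The code of \<open>listing\<close>, written with operations on natural numbers only; the
  factor 2 is the integer code of a nonnegative number.\<close>

definition lcode :: "nat \<Rightarrow> nat \<Rightarrow> nat \<Rightarrow> nat \<Rightarrow> nat" where
  "lcode d k n c = list_encode (map (\<lambda>i. ppair (list_encode (map (\<lambda>j. 2 * digit n i j) [0..<d])) (digit k c i))
     [0..<n ^ d])"

lemma int_encode_int: "int_encode (int a) = 2 * a"
  by (simp add: int_encode_def sum_encode_def)

lemma listing_code: "listing_code (listing d k n c) = lcode d k n c"
  by (simp add: listing_code_def listing_def lcode_def cell_at_def ppair_def int_encode_int o_def)

lemma recf_lcode:
  assumes "recf k" "recf n" "recf c"
  shows "recf (\<lambda>x. lcode d (k x) (n x) (c x))"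
  by (rule recf_comp3[of "lcode d"])
    (unfold lcode_def, intro recf_intros recf_list_intros recf_digit, (rule assms)+)

lemma pattern_listing_listing:
  assumes "n > 0" "k > 0"
  shows "pattern_listing d k (listing d k n c)"
proof -
  have "map fst (listing d k n c) = map (cell_at d n) [0..<n ^ d]" by (simp add: listing_def o_def)
  then have "distinct (map fst (listing d k n c))"
    using bij_cell_at[OF assms(1), of d] by (simp add: distinct_map bij_betw_def atLeast0LessThan)
  moreover have "set (listing d k n c) \<subseteq> Zd d \<times> {..<k}"
    using digit_less[OF assms(2)] by (auto simp: listing_def cell_at_def Zd_def)
  ultimately show ?thesis by (simp add: pattern_listing_def)
qed

lemma map_of_listing:
  assumes n: "n > 0"
  shows "i < n ^ d \<Longrightarrow> map_of (listing d k n c) (cell_at d n i) = Some (digit k c i)"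
    and "j \<notin> box d n \<Longrightarrow> map_of (listing d k n c) j = None"
proof -
  have fst: "map fst (listing d k n c) = map (cell_at d n) [0..<n ^ d]" by (simp add: listing_def o_def)
  then have "distinct (map fst (listing d k n c))"
    using bij_cell_at[OF n, of d] by (simp add: distinct_map bij_betw_def atLeast0LessThan)
  then show "i < n ^ d \<Longrightarrow> map_of (listing d k n c) (cell_at d n i) = Some (digit k c i)"
    by (rule map_of_is_SomeI) (auto simp: listing_def)
  have "fst ` set (listing d k n c) = box d n"
    using fst bij_cell_at[OF n, of d] by (metis bij_betw_imp_surj_on list.set_map set_upt atLeast0LessThan)
  then show "j \<notin> box d n \<Longrightarrow> map_of (listing d k n c) j = None"
    by (simp add: map_of_eq_None_iff)
qed

lemma dom_lang_on: "p \<in> lang_on \<Sigma> U \<Longrightarrow> dom p = U"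
  by (auto simp: lang_on_def pattern_at_def restrict_map_def split: if_splits)

text \<open>A pattern determines its support as its domain, so at most one member of the union
  defining the language can contain it.\<close>

lemma language_iff: "finite (dom p) \<Longrightarrow> dom p \<subseteq> Zd d \<Longrightarrow> p \<in> language d \<Sigma> \<longleftrightarrow> p \<in> lang_on \<Sigma> (dom p)"
  unfolding language_def using dom_lang_on[of p \<Sigma>] by blast

lemma card_listings:
  assumes S: "subshift d k \<Sigma>" and n: "n > 0" and k: "k > 0"
  shows "card {c. c < k ^ (n ^ d) \<and> map_of (listing d k n c) \<in> language d \<Sigma>} = card (lang_on \<Sigma> (box d n))"
proof (rule bij_betw_same_card[of "\<lambda>c. map_of (listing d k n c)"])
  let ?p = "\<lambda>c. map_of (listing d k n c)"
  let ?C = "{c. c < k ^ (n ^ d) \<and> ?p c \<in> language d \<Sigma>}"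
  have cells: "\<exists>i<n ^ d. j = cell_at d n i" if "j \<in> box d n" for j
    using bij_cell_at[OF n, of d] that by (auto simp: bij_betw_def)
  have dom: "dom (?p c) = box d n" for c
    using map_of_listing[OF n, where k = k and d = d and c = c] cells by (fastforce simp: dom_def)
  have inj: "inj_on ?p ?C"
  proof (rule inj_onI)
    fix c c' assume c: "c \<in> ?C" "c' \<in> ?C" and e: "?p c = ?p c'"
    have "digit k c i = digit k c' i" if "i < n ^ d" for i
      using fun_cong[OF e, of "cell_at d n i"] map_of_listing(1)[OF n that] by simp
    then show "c = c'" using digits_inj[OF k] c by blast
  qed
  have "?p ` ?C = lang_on \<Sigma> (box d n)"
  proof (intro equalityI subsetI)
    fix p assume "p \<in> ?p ` ?C"
    then show "p \<in> lang_on \<Sigma> (box d n)"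
      using language_iff[of p d \<Sigma>] dom box_subset_Zd by fastforce
  next
    fix p assume p: "p \<in> lang_on \<Sigma> (box d n)"
    then obtain x where x: "x \<in> \<Sigma>" "p = pattern_at x (box d n)" by (auto simp: lang_on_def)
    have "x (cell_at d n i) < k" if "i < n ^ d" for i
    proof -
      have "cell_at d n i \<in> Zd d" by (simp add: cell_at_def Zd_def)
      then show ?thesis using subshift_less[OF S x(1)] by blast
    qed
    then obtain c where c: "c < k ^ (n ^ d)" "\<And>i. i < n ^ d \<Longrightarrow> digit k c i = x (cell_at d n i)"
      using ex_digits[OF k, of "n ^ d" "\<lambda>i. x (cell_at d n i)"] by blast
    have "?p c = p"
    proof
      fix j
      show "?p c j = p j"
      proof (cases "j \<in> box d n")
        case True
        then obtain i where i: "i < n ^ d" "j = cell_at d n i" using cells by blast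
        then show ?thesis using True map_of_listing(1)[OF n i(1)] c(2) by (simp add: x(2) pattern_at_def)
      next
        case False
        then show ?thesis using map_of_listing(2)[OF n] by (simp add: x(2) pattern_at_def)
      qed
    qed
    moreover have "p \<in> language d \<Sigma>"
      using p language_iff[of p d \<Sigma>] dom_lang_on[OF p] box_subset_Zd by simp
    ultimately show "p \<in> ?p ` ?C" using c(1) by blast
  qed
  with inj show "bij_betw ?p ?C (lang_on \<Sigma> (box d n))" by (simp add: bij_betw_def)
qed

text \<open>A common time bound for all queries about a box: a single search for \<open>T\<close>
  makes all answers available at once, and the count is their sum.\<close>

definition all_halt :: "nat \<Rightarrow> nat \<Rightarrow> nat \<Rightarrow> nat \<Rightarrow> nat \<Rightarrow> bool" where
  "all_halt d k e n T \<longleftrightarrow> (\<forall>c<k ^ (n ^ d). uhalt e (lcode d k n c) T)"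

definition pattern_count :: "nat \<Rightarrow> nat \<Rightarrow> nat \<Rightarrow> nat \<Rightarrow> nat \<Rightarrow> nat" where
  "pattern_count d k e n T = (\<Sum>c<k ^ (n ^ d). uout e (lcode d k n c) T)"

lemma pattern_count:
  assumes S: "subshift d k \<Sigma>" and dec: "decides_language d k (nth_tm e) \<Sigma>" and n: "n > 0" and k: "k > 0"
  shows "\<exists>T. all_halt d k e n T"
    and "all_halt d k e n T \<Longrightarrow> pattern_count d k e n T = card (lang_on \<Sigma> (box d n))"
proof -
  have dec: "tm_computes (nth_tm e) (lcode d k n c) (of_bool (map_of (listing d k n c) \<in> language d \<Sigma>))" for c
    using dec pattern_listing_listing[OF n k, of d c] unfolding decides_language_def
    by (auto simp: listing_code[symmetric] of_bool_def)
  then have "\<exists>T. uhalt e (lcode d k n c) T" for c using tm_computes_uhalt(1) by blast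
  then obtain t where t: "\<And>c. uhalt e (lcode d k n c) (t c)" by metis
  have "all_halt d k e n (\<Sum>c<k ^ (n ^ d). t c)"
    unfolding all_halt_def
  proof (intro allI impI)
    fix c assume "c < k ^ (n ^ d)"
    then have "t c \<le> (\<Sum>c<k ^ (n ^ d). t c)" by (intro member_le_sum) auto
    then show "uhalt e (lcode d k n c) (\<Sum>c<k ^ (n ^ d). t c)" using urun_stable(2)[OF t] by blast
  qed
  then show "\<exists>T. all_halt d k e n T" by blast
  assume "all_halt d k e n T"
  then have "pattern_count d k e n T = (\<Sum>c<k ^ (n ^ d). of_bool (map_of (listing d k n c) \<in> language d \<Sigma>))"
    unfolding pattern_count_def all_halt_def using tm_computes_uhalt(2)[OF dec] by (intro sum.cong) auto
  also have "\<dots> = card {c. c < k ^ (n ^ d) \<and> map_of (listing d k n c) \<in> language d \<Sigma>}"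
    by (simp add: Int_def)
  finally show "pattern_count d k e n T = card (lang_on \<Sigma> (box d n))"
    using card_listings[OF S n k] by simp
qed

section \<open>Rational upper bounds for logarithms of counts\<close>

definition log_floor :: "nat \<Rightarrow> nat" where
  "log_floor x = rec_nat 0 (\<lambda>i a. if 2 ^ Suc a \<le> x then Suc a else a) x"

lemma log_floor:
  assumes "x > 0"
  shows "2 ^ log_floor x \<le> x" "x < 2 ^ Suc (log_floor x)"
proof -
  let ?r = "\<lambda>i. rec_nat 0 (\<lambda>i a. if 2 ^ Suc a \<le> x then Suc a else a) i"
  have "2 ^ ?r i \<le> x \<and> (?r i = i \<or> x < 2 ^ Suc (?r i))" for i
    by (induction i) (use assms in auto)
  from this[of x] show "2 ^ log_floor x \<le> x" "x < 2 ^ Suc (log_floor x)"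
    using less_le_trans[OF less_exp[of x], of "2 ^ Suc x"] by (auto simp: log_floor_def)
qed

lemma recf_log_floor: "recf f \<Longrightarrow> recf (\<lambda>x. log_floor (f x))"
  by (rule recf_comp[of log_floor]) (unfold log_floor_def, intro recf_intros)

text \<open>Rounding up \<open>log 2 (c ^ n)\<close> instead of \<open>log 2 c\<close> divides the
  rounding error by \<open>n\<close>. The factor 2 codes a nonnegative numerator, and
  \<open>rat_of_code\<close> adds 1 to the second component, whence the \<open>- 1\<close>.\<close>

definition entropy_code :: "nat \<Rightarrow> nat \<Rightarrow> nat \<Rightarrow> nat" where
  "entropy_code d c n = ppair (2 * Suc (log_floor (c ^ n))) (n ^ Suc d - 1)"

lemma recf_entropy_code: "recf f \<Longrightarrow> recf g \<Longrightarrow> recf (\<lambda>x. entropy_code d (f x) (g x))"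
  unfolding entropy_code_def by (intro recf_intros recf_log_floor)

lemma rat_of_code_ppair:
  "B > 0 \<Longrightarrow> real_of_rat (rat_of_code (ppair (2 * a) (B - 1))) = real a / real B"
proof -
  assume B: "B > 0"
  have "int_decode (2 * a) = int a" by (metis int_encode_int int_encode_inverse)
  then have "rat_of_code (ppair (2 * a) (B - 1)) = of_nat a / of_nat B"
    using B by (simp add: rat_of_code_def ppair_def)
  then show ?thesis by (simp add: of_rat_divide)
qed

lemma entropy_code_bounds:
  assumes "c > 0" "n > 0"
  shows "log 2 (real c) / real n ^ d \<le> real_of_rat (rat_of_code (entropy_code d c n))"
    and "real_of_rat (rat_of_code (entropy_code d c n)) \<le> log 2 (real c) / real n ^ d + 1 / real n ^ Suc d"
proof -
  let ?l = "log_floor (c ^ n)"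
  have cn: "c ^ n > 0" using assms by simp
  have eq: "real_of_rat (rat_of_code (entropy_code d c n)) = real (Suc ?l) / real n ^ Suc d"
    using rat_of_code_ppair[of "n ^ Suc d" "Suc ?l"] assms(2) by (simp add: entropy_code_def)
  have lg: "log 2 (real (c ^ n)) = real n * log 2 (real c)"
    using assms by (simp add: log_nat_power)
  have "real (c ^ n) \<le> real (2 ^ Suc ?l)" using log_floor(2)[OF cn] by (intro of_nat_mono less_imp_le)
  then have "log 2 (real (c ^ n)) \<le> log 2 (2 ^ Suc ?l)"
    by (subst log_le_cancel_iff) (simp_all add: assms(1))
  then have up: "real n * log 2 (real c) \<le> real (Suc ?l)" by (simp add: lg log_nat_power del: power_Suc)
  have "real (2 ^ ?l) \<le> real (c ^ n)" using log_floor(1)[OF cn] by (rule of_nat_mono)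
  then have "log 2 (2 ^ ?l) \<le> log 2 (real (c ^ n))"
    by (subst log_le_cancel_iff) (simp_all add: assms(1))
  then have low: "real ?l \<le> real n * log 2 (real c)" by (simp add: lg log_nat_power)
  have "log 2 (real c) / real n ^ d = real n * log 2 (real c) / real n ^ Suc d" using assms(2) by simp
  also have "\<dots> \<le> real (Suc ?l) / real n ^ Suc d" using up by (intro divide_right_mono) auto
  finally show "log 2 (real c) / real n ^ d \<le> real_of_rat (rat_of_code (entropy_code d c n))" by (simp only: eq)
  have "real (Suc ?l) / real n ^ Suc d \<le> (real n * log 2 (real c) + 1) / real n ^ Suc d"
    using low by (intro divide_right_mono) auto
  also have "\<dots> = log 2 (real c) / real n ^ d + 1 / real n ^ Suc d"
    using assms(2) by (simp add: add_divide_distrib)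
  finally show "real_of_rat (rat_of_code (entropy_code d c n)) \<le> log 2 (real c) / real n ^ d + 1 / real n ^ Suc d"
    by (simp only: eq)
qed

lemma recp_all_halt:
  assumes "recf k" "recf e" "recf n" "recf t"
  shows "recp (\<lambda>x. all_halt d (k x) (e x) (n x) (t x))"
  by (rule recf_comp4[of "\<lambda>k e n t. of_bool (all_halt d k e n t)"])
    (unfold all_halt_def, intro recf_intros recp_uhalt recf_lcode, (rule assms)+)

lemma recf_pattern_count:
  assumes "recf k" "recf e" "recf n" "recf t"
  shows "recf (\<lambda>x. pattern_count d (k x) (e x) (n x) (t x))"
  by (rule recf_comp4[of "pattern_count d"])
    (unfold pattern_count_def, intro recf_intros recf_uout recf_lcode, (rule assms)+)

section \<open>The entropy as an infimum and as the output of an algorithm\<close>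

lemma INF_eq_limit:
  fixes u :: "nat \<Rightarrow> real"
  assumes "\<And>n. h \<le> u n" "u \<longlonglongrightarrow> h"
  shows "bdd_below (range u)" "(INF n. u n) = h"
proof -
  show b: "bdd_below (range u)" using assms(1) by (auto intro: bdd_belowI[of _ h])
  show "(INF n. u n) = h"
  proof (rule antisym)
    show "(INF n. u n) \<le> h"
      using assms(2) b by (intro LIMSEQ_le_const[of u]) (auto intro: cINF_lower)
    show "h \<le> (INF n. u n)" using assms(1) by (intro cINF_greatest) auto
  qed
qed

lemma alphabet_pos:
  assumes "subshift d k \<Sigma>" "\<Sigma> \<noteq> {}"
  shows "k > 0"
proof -
  obtain x where "x \<in> \<Sigma>" using assms(2) by blast
  moreover have "replicate d 0 \<in> Zd d" by (simp add: Zd_def)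
  ultimately show ?thesis using subshift_less[OF assms(1)] by fastforce
qed

text \<open>The entropy is a lower bound of all normalised logarithms of counts and also their
  limit. Rounding upwards with an error that tends to 0 preserves both properties, and side
  \<open>Suc n\<close> avoids the empty box.\<close>

lemma entropy_Pi1:
  assumes "decidable_subshift d k \<Sigma>" and ne: "\<Sigma> \<noteq> {}"
  shows "Pi1_computable (entropy d \<Sigma>)"
proof -
  obtain e where S: "subshift d k \<Sigma>" and dec: "decides_language d k (nth_tm e) \<Sigma>"
    using assms(1) nth_tm_surj unfolding decidable_subshift_def by metis
  have k: "k > 0" using alphabet_pos[OF S ne] .
  define t where "t n = (LEAST T. all_halt d k e (Suc n) T)" for n
  define g where "g n = entropy_code d (pattern_count d k e (Suc n) (t n)) (Suc n)" for n
  have "recf t"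
    unfolding t_def
    by (rule recf_Least) (intro recp_all_halt recf_intros pattern_count(1)[OF S dec] zero_less_Suc k)+
  then have "recf g" unfolding g_def by (intro recf_entropy_code recf_pattern_count recf_intros)
  let ?c = "\<lambda>n. card (lang_on \<Sigma> (box d n))"
  have "all_halt d k e (Suc n) (t n)" for n
    unfolding t_def by (rule LeastI_ex) (rule pattern_count(1)[OF S dec zero_less_Suc k])
  then have g: "g n = entropy_code d (?c (Suc n)) (Suc n)" for n
    unfolding g_def by (simp add: pattern_count(2)[OF S dec _ k])
  have pos: "?c n > 0" for n using card_lang_on_pos[OF S finite_box box_subset_Zd ne] .
  let ?u = "\<lambda>n. real_of_rat (rat_of_code (g n))"
  let ?a = "\<lambda>n. log 2 (real (?c n)) / real n ^ d"
  have a: "(\<lambda>n. ?a (Suc n)) \<longlonglongrightarrow> entropy d \<Sigma>"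
    using entropy_limit(1)[OF S ne] by (rule LIMSEQ_Suc)
  have low: "?a (Suc n) \<le> ?u n" and up: "?u n \<le> ?a (Suc n) + 1 / real (Suc n) ^ Suc d" for n
    unfolding g using entropy_code_bounds[OF pos[of "Suc n"] zero_less_Suc[of n], of d] by auto
  have "?u \<longlonglongrightarrow> entropy d \<Sigma>"
  proof (rule tendsto_sandwich[OF _ _ a])
    have "1 / real (Suc n) ^ Suc d \<le> inverse (real (Suc n))" for n
    proof -
      have "real (Suc n) * 1 \<le> real (Suc n) * real (Suc n) ^ d"
        by (intro mult_left_mono one_le_power) auto
      then show ?thesis by (simp add: divide_simps)
    qed
    then have "?u n \<le> ?a (Suc n) + inverse (real (Suc n))" for n using up[of n] by (meson add_left_mono order_trans)
    then show "eventually (\<lambda>n. ?u n \<le> ?a (Suc n) + inverse (real (Suc n))) sequentially" by simp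
    show "(\<lambda>n. ?a (Suc n) + inverse (real (Suc n))) \<longlonglongrightarrow> entropy d \<Sigma>"
      using tendsto_add[OF a LIMSEQ_inverse_real_of_nat] by simp
  qed (use low in auto)
  moreover have "entropy d \<Sigma> \<le> ?u n" for n
    using entropy_limit(3)[OF S ne, of "Suc n"] low[of n] by simp
  ultimately have "bdd_below (range ?u)" "(INF n. ?u n) = entropy d \<Sigma>"
    using INF_eq_limit[of "entropy d \<Sigma>" ?u] by auto
  then show ?thesis
    unfolding Pi1_computable_def computable_rat_seq_def using recf_computable[OF \<open>recf g\<close>]
    by (intro exI[of _ "\<lambda>n. rat_of_code (g n)"]) auto
qed

lemma entropy_algorithm_of_rate:
  assumes f: "mono f" and d: "d \<ge> 1"
    and conv: "converges_at_computable_rate (\<lambda>n. real (f n) / real n ^ 2)"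
  shows "entropy_algorithm_exists d (irreducible_decidable_class d f)"
proof -
  obtain N where "computable N" and sm: "summable (\<lambda>n. real (f n) / real n ^ 2)"
    and tail: "\<And>t. \<bar>\<Sum>i. real (f (i + N t)) / real (i + N t) ^ 2\<bar> \<le> 1 / 2 ^ t"
    using conv unfolding converges_at_computable_rate_def by blast
  then have N: "recf N" by (simp add: computable_recf)
  \<comment> \<open>The argument codes alphabet \<open>k\<close>, index and precision
    \<open>m\<close>. A tail below \<open>1 / 2 ^ (m + k + d + 4)\<close> makes the error
    \<open>8 * k * d\<close> times that tail at most \<open>1 / 2 ^ (m + 1)\<close>, because
    \<open>k \<le> 2 ^ k\<close> and \<open>d \<le> 2 ^ d\<close>; the summand
    \<open>2 ^ (m + 1)\<close> does the same for the rounding error.\<close>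
  define n where "n x = N (psnd x + pfst (pfst x) + d + 4) + 2 ^ Suc (psnd x)" for x
  have n: "recf n" unfolding n_def by (intro recf_intros recf_comp[OF N])
  define P where "P x = all_halt d (pfst (pfst x)) (psnd (pfst x)) (n x)" for x
  define g where "g x T = entropy_code d (pattern_count d (pfst (pfst x)) (psnd (pfst x)) (n x) T) (n x)" for x T
  have prec: "partial_rec (\<lambda>x y. (\<exists>T. P x T) \<and> y = g x (LEAST T. P x T))"
    unfolding P_def g_def
    by (rule partial_rec_Least)
      (intro recp_all_halt recf_entropy_code recf_pattern_count recf_intros recf_comp[OF n])+
  have "\<exists>M. \<forall>x. (\<exists>T. P x T) \<longrightarrow> tm_computes M x (g x (LEAST T. P x T))"
  proof (rule partial_rec_tm[OF prec])
    fix M assume "\<And>x y. (\<exists>T. P x T) \<and> y = g x (LEAST T. P x T) \<Longrightarrow> tm_computes M x y"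
    then show ?thesis by (intro exI[of _ M]) simp
  qed
  then obtain M where M: "\<And>x. \<exists>T. P x T \<Longrightarrow> tm_computes M x (g x (LEAST T. P x T))" by blast
  have "\<exists>c. tm_computes M (prod_encode (prod_encode (k, e), m)) c
      \<and> \<bar>entropy d \<Sigma> - real_of_rat (rat_of_code c)\<bar> \<le> 1 / 2 ^ m"
    if kS: "(k, \<Sigma>) \<in> irreducible_decidable_class d f" and dec: "decides_language d k (nth_tm e) \<Sigma>" for k \<Sigma> e m
  proof -
    have S: "subshift d k \<Sigma>" and ne: "\<Sigma> \<noteq> {}" and irr: "irreducible d f \<Sigma>"
      using kS by (auto simp: irreducible_decidable_class_def decidable_subshift_def)
    have k: "k > 0" using alphabet_pos[OF S ne] .
    let ?x = "ppair (ppair k e) m" and ?t = "m + k + d + 4"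
    let ?n = "n ?x" and ?c = "\<lambda>n. card (lang_on \<Sigma> (box d n))"
    have nx: "?n = N ?t + 2 ^ Suc m" by (simp add: n_def)
    then have n0: "?n > 0" by simp
    have Px: "P ?x = all_halt d k e ?n" by (simp add: P_def)
    have ex: "\<exists>T. P ?x T" unfolding Px using pattern_count(1)[OF S dec n0 k] .
    then have "P ?x (LEAST T. P ?x T)" by (rule LeastI_ex)
    then have c: "g ?x (LEAST T. P ?x T) = entropy_code d (?c ?n) ?n"
      unfolding g_def using pattern_count(2)[OF S dec n0 k] by (simp add: Px)
    have M: "tm_computes M ?x (entropy_code d (?c ?n) ?n)" using M[OF ex] unfolding c .
    let ?r = "real_of_rat (rat_of_code (entropy_code d (?c ?n) ?n))"
    let ?b = "log 2 (real (?c ?n)) / real ?n ^ d"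
    have pos: "?c ?n > 0" using card_lang_on_pos[OF S finite_box box_subset_Zd ne] .
    have r: "?b \<le> ?r" "?r \<le> ?b + 1 / real ?n ^ Suc d" using entropy_code_bounds[OF pos n0] .
    have h: "entropy d \<Sigma> \<le> ?b" using entropy_limit(3)[OF S ne] n0 by simp
    have "?b - entropy d \<Sigma> \<le> real k * (8 * real d * (1 / 2 ^ ?t))"
    proof (rule entropy_rate[OF S ne irr f d _ _ sm])
      show "(\<Sum>i. real (f (i + N ?t)) / real (i + N ?t) ^ 2) \<le> 1 / 2 ^ ?t" using tail[of ?t] by linarith
      have "(8::real) \<le> 2 ^ ?t" using power_increasing[of 3 ?t "2::real"] by simp
      then show "8 * (1 / 2 ^ ?t) \<le> (1::real)" by simp
      show "1 \<le> ?n" using n0 by linarith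
      show "N ?t \<le> 4 * ?n" using nx by linarith
    qed
    also have "\<dots> \<le> 2 ^ k * (8 * 2 ^ d * (1 / 2 ^ ?t))"
      by (intro mult_mono) (auto simp: less_imp_le of_nat_less_two_power)
    also have "\<dots> = 1 / 2 ^ Suc m" by (simp add: power_add)
    finally have e1: "?b - entropy d \<Sigma> \<le> 1 / 2 ^ Suc m" .
    have "(2::real) ^ Suc m = real (2 ^ Suc m)" by simp
    also have "\<dots> \<le> real ?n" unfolding nx by (rule of_nat_mono) simp
    also have "\<dots> = real ?n * 1" by simp
    also have "\<dots> \<le> real ?n * real ?n ^ d" using n0 by (intro mult_left_mono one_le_power) auto
    finally have "1 / real ?n ^ Suc d \<le> 1 / 2 ^ Suc m" by (intro divide_left_mono) (use n0 in auto)
    with r e1 h have "\<bar>entropy d \<Sigma> - ?r\<bar> \<le> 1 / 2 ^ Suc m + 1 / 2 ^ Suc m" by linarith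
    also have "\<dots> = 1 / 2 ^ m" by simp
    finally show ?thesis using M by (auto simp: ppair_def)
  qed
  then show ?thesis unfolding entropy_algorithm_exists_def by blast
qed

section \<open>A noncomputable real number\<close>

text \<open>For one fixed subshift the alphabet and the index of a deciding machine are constants,
  so that the algorithm becomes a total recursive function of the precision.\<close>

lemma entropy_approximable:
  assumes "entropy_algorithm_exists d C" "(k, \<Sigma>) \<in> C" "decides_language d k M \<Sigma>"
  obtains g where "recf g" "\<And>m. \<bar>entropy d \<Sigma> - real_of_rat (rat_of_code (g m))\<bar> \<le> 1 / 2 ^ m"
proof -
  obtain e where e: "nth_tm e = M" using nth_tm_surj by blast
  obtain M' where M': "\<And>k \<Sigma> e m. (k, \<Sigma>) \<in> C \<Longrightarrow> decides_language d k (nth_tm e) \<Sigma> \<Longrightarrow>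
      \<exists>c. tm_computes M' (prod_encode (prod_encode (k, e), m)) c
              \<and> \<bar>entropy d \<Sigma> - real_of_rat (rat_of_code c)\<bar> \<le> 1 / 2 ^ m"
    using assms(1) unfolding entropy_algorithm_exists_def by blast
  obtain u where u: "nth_tm u = M'" using nth_tm_surj by blast
  have ex: "\<exists>c. tm_computes (nth_tm u) (ppair (ppair k e) m) c
     \<and> \<bar>entropy d \<Sigma> - real_of_rat (rat_of_code c)\<bar> \<le> 1 / 2 ^ m" for m
    using M'[OF assms(2), of e m] assms(3) by (simp add: e u ppair_def)
  then obtain c where c: "\<And>m. tm_computes (nth_tm u) (ppair (ppair k e) m) (c m)"
    "\<And>m. \<bar>entropy d \<Sigma> - real_of_rat (rat_of_code (c m))\<bar> \<le> 1 / 2 ^ m" by metis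
  define t where "t m = (LEAST T. uhalt u (ppair (ppair k e) m) T)" for m
  have t: "recf t"
    unfolding t_def
    by (rule recf_Least) (intro recp_uhalt recf_intros tm_computes_uhalt(1)[OF c(1)])+
  have "uhalt u (ppair (ppair k e) m) (t m)" for m
    unfolding t_def by (rule LeastI_ex) (rule tm_computes_uhalt(1)[OF c(1)])
  then have "c m = uout u (ppair (ppair k e) m) (t m)" for m using tm_computes_uhalt(2)[OF c(1)] by simp
  then have "c = (\<lambda>m. uout u (ppair (ppair k e) m) (t m))" by blast
  moreover have "recf (\<lambda>m. uout u (ppair (ppair k e) m) (t m))" using t by (intro recf_uout recf_intros)
  ultimately show thesis using that c(2) by simp
qed

definition diag :: "nat \<Rightarrow> nat \<Rightarrow> bool" where
  "diag i T \<longleftrightarrow> uhalt i i T \<and> uout i i T = 0"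

lemma recp_diag: "recf f \<Longrightarrow> recf g \<Longrightarrow> recp (\<lambda>x. diag (f x) (g x))"
  unfolding diag_def by (intro recf_intros recp_uhalt recf_uout)

lemma diag_mono: "diag i T \<Longrightarrow> T \<le> T' \<Longrightarrow> diag i T'"
  unfolding diag_def using urun_stable[of i i T T'] by simp

text \<open>Run on its own index, a decision procedure for this set would output 0 exactly if it
  outputs 1.\<close>

lemma diag_not_recursive: "\<not> recf (\<lambda>i. of_bool (\<exists>T. diag i T))"
proof
  assume "recf (\<lambda>i. of_bool (\<exists>T. diag i T))"
  then have "computable (\<lambda>i. of_bool (\<exists>T. diag i T))" by (rule recf_computable)
  then obtain j where j: "\<And>i. tm_computes (nth_tm j) i (of_bool (\<exists>T. diag i T))"
    using nth_tm_surj unfolding computable_def by metis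
  obtain T where T: "uhalt j j T" using tm_computes_uhalt(1)[OF j] by blast
  then have out: "uout j j T = of_bool (\<exists>T. diag j T)" by (rule tm_computes_uhalt(2)[OF j])
  show False
  proof (cases "\<exists>T. diag j T")
    case True
    then obtain T' where "uhalt j j T'" "uout j j T' = 0" unfolding diag_def by blast
    with tm_computes_uhalt(2)[OF j this(1)] True show False by simp
  next
    case False
    then have "uout j j T = 0" using out by simp
    with T have "diag j T" by (simp add: diag_def)
    with False show False by blast
  qed
qed

text \<open>The number \<open>2 - diag_sum T\<close> decreases to its limit, and a member
  \<open>i < T\<close> of the diagonal set that turns up only after time \<open>T\<close> still
  lowers it by \<open>1 / 4 ^ i\<close>. Knowing how close the limit is would exclude such late
  members.\<close>

definition diag_sum :: "nat \<Rightarrow> real" where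
  "diag_sum T = (\<Sum>i<T. of_bool (diag i T) / 4 ^ i)"

lemma diag_sum_mono: "T \<le> T' \<Longrightarrow> diag_sum T \<le> diag_sum T'"
proof -
  assume T: "T \<le> T'"
  have "diag_sum T \<le> (\<Sum>i<T. of_bool (diag i T') / 4 ^ i)"
    unfolding diag_sum_def using diag_mono[OF _ T] by (intro sum_mono divide_right_mono) auto
  also have "\<dots> \<le> diag_sum T'" unfolding diag_sum_def using T by (intro sum_mono2) auto
  finally show ?thesis .
qed

lemma diag_sum_less_2: "diag_sum T \<le> 2"
proof -
  have "(\<Sum>i<T. (1 / 4) ^ i) = 4 / 3 - 4 / 3 * (1 / 4 :: real) ^ T" for T :: nat
    by (induction T) auto
  then have "(\<Sum>i<T. (1 / 4) ^ i) \<le> (4 / 3 :: real)" by simp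
  then have "(\<Sum>i<T. 1 / 4 ^ i) \<le> (2::real)" by (simp add: power_one_over)
  moreover have "diag_sum T \<le> (\<Sum>i<T. 1 / 4 ^ i)"
    unfolding diag_sum_def by (intro sum_mono divide_right_mono) auto
  ultimately show ?thesis by linarith
qed

definition diag_num :: "nat \<Rightarrow> nat" where
  "diag_num T = 2 * 4 ^ T - (\<Sum>i<T. of_bool (diag i T) * 4 ^ (T - i))"

lemma recf_diag_num: "recf f \<Longrightarrow> recf (\<lambda>x. diag_num (f x))"
  by (rule recf_comp[of diag_num]) (unfold diag_num_def, intro recf_intros recp_diag)

lemma diag_num: "real (diag_num T) = (2 - diag_sum T) * 4 ^ T"
proof -
  have "real (of_bool (diag i T) * 4 ^ (T - i)) = of_bool (diag i T) / 4 ^ i * 4 ^ T" if "i < T" for i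
  proof -
    have "real (4 ^ (T - i)) = (4::real) ^ (T - i)" by simp
    also have "\<dots> = 4 ^ T / 4 ^ i" using that by (intro power_diff) auto
    finally show ?thesis by (simp only: of_nat_mult of_nat_of_bool) simp
  qed
  then have "real (\<Sum>i<T. of_bool (diag i T) * 4 ^ (T - i)) = (\<Sum>i<T. (of_bool (diag i T) / 4 ^ i) * 4 ^ T)"
    unfolding of_nat_sum by (intro sum.cong) auto
  also have "\<dots> = diag_sum T * 4 ^ T" by (simp add: diag_sum_def sum_distrib_right)
  finally have *: "real (\<Sum>i<T. of_bool (diag i T) * 4 ^ (T - i)) = diag_sum T * 4 ^ T" .
  also have "\<dots> \<le> 2 * 4 ^ T" using diag_sum_less_2 by (intro mult_right_mono) auto
  also have "\<dots> = real (2 * 4 ^ T)" by simp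
  finally have "(\<Sum>i<T. of_bool (diag i T) * 4 ^ (T - i)) \<le> (2 * 4 ^ T :: nat)" by (simp only: of_nat_le_iff)
  then show ?thesis unfolding diag_num_def using * by (simp add: of_nat_diff left_diff_distrib)
qed

lemma rat_of_code_numerator:
  "real_of_rat (rat_of_code c) =
    (real (if even (pfst c) then pfst c div 2 else 0) - real (if even (pfst c) then 0 else Suc (pfst c div 2)))
      / real (Suc (psnd c))"
proof -
  have "rat_of_code c = of_int (int_decode (pfst c)) / of_nat (Suc (psnd c))"
    by (simp add: rat_of_code_def pfst_def psnd_def split: prod.splits)
  then have "real_of_rat (rat_of_code c) = real_of_int (int_decode (pfst c)) / real (Suc (psnd c))"
    by (simp add: of_rat_divide del: of_nat_Suc)
  then show ?thesis by (auto simp: int_decode_def sum_decode_def)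
qed

text \<open>Clearing denominators, with the negative terms moved to the other side, yields a
  comparison that can be carried out in natural numbers; \<open>F\<close>, \<open>B\<close> and
  \<open>K\<close> will be \<open>4 ^ T\<close>, the denominator of the approximation and the
  inverse of its precision.\<close>

lemma scaled_le_iff:
  fixes F B K :: real
  assumes "F > 0" "B > 0" "K > 0"
  shows "u * F * B * K + q * F * K \<le> p * F * K + 2 * F * B \<longleftrightarrow> u - (p - q) / B \<le> 2 / K"
proof -
  have "u - (p - q) / B - 2 / K = (u * F * B * K + q * F * K - (p * F * K + 2 * F * B)) / (F * B * K)"
    using assms by (simp add: field_simps)
  then have "u - (p - q) / B - 2 / K \<le> 0 \<longleftrightarrow> u * F * B * K + q * F * K - (p * F * K + 2 * F * B) \<le> 0"
    using assms by (simp only: pos_divide_le_eq mult_pos_pos mult_zero_left)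
  then show ?thesis by linarith
qed

text \<open>Approximations of \<open>\<alpha>\<close> tell when the decreasing sequence defining it has come so close
  that the first \<open>i\<close> members of the diagonal set are settled.\<close>

lemma ex_Pi1_not_approximable:
  obtains \<alpha> where "\<alpha> \<ge> 0" "Pi1_computable \<alpha>"
    "\<And>g. recf g \<Longrightarrow> \<exists>m. \<not> \<bar>\<alpha> - real_of_rat (rat_of_code (g m))\<bar> \<le> 1 / 2 ^ m"
proof -
  define \<phi> where "\<phi> T = 2 - diag_sum T" for T
  define \<alpha> where "\<alpha> = (INF T. \<phi> T)"
  have bdd: "bdd_below (range \<phi>)"
    using diag_sum_less_2 by (auto simp: \<phi>_def intro!: bdd_belowI[of _ 0])
  have dec: "decseq \<phi>" by (auto simp: decseq_def \<phi>_def diag_sum_mono)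
  have lim: "\<phi> \<longlonglongrightarrow> \<alpha>" unfolding \<alpha>_def by (rule LIMSEQ_decseq_INF[OF bdd dec])
  have low: "\<alpha> \<le> \<phi> T" for T unfolding \<alpha>_def using bdd by (intro cINF_lower) auto
  let ?h = "\<lambda>T. ppair (2 * diag_num T) (4 ^ T - 1)"
  have h: "real_of_rat (rat_of_code (?h T)) = \<phi> T" for T
    using rat_of_code_ppair[of "4 ^ T" "diag_num T"] by (simp add: diag_num \<phi>_def)
  have "recf ?h" by (intro recf_intros recf_diag_num)
  then have "computable ?h" by (rule recf_computable)
  then have "computable_rat_seq (\<lambda>T. rat_of_code (?h T))" unfolding computable_rat_seq_def by blast
  then have Pi1: "Pi1_computable \<alpha>"
    unfolding Pi1_computable_def
    by (rule exI[of _ "\<lambda>T. rat_of_code (?h T)", OF conjI]) (simp only: h bdd \<alpha>_def simp_thms)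
  have nonneg: "\<alpha> \<ge> 0" unfolding \<alpha>_def using diag_sum_less_2 by (intro cINF_greatest) (auto simp: \<phi>_def)
  have False if g: "recf g" and approx: "\<And>m. \<bar>\<alpha> - real_of_rat (rat_of_code (g m))\<bar> \<le> 1 / 2 ^ m" for g
  proof -
    define p where "p c = (if even (pfst c) then pfst c div 2 else 0)" for c
    define q where "q c = (if even (pfst c) then 0 else Suc (pfst c div 2))" for c
    have ev: "recp (\<lambda>x. even (pfst (c x)))" if "recf c" for c
      unfolding even_iff_mod_2_eq_zero by (intro recf_intros recf_comp[OF that] that)
    have p: "recf (\<lambda>x. p (c x))" and q: "recf (\<lambda>x. q (c x))" if "recf c" for c
      unfolding p_def q_def by (intro recf_intros ev that)+
    \<comment> \<open>At this precision three errors add up to \<open>3 / 4\<close> of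
      \<open>1 / 4 ^ i\<close>, which is less than the contribution of a member
      \<open>i\<close>.\<close>
    let ?m = "\<lambda>i. 2 * i + 2 :: nat"
    \<comment> \<open>In integer form: \<open>\<phi> T\<close> exceeds the approximation by at most
      twice its precision, hence \<alpha> by at most three times. The condition \<open>i < T\<close>
      ensures that \<open>diag_sum T\<close> has a term for \<open>i\<close>.\<close>
    define Q where "Q i T \<longleftrightarrow> i < T \<and>
      diag_num T * Suc (psnd (g (?m i))) * 2 ^ ?m i + q (g (?m i)) * 4 ^ T * 2 ^ ?m i
        \<le> p (g (?m i)) * 4 ^ T * 2 ^ ?m i + 2 * 4 ^ T * Suc (psnd (g (?m i)))" for i T
    have Q: "Q i T \<longleftrightarrow> i < T \<and> \<phi> T - real_of_rat (rat_of_code (g (?m i))) \<le> 2 / 2 ^ ?m i" for i T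
    proof -
      let ?c = "g (?m i)"
      let ?B = "real (Suc (psnd ?c))" and ?K = "2 ^ ?m i :: real"
      have "(diag_num T * Suc (psnd ?c) * 2 ^ ?m i + q ?c * 4 ^ T * 2 ^ ?m i
          \<le> p ?c * 4 ^ T * 2 ^ ?m i + 2 * 4 ^ T * Suc (psnd ?c))
        \<longleftrightarrow> real (diag_num T * Suc (psnd ?c) * 2 ^ ?m i + q ?c * 4 ^ T * 2 ^ ?m i)
          \<le> real (p ?c * 4 ^ T * 2 ^ ?m i + 2 * 4 ^ T * Suc (psnd ?c))" by (rule of_nat_le_iff[symmetric])
      also have "\<dots> \<longleftrightarrow> \<phi> T * 4 ^ T * ?B * ?K + real (q ?c) * 4 ^ T * ?K
          \<le> real (p ?c) * 4 ^ T * ?K + 2 * 4 ^ T * ?B"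
        by (simp only: of_nat_add of_nat_mult of_nat_power of_nat_numeral diag_num \<phi>_def)
      also have "\<dots> \<longleftrightarrow> \<phi> T - (real (p ?c) - real (q ?c)) / ?B \<le> 2 / ?K"
        by (rule scaled_le_iff) simp_all
      also have "(real (p ?c) - real (q ?c)) / ?B = real_of_rat (rat_of_code ?c)"
        by (simp only: rat_of_code_numerator p_def q_def)
      finally show ?thesis unfolding Q_def by blast
    qed
    have ex: "\<exists>T. Q i T" for i
    proof -
      have "\<alpha> < \<alpha> + 1 / 2 ^ ?m i" by simp
      from order_tendstoD(2)[OF lim this] obtain T0 where T0: "\<And>T. T \<ge> T0 \<Longrightarrow> \<phi> T < \<alpha> + 1 / 2 ^ ?m i"
        unfolding eventually_sequentially by blast
      let ?T = "max T0 (Suc i)"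
      have "\<phi> ?T < \<alpha> + 1 / 2 ^ ?m i" using T0 by simp
      moreover have "\<alpha> - real_of_rat (rat_of_code (g (?m i))) \<le> 1 / 2 ^ ?m i" using approx[of "?m i"] by linarith
      ultimately have "Q i ?T" unfolding Q by (simp add: field_simps)
      then show ?thesis by blast
    qed
    define t where "t i = (LEAST T. Q i T)" for i
    have "recf t"
      unfolding t_def Q_def
      by (rule recf_Least)
        (intro recf_intros recf_diag_num p q recf_comp[OF g] ex[unfolded Q_def])+
    then have "recf (\<lambda>i. of_bool (diag i (t i)))" by (intro recp_diag recf_intros)
    moreover have "diag i (t i) \<longleftrightarrow> (\<exists>T. diag i T)" for i
    proof
      assume "\<exists>T. diag i T"
      then obtain T' where T': "diag i T'" by blast
      show "diag i (t i)"
      proof (rule ccontr)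
        assume nd: "\<not> diag i (t i)"
        have Qt: "Q i (t i)" unfolding t_def by (rule LeastI_ex[OF ex])
        let ?T = "max T' (t i)"
        have "diag_sum (t i) + 1 / 4 ^ i = (\<Sum>j<t i. of_bool (diag j (t i)) / 4 ^ j + of_bool (j = i) / 4 ^ i)"
          using Qt by (simp add: Q diag_sum_def sum.distrib sum_divide_distrib[symmetric])
        also have "\<dots> \<le> (\<Sum>j<t i. of_bool (diag j ?T) / 4 ^ j)"
        proof (rule sum_mono)
          fix j
          have "diag j (t i) \<Longrightarrow> diag j ?T" by (rule diag_mono) auto
          moreover have "diag i ?T" by (rule diag_mono[OF T']) auto
          ultimately show "of_bool (diag j (t i)) / 4 ^ j + of_bool (j = i) / 4 ^ i \<le> (of_bool (diag j ?T) / 4 ^ j :: real)"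
            using nd by (cases "j = i") auto
        qed
        also have "\<dots> \<le> diag_sum ?T" unfolding diag_sum_def by (intro sum_mono2) auto
        finally have "\<phi> ?T + 1 / 4 ^ i \<le> \<phi> (t i)" by (simp add: \<phi>_def)
        then have "\<alpha> + 1 / 4 ^ i \<le> \<phi> (t i)" using low[of ?T] by linarith
        also have "\<phi> (t i) \<le> real_of_rat (rat_of_code (g (?m i))) + 2 / 2 ^ ?m i" using Qt by (simp add: Q)
        also have "\<dots> \<le> \<alpha> + 3 / 2 ^ ?m i"
        proof -
          have "2 / 2 ^ ?m i = 2 * (1 / 2 ^ ?m i :: real)" "3 / 2 ^ ?m i = 3 * (1 / 2 ^ ?m i :: real)"
            by simp_all
          then show ?thesis using approx[of "?m i"] by linarith
        qed
        finally have "1 / 4 ^ i \<le> 3 / (2 ^ ?m i :: real)" by simp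
        also have "(2::real) ^ ?m i = 4 * 4 ^ i" by (simp add: power_mult)
        finally show False by (simp add: divide_simps)
      qed
    qed blast
    ultimately show False using diag_not_recursive by simp
  qed
  then show thesis using that[OF nonneg Pi1] by blast
qed

section \<open>Spaced sets of integers\<close>

text \<open>The interval is half-open so that the count is \<open>r\<close> for the two ends of a
  group of \<open>r + 1\<close> elements.\<close>

definition spaced :: "(nat \<Rightarrow> nat) \<Rightarrow> int set \<Rightarrow> bool" where
  "spaced l X \<longleftrightarrow> (\<forall>x\<in>X. \<forall>y\<in>X. x \<le> y \<longrightarrow> int (l (card (X \<inter> {x..<y}))) \<le> y - x)"

lemma spacedD: "spaced l X \<Longrightarrow> x \<in> X \<Longrightarrow> y \<in> X \<Longrightarrow> x \<le> y \<Longrightarrow> int (l (card (X \<inter> {x..<y}))) \<le> y - x"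
  unfolding spaced_def by blast

lemma spaced_empty [simp]: "spaced l {}"
  by (simp add: spaced_def)

lemma spaced_subset:
  assumes "mono l" "spaced l X" "Y \<subseteq> X"
  shows "spaced l Y"
  unfolding spaced_def
proof (intro ballI impI)
  fix x y assume xy: "x \<in> Y" "y \<in> Y" "x \<le> y"
  have "l (card (Y \<inter> {x..<y})) \<le> l (card (X \<inter> {x..<y}))"
    using assms(3) by (intro monoD[OF assms(1)] card_mono) auto
  also have "int (l (card (X \<inter> {x..<y}))) \<le> y - x" using xy assms(2,3) by (intro spacedD) auto
  finally show "int (l (card (Y \<inter> {x..<y}))) \<le> y - x" by simp
qed

lemma spaced_translate:
  assumes "spaced l X"
  shows "spaced l ((\<lambda>i. i + c) ` X)"
  unfolding spaced_def
proof (intro ballI impI)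
  fix x y assume "x \<in> (\<lambda>i. i + c) ` X" "y \<in> (\<lambda>i. i + c) ` X" "x \<le> y"
  then obtain x' y' where xy: "x' \<in> X" "y' \<in> X" "x = x' + c" "y = y' + c" "x' \<le> y'" by auto
  have "(\<lambda>i. i + c) ` X \<inter> {x..<y} = (\<lambda>i. i + c) ` (X \<inter> {x'..<y'})" by (auto simp: xy)
  then have "card ((\<lambda>i. i + c) ` X \<inter> {x..<y}) = card (X \<inter> {x'..<y'})"
    by (simp add: card_image inj_on_def)
  then show "int (l (card ((\<lambda>i. i + c) ` X \<inter> {x..<y}))) \<le> y - x"
    using spacedD[OF assms xy(1,2,5)] by (simp add: xy)
qed

text \<open>Take for \<open>b\<close> the first point after \<open>x\<close> that is not in
  \<open>A\<close>, and for \<open>a\<close> the last point of the union before \<open>b\<close>;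
  minimality of \<open>b\<close> puts \<open>a\<close> into \<open>A\<close>.\<close>

lemma adjacent_change:
  fixes x y :: int
  assumes "x \<in> A" "x \<le> y" "\<not> (A \<union> B) \<inter> {x..y} \<subseteq> A"
  obtains a b where "a \<in> A" "b \<in> B" "x \<le> a" "a < b" "b \<le> y" "(A \<union> B) \<inter> {a<..<b} = {}"
proof -
  define S where "S = (A \<union> B) \<inter> {x..y} - A"
  define b where "b = Min S"
  have fin: "finite S" by (simp add: S_def)
  then have b: "b \<in> S" unfolding b_def using assms(3) by (intro Min_in) (auto simp: S_def)
  then have xb: "x < b" using assms(1) by (cases "x = b") (auto simp: S_def)
  define T where "T = (A \<union> B) \<inter> {x..<b}"
  define a where "a = Max T"
  have finT: "finite T" by (simp add: T_def)
  then have a: "a \<in> T" unfolding a_def using assms(1) xb by (intro Max_in) (auto simp: T_def)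
  have "a \<in> A"
  proof (rule ccontr)
    assume "a \<notin> A"
    then have "a \<in> S" using a b by (auto simp: S_def T_def)
    then have "b \<le> a" unfolding b_def using fin by (intro Min_le)
    then show False using a by (auto simp: T_def)
  qed
  moreover have "(A \<union> B) \<inter> {a<..<b} = {}"
  proof -
    have "z \<le> a" if "z \<in> (A \<union> B)" "a < z" "z < b" for z
      unfolding a_def by (rule Max_ge[OF finT]) (use that a in \<open>auto simp: T_def\<close>)
    then show ?thesis by fastforce
  qed
  ultimately show thesis using that a b by (auto simp: S_def T_def)
qed

text \<open>The two sets may interleave, so there is no single place at which to cut. By induction
  on \<open>y - x\<close>, an interval that meets both sets is split at two neighbouring points
  \<open>a < b\<close> from different sets: the groups on the two sides are spaced by induction,
  \<open>b - a\<close> supplies \<open>gap\<close>, and the counts add up to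
  \<open>s + t + 1\<close>. The condition \<open>super\<close> is asked only for counts that can
  occur, which lets \<open>gap\<close> depend on the sizes of the sets.\<close>

lemma spaced_Un:
  assumes A: "spaced l A" "finite A" and B: "spaced l B" "finite B"
    and sep: "\<And>a b. a \<in> A \<Longrightarrow> b \<in> B \<Longrightarrow> int gap \<le> \<bar>a - b\<bar>"
    and super: "\<And>s t. s + t + 2 \<le> card (A \<union> B) \<Longrightarrow> l (s + t + 1) \<le> l s + l t + gap"
  shows "spaced l (A \<union> B)"
proof -
  let ?X = "A \<union> B"
  have "int (l (card (?X \<inter> {x..<y}))) \<le> y - x" if "x \<in> ?X" "y \<in> ?X" "x \<le> y" for x y
    using that
  proof (induction "nat (y - x)" arbitrary: x y rule: less_induct)
    case less
    show ?case
    proof (cases "?X \<inter> {x..y} \<subseteq> A \<or> ?X \<inter> {x..y} \<subseteq> B")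
      case True
      then show ?thesis
      proof
        assume *: "?X \<inter> {x..y} \<subseteq> A"
        then have "x \<in> A" "y \<in> A" "?X \<inter> {x..<y} = A \<inter> {x..<y}" using less.prems by auto
        then show ?thesis using spacedD[OF A(1)] less.prems(3) by simp
      next
        assume *: "?X \<inter> {x..y} \<subseteq> B"
        then have "x \<in> B" "y \<in> B" "?X \<inter> {x..<y} = B \<inter> {x..<y}" using less.prems by auto
        then show ?thesis using spacedD[OF B(1)] less.prems(3) by simp
      qed
    next
      case False
      obtain a b where ab: "a \<in> A \<and> b \<in> B \<or> a \<in> B \<and> b \<in> A" "x \<le> a" "a < b" "b \<le> y"
        and empty: "?X \<inter> {a<..<b} = {}"
      proof (cases "x \<in> A")
        case True
        then show ?thesis using adjacent_change[of x A y B] False less.prems(3) that by metis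
      next
        case False
        then have "x \<in> B" using less.prems by auto
        then show ?thesis
          using adjacent_change[of x B y A] \<open>\<not> (_ \<or> _)\<close> less.prems(3) that by (metis Un_commute)
      qed
      have abX: "a \<in> ?X" "b \<in> ?X" using ab(1) by auto
      let ?s = "card (?X \<inter> {x..<a})" and ?t = "card (?X \<inter> {b..<y})"
      have split: "?X \<inter> {x..<y} = (?X \<inter> {x..<a}) \<union> (insert a (?X \<inter> {b..<y}))"
      proof (intro equalityI subsetI)
        fix z assume z: "z \<in> ?X \<inter> {x..<y}"
        then have "\<not> (a < z \<and> z < b)" using empty by auto
        with z show "z \<in> (?X \<inter> {x..<a}) \<union> (insert a (?X \<inter> {b..<y}))" by auto
      qed (use ab abX in auto)
      have card: "card (?X \<inter> {x..<y}) = ?s + ?t + 1"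
        unfolding split by (subst card_Un_disjoint) (use ab in auto)
      have "card (insert y (?X \<inter> {x..<y})) \<le> card ?X"
        using less.prems A(2) B(2) by (intro card_mono) auto
      then have "?s + ?t + 2 \<le> card ?X" using card by simp
      then have "l (card (?X \<inter> {x..<y})) \<le> l ?s + l ?t + gap" unfolding card by (rule super)
      then have "int (l (card (?X \<inter> {x..<y}))) \<le> int (l ?s) + int (l ?t) + int gap" by simp
      also have "int (l ?s) \<le> a - x" using ab abX less.prems by (intro less.hyps) auto
      also have "int (l ?t) \<le> y - b" using ab abX less.prems by (intro less.hyps) auto
      also have "int gap \<le> b - a" using ab(1,3) sep by fastforce
      finally show ?thesis by simp
    qed
  qed
  then show ?thesis unfolding spaced_def by blast
qed

lemma card_Int_less:
  assumes "X \<subseteq> {0..<int n}" "y \<in> X"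
  shows "card (X \<inter> {x..<y}) < n"
proof -
  have "card (X \<inter> {x..<y}) \<le> card {0..<int (n - 1)}"
    using assms by (intro card_mono) (auto simp: subset_iff of_nat_diff)
  also have "\<dots> < n" using assms by (cases n) auto
  finally show ?thesis .
qed

section \<open>Words\<close>

text \<open>A word of length \<open>n\<close> is extended by 0 to all integers.\<close>

definition words :: "nat \<Rightarrow> (nat \<Rightarrow> nat) \<Rightarrow> nat \<Rightarrow> (int \<Rightarrow> nat) set" where
  "words k l n = {w. (\<forall>i. w i < k) \<and> {i. w i \<noteq> 0} \<subseteq> {0..<int n} \<and> spaced l {i. w i \<noteq> 0}}"

lemma words_outside: "w \<in> words k l n \<Longrightarrow> i \<notin> {0..<int n} \<Longrightarrow> w i = 0"
  unfolding words_def by blast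

lemma finite_words [simp]: "finite (words k l n)"
proof (rule finite_subset)
  show "words k l n \<subseteq> {w. \<forall>i. (i \<in> {0..<int n} \<longrightarrow> w i \<in> {..<k}) \<and> (i \<notin> {0..<int n} \<longrightarrow> w i = 0)}"
    by (auto simp: words_def)
  show "finite {w. \<forall>i. (i \<in> {0..<int n} \<longrightarrow> w i \<in> {..<k}) \<and> (i \<notin> {0..<int n} \<longrightarrow> w i = (0::nat))}"
    by (rule finite_set_of_finite_funs) auto
qed

lemma card_words_pos: "k > 0 \<Longrightarrow> card (words k l n) > 0"
proof -
  assume "k > 0"
  then have "(\<lambda>_. 0) \<in> words k l n" by (simp add: words_def)
  then show ?thesis by (auto simp: card_gt_0_iff)
qed

lemma words_cong:
  assumes "\<And>r. r < n \<Longrightarrow> l r = l' r"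
  shows "words k l n = words k l' n"
proof -
  have "spaced l X \<longleftrightarrow> spaced l' X" if "X \<subseteq> {0..<int n}" for X
    unfolding spaced_def using assms card_Int_less[OF that] by simp
  then show ?thesis by (auto simp: words_def)
qed

lemma words_antimono:
  assumes "\<And>r. l r \<le> l' r"
  shows "words k l' n \<subseteq> words k l n"
proof -
  have "spaced l X" if "spaced l' X" for X
    unfolding spaced_def
  proof (intro ballI impI)
    fix x y assume "x \<in> X" "y \<in> X" "x \<le> y"
    from spacedD[OF that this] assms[of "card (X \<inter> {x..<y})"]
    show "int (l (card (X \<inter> {x..<y}))) \<le> y - x" by linarith
  qed
  then show ?thesis by (auto simp: words_def)
qed

lemma card_words_mult:
  assumes l: "mono l" and n: "n \<ge> 1" and k: "k > 0"
  shows "card (words k l (n * q)) \<le> card (words k l n) ^ q"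
proof -
  define \<Phi> where "\<Phi> w = (\<lambda>j\<in>{..<q}. \<lambda>i. if 0 \<le> i \<and> i < int n then w (i + int n * int j) else 0)"
    for w :: "int \<Rightarrow> nat"
  have "inj_on \<Phi> (words k l (n * q))"
  proof (rule inj_onI)
    fix v w assume vw: "v \<in> words k l (n * q)" "w \<in> words k l (n * q)" and e: "\<Phi> v = \<Phi> w"
    show "v = w"
    proof
      fix i
      show "v i = w i"
      proof (cases "i \<in> {0..<int (n * q)}")
        case True
        let ?j = "nat (i div int n)"
        have i: "i = i mod int n + int n * (i div int n)" by (metis mod_mult_div_eq)
        have j0: "0 \<le> i div int n" using True n by (simp add: pos_imp_zdiv_nonneg_iff)
        have "int n * (i div int n) \<le> i" using n pos_mod_sign[of "int n" i] i by linarith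
        then have "int n * (i div int n) < int n * int q" using True by simp
        then have j: "?j < q" using n j0 by (simp add: zless_nat_eq_int_zless nat_less_iff)
        have "0 \<le> i mod int n" "i mod int n < int n" using n by auto
        then show ?thesis
          using fun_cong[OF fun_cong[OF e, of ?j], of "i mod int n"] j j0 i[symmetric] by (simp add: \<Phi>_def)
      next
        case False
        then show ?thesis using words_outside vw by metis
      qed
    qed
  qed
  moreover have "\<Phi> ` words k l (n * q) \<subseteq> {..<q} \<rightarrow>\<^sub>E words k l n"
  proof (rule image_subsetI)
    fix w assume w: "w \<in> words k l (n * q)"
    have "(\<lambda>i. if 0 \<le> i \<and> i < int n then w (i + int n * int j) else 0) \<in> words k l n" (is "?v \<in> _") for j
    proof -
      have sub: "{i. ?v i \<noteq> 0} \<subseteq> (\<lambda>i. i + (- int n * int j)) ` {i. w i \<noteq> 0}"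
      proof
        fix i assume "i \<in> {i. ?v i \<noteq> 0}"
        then have "i + int n * int j \<in> {i. w i \<noteq> 0}" by (auto split: if_splits)
        then show "i \<in> (\<lambda>i. i + (- int n * int j)) ` {i. w i \<noteq> 0}" by (rule rev_image_eqI) simp
      qed
      have "spaced l {i. ?v i \<noteq> 0}"
        using w by (intro spaced_subset[OF l spaced_translate sub]) (simp add: words_def)
      then show ?thesis using w k by (auto simp: words_def)
    qed
    then show "\<Phi> w \<in> {..<q} \<rightarrow>\<^sub>E words k l n" by (simp add: \<Phi>_def restrict_PiE_iff)
  qed
  moreover have "finite ({..<q} \<rightarrow>\<^sub>E words k l n)" by (intro finite_PiE) auto
  ultimately have "card (words k l (n * q)) \<le> card ({..<q} \<rightarrow>\<^sub>E words k l n)"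
    by (rule card_inj_on_le)
  then show ?thesis by (simp add: card_PiE)
qed

lemma card_words_add:
  assumes super: "\<And>s t. l (s + t + 1) \<le> l s + l t + G"
  shows "card (words k l n) * card (words k l m) \<le> card (words k l (n + G + m))"
proof -
  define \<Phi> where "\<Phi> p = (\<lambda>i. if i < int n then fst p i else snd p (i - int (n + G)))"
    for p :: "(int \<Rightarrow> nat) \<times> (int \<Rightarrow> nat)"
  have "inj_on \<Phi> (words k l n \<times> words k l m)"
  proof (rule inj_onI, clarify)
    fix u v u' v' assume w: "u \<in> words k l n" "v \<in> words k l m" "u' \<in> words k l n" "v' \<in> words k l m"
      and e: "\<Phi> (u, v) = \<Phi> (u', v')"
    have "u i = u' i" for i
      using fun_cong[OF e, of i] words_outside[OF w(1), of i] words_outside[OF w(3), of i]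
      by (cases "i < int n") (auto simp: \<Phi>_def)
    moreover have "v i = v' i" for i
      using fun_cong[OF e, of "i + int (n + G)"] words_outside[OF w(2), of i] words_outside[OF w(4), of i]
      by (cases "0 \<le> i") (auto simp: \<Phi>_def)
    ultimately show "u = u' \<and> v = v'" by blast
  qed
  moreover have "\<Phi> ` (words k l n \<times> words k l m) \<subseteq> words k l (n + G + m)"
  proof (rule image_subsetI, clarify)
    fix u v assume u: "u \<in> words k l n" and v: "v \<in> words k l m"
    let ?A = "{i. u i \<noteq> 0}" and ?B = "(\<lambda>i. i + int (n + G)) ` {i. v i \<noteq> 0}"
    have A: "?A \<subseteq> {0..<int n}" and B: "?B \<subseteq> {int (n + G)..<int (n + G + m)}"
      using u v by (auto simp: words_def)
    have supp: "{i. \<Phi> (u, v) i \<noteq> 0} = ?A \<union> ?B"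
    proof (intro equalityI subsetI)
      fix i assume i: "i \<in> {i. \<Phi> (u, v) i \<noteq> 0}"
      show "i \<in> ?A \<union> ?B"
      proof (cases "i < int n")
        case False
        then have "v (i - int (n + G)) \<noteq> 0" using i by (simp add: \<Phi>_def)
        then show ?thesis by (intro UnI2 image_eqI[of _ _ "i - int (n + G)"]) auto
      qed (use i in \<open>auto simp: \<Phi>_def\<close>)
    next
      fix i assume "i \<in> ?A \<union> ?B"
      then show "i \<in> {i. \<Phi> (u, v) i \<noteq> 0}"
      proof
        assume "i \<in> ?A"
        then show ?thesis using A by (auto simp: \<Phi>_def)
      next
        assume i: "i \<in> ?B"
        then have "int n \<le> i" using B by fastforce
        then show ?thesis using i by (auto simp: \<Phi>_def)
      qed
    qed
    have "spaced l (?A \<union> ?B)"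
    proof (rule spaced_Un)
      show "spaced l ?A" "spaced l ?B" using u v by (auto simp: words_def intro: spaced_translate)
      show "finite ?A" using A by (rule finite_subset) simp
      show "finite ?B" using B by (rule finite_subset) simp
      show "int G \<le> \<bar>a - b\<bar>" if "a \<in> ?A" "b \<in> ?B" for a b
      proof -
        have "a < int n" "int (n + G) \<le> b" using that A B by fastforce+
        then show ?thesis by simp
      qed
    qed (use super in auto)
    moreover have "?A \<union> ?B \<subseteq> {0..<int (n + G + m)}" using A B by fastforce
    moreover have "\<Phi> (u, v) i < k" for i using u v by (auto simp: \<Phi>_def words_def)
    ultimately show "\<Phi> (u, v) \<in> words k l (n + G + m)" unfolding words_def supp[symmetric] by auto
  qed
  ultimately have "card (words k l n \<times> words k l m) \<le> card (words k l (n + G + m))"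
    by (rule card_inj_on_le) simp
  then show ?thesis by (simp add: card_cartesian_product)
qed

lemma card_words_concat:
  assumes super: "\<And>s t. l (s + t + 1) \<le> l s + l t + G" and k: "k > 0"
  shows "card (words k l n) ^ q \<le> card (words k l (q * (n + G)))"
proof (induction q)
  case 0
  show ?case using card_words_pos[OF k, of l 0] by simp
next
  case (Suc q)
  have "card (words k l n) ^ Suc q \<le> card (words k l n) * card (words k l (q * (n + G)))"
    using Suc by simp
  also have "\<dots> \<le> card (words k l (n + G + q * (n + G)))" by (rule card_words_add[OF super])
  finally show ?case by simp
qed

text \<open>The premise \<open>big\<close> says \<open>a / b \<le> log 2 c / (m + G)\<close> for the
  number \<open>c\<close> of words of length \<open>m\<close>, as an inequality of integers.
  Concatenating \<open>n\<close> of them gives \<open>c ^ n\<close> words of length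
  \<open>n * (m + G)\<close>; these can be cut into \<open>m + G\<close> words of length
  \<open>n\<close>, so \<open>c ^ n\<close> is at most the \<open>(m + G)\<close>th power of the
  number of words of length \<open>n\<close>.\<close>

lemma card_words_lower:
  assumes l: "mono l" and super: "\<And>s t. l (s + t + 1) \<le> l s + l t + G" and k: "k > 0"
    and m: "m \<ge> 1" and b: "b > 0" and big: "2 ^ (a * (m + G)) \<le> card (words k l m) ^ b"
  shows "real n * (real a / real b) \<le> log 2 (real (card (words k l n)))"
proof (cases "n = 0")
  case True
  then show ?thesis using card_words_pos[OF k, of l 0] by simp
next
  case False
  let ?c = "\<lambda>n. card (words k l n)"
  have pos: "?c n > 0" for n using card_words_pos[OF k] .
  have "2 ^ (a * (m + G) * n) \<le> (?c m ^ b) ^ n" using power_mono[OF big, of n] by (simp add: power_mult)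
  also have "\<dots> = (?c m ^ n) ^ b" by (simp add: power_mult[symmetric] mult.commute)
  also have "\<dots> \<le> ?c (n * (m + G)) ^ b" by (intro power_mono card_words_concat super k) simp
  also have "\<dots> \<le> (?c n ^ (m + G)) ^ b" using False by (intro power_mono card_words_mult l k) auto
  finally have "real (2 ^ (a * (m + G) * n)) \<le> real ((?c n ^ (m + G)) ^ b)" by (rule of_nat_mono)
  then have "log 2 (real (2 ^ (a * (m + G) * n))) \<le> log 2 (real ((?c n ^ (m + G)) ^ b))"
    using pos[of n] by (subst log_le_cancel_iff) simp_all
  then have "real (a * (m + G) * n) \<le> real ((m + G) * b) * log 2 (real (?c n))"
    using pos[of n] by (simp add: log_nat_power power_mult[symmetric] del: of_nat_mult of_nat_add)
  then have "real (m + G) * (real n * real a) \<le> real (m + G) * (real b * log 2 (real (?c n)))"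
    by (simp only: of_nat_mult mult_ac)
  then have "real n * real a \<le> real b * log 2 (real (?c n))"
    using m by (subst (asm) mult_le_cancel_left_pos) auto
  then show ?thesis using b by (simp add: field_simps)
qed

text \<open>Inserting a 0 after every \<open>j\<close>th nonzero letter realises one more unit of gap at level \<open>j\<close>.\<close>

lemma add_div_le: "a div j + b div j \<le> (a + b) div (j :: nat)"
proof (cases "j = 0")
  case False
  have "(a div j + b div j) * j \<le> a + b"
    unfolding distrib_right by (intro add_mono div_times_less_eq_dividend)
  then show ?thesis using False by (simp add: less_eq_div_iff_mult_less_eq)
qed simp

lemma card_words_insert:
  assumes j: "j > 0"
  shows "card (words k l n) \<le> card (words k (\<lambda>r. l r + r div j) (n + n div j))"
proof -
  define rk where "rk X p = card (X \<inter> {..<p})" for X :: "int set" and p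
  \<comment> \<open>A letter moves by the number of zeros inserted before it, one for every
    \<open>j\<close> preceding letters.\<close>
  define \<tau> where "\<tau> X p = p + int (rk X p div j)" for X p
  define S where "S w = {i. w i \<noteq> (0::nat)}" for w :: "int \<Rightarrow> nat"
  define \<Phi> where "\<Phi> w i = (if i \<in> \<tau> (S w) ` S w then w (inv_into (S w) (\<tau> (S w)) i) else 0)" for w i
  have fin: "finite (S w)" and S0: "S w \<subseteq> {0..<int n}" and sp: "spaced l (S w)" if "w \<in> words k l n" for w
    using that finite_subset[of _ "{0..<int n}"] by (auto simp: words_def S_def)
  have mono: "\<tau> X p < \<tau> X p'" if "finite X" "p < p'" for X p p'
  proof -
    have "rk X p \<le> rk X p'" unfolding rk_def using that by (intro card_mono) auto
    then have "rk X p div j \<le> rk X p' div j" by (rule div_le_mono)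
    then show ?thesis using that(2) by (simp add: \<tau>_def)
  qed
  have less_iff: "\<tau> X p < \<tau> X p' \<longleftrightarrow> p < p'" if "finite X" for X p p'
    using mono[OF that] by (metis less_asym not_less_iff_gr_or_eq)
  have inj: "inj_on (\<tau> X) X" if "finite X" for X
    by (rule inj_onI) (metis less_iff[OF that] not_less_iff_gr_or_eq)
  have \<Phi>_\<tau>: "\<Phi> w (\<tau> (S w) p) = w p" if "w \<in> words k l n" "p \<in> S w" for w p
    using that inj[OF fin] by (simp add: \<Phi>_def)
  have supp: "S (\<Phi> w) = \<tau> (S w) ` S w" if "w \<in> words k l n" for w
  proof (intro equalityI subsetI)
    fix i assume "i \<in> S (\<Phi> w)"
    then show "i \<in> \<tau> (S w) ` S w" by (auto simp: S_def[of "\<Phi> w"] \<Phi>_def split: if_splits)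
  next
    fix i assume "i \<in> \<tau> (S w) ` S w"
    then obtain p where "p \<in> S w" "i = \<tau> (S w) p" by blast
    then show "i \<in> S (\<Phi> w)" using \<Phi>_\<tau>[OF that] by (simp add: S_def)
  qed
  have rk: "rk (\<tau> X ` X) (\<tau> X p) = rk X p" if "finite X" for X p
  proof -
    have "\<tau> X ` X \<inter> {..<\<tau> X p} = \<tau> X ` (X \<inter> {..<p})" using less_iff[OF that] by auto
    then show ?thesis using inj[OF that] by (simp add: rk_def card_image inj_on_subset)
  qed
  have "inj_on \<Phi> (words k l n)"
  proof (rule inj_onI)
    fix v w assume v: "v \<in> words k l n" and w: "w \<in> words k l n" and e: "\<Phi> v = \<Phi> w"
    \<comment> \<open>The insertion does not change the rank of a letter, so its shift can be read
      off from the image; this makes the map injective.\<close>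
    have recover: "S u = (\<lambda>i. i - int (rk (S (\<Phi> u)) i div j)) ` S (\<Phi> u)" if "u \<in> words k l n" for u
      unfolding supp[OF that] image_image using rk[OF fin[OF that]] by (simp add: \<tau>_def)
    have eqS: "S v = S w" using recover[OF v] recover[OF w] e by simp
    show "v = w"
    proof
      fix p
      show "v p = w p"
      proof (cases "p \<in> S w")
        case True
        then show ?thesis using \<Phi>_\<tau>[OF v, of p] \<Phi>_\<tau>[OF w, of p] eqS e by simp
      next
        case False
        moreover from this have "p \<notin> S v" by (simp only: eqS not_False_eq_True)
        ultimately show ?thesis by (simp add: S_def)
      qed
    qed
  qed
  moreover have "\<Phi> ` words k l n \<subseteq> words k (\<lambda>r. l r + r div j) (n + n div j)"
  proof (rule image_subsetI)
    fix w assume w: "w \<in> words k l n"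
    let ?X = "S w"
    have fX: "finite ?X" by (rule fin[OF w])
    have "\<Phi> w i < k" for i
    proof -
      have "w i < k" for i using w by (simp add: words_def)
      moreover from this[of 0] have "k > 0" by simp
      ultimately show ?thesis by (simp add: \<Phi>_def)
    qed
    moreover have "S (\<Phi> w) \<subseteq> {0..<int (n + n div j)}"
      unfolding supp[OF w]
    proof (rule image_subsetI)
      fix p assume "p \<in> ?X"
      then have p: "0 \<le> p" "p < int n" using S0[OF w] by auto
      have "rk ?X p \<le> card {0..<int n}" unfolding rk_def using S0[OF w] by (intro card_mono) auto
      then have "rk ?X p div j \<le> n div j" by (intro div_le_mono) simp
      then show "\<tau> ?X p \<in> {0..<int (n + n div j)}" using p by (simp add: \<tau>_def)
    qed
    moreover have "spaced (\<lambda>r. l r + r div j) (S (\<Phi> w))"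
      unfolding spaced_def supp[OF w]
    proof (intro ballI impI)
      fix x' y' assume "x' \<in> \<tau> ?X ` ?X" "y' \<in> \<tau> ?X ` ?X" and le: "x' \<le> y'"
      then obtain x y where x: "x \<in> ?X" "x' = \<tau> ?X x" and y: "y \<in> ?X" "y' = \<tau> ?X y" by blast
      have xy: "x \<le> y" using le less_iff[OF fX, of y x] by (simp add: x y not_less[symmetric])
      have "\<tau> ?X ` ?X \<inter> {x'..<y'} = \<tau> ?X ` (?X \<inter> {x..<y})"
        using less_iff[OF fX] by (auto simp: x y not_less[symmetric])
      then have card: "card (\<tau> ?X ` ?X \<inter> {x'..<y'}) = card (?X \<inter> {x..<y})"
        using inj[OF fX] by (simp add: card_image inj_on_subset)
      let ?r = "card (?X \<inter> {x..<y})"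
      have "?X \<inter> {..<y} = (?X \<inter> {..<x}) \<union> (?X \<inter> {x..<y})" using xy by auto
      then have "rk ?X y = rk ?X x + ?r"
        unfolding rk_def using fX by (simp add: card_Un_disjoint disjoint_iff)
      \<comment> \<open>The difference of two floors is at least the floor of the difference, which
        is the distance gained between the ends of a group.\<close>
      then have "rk ?X x div j + ?r div j \<le> rk ?X y div j" using add_div_le by metis
      then have "int (rk ?X x div j) + int (?r div j) \<le> int (rk ?X y div j)" by linarith
      moreover have "int (l ?r) \<le> y - x" by (rule spacedD[OF sp[OF w] x(1) y(1) xy])
      ultimately show "int (l (card (\<tau> ?X ` ?X \<inter> {x'..<y'})) + card (\<tau> ?X ` ?X \<inter> {x'..<y'}) div j) \<le> y' - x'"
        unfolding card by (simp add: x y \<tau>_def)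
    qed
    ultimately show "\<Phi> w \<in> words k (\<lambda>r. l r + r div j) (n + n div j)"
      by (simp add: words_def S_def)
  qed
  ultimately show ?thesis by (rule card_inj_on_le) simp
qed

text \<open>Weighting a word by \<open>2\<^sup>-\<^sup>p\<close> per nonzero letter turns the count into a product.\<close>

lemma card_words_sparse:
  assumes k: "k > 0" and s: "\<And>w. w \<in> words k l n \<Longrightarrow> card {i. w i \<noteq> 0} \<le> s"
  shows "real (card (words k l n)) \<le> 2 ^ (p * s) * (1 + real k / 2 ^ p) ^ n"
proof -
  define wt where "wt a = (if a = 0 then 1 else 1 / 2 ^ p :: real)" for a :: nat
  let ?I = "{0..<int n}"
  define R where "R w = restrict w ?I" for w :: "int \<Rightarrow> nat"
  have "inj_on R (words k l n)"
  proof (rule inj_onI)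
    fix v w assume vw: "v \<in> words k l n" "w \<in> words k l n" and e: "R v = R w"
    show "v = w"
    proof
      fix i
      show "v i = w i"
        using fun_cong[OF e, of i] words_outside[OF vw(1), of i] words_outside[OF vw(2), of i]
        by (cases "i \<in> ?I") (auto simp: R_def)
    qed
  qed
  moreover have sub: "R ` words k l n \<subseteq> ?I \<rightarrow>\<^sub>E {..<k}"
    by (rule image_subsetI) (simp add: R_def words_def restrict_PiE_iff)
  moreover have prod: "1 / 2 ^ (p * s) \<le> (\<Prod>i\<in>?I. wt (R w i))" if w: "w \<in> words k l n" for w
  proof -
    have "(\<Prod>i\<in>?I. wt (R w i)) = (\<Prod>i\<in>?I. if i \<in> {i. w i \<noteq> 0} then 1 / 2 ^ p else 1)"
      by (rule prod.cong) (auto simp: R_def wt_def)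
    also have "\<dots> = (\<Prod>i\<in>?I \<inter> {i. w i \<noteq> 0}. 1 / 2 ^ p)" by (rule prod.inter_restrict[symmetric]) simp
    also have "?I \<inter> {i. w i \<noteq> 0} = {i. w i \<noteq> 0}" using w by (auto simp: words_def)
    also have "(\<Prod>i\<in>{i. w i \<noteq> 0}. 1 / 2 ^ p) = (1 / 2 ^ p :: real) ^ card {i. w i \<noteq> 0}" by simp
    also have "\<dots> \<ge> (1 / 2 ^ p) ^ s" using s[OF w] by (intro power_decreasing) auto
    finally show ?thesis by (simp add: power_divide power_mult)
  qed
  ultimately have "(\<Sum>w\<in>words k l n. 1 / 2 ^ (p * s)) \<le> (\<Sum>g\<in>R ` words k l n. \<Prod>i\<in>?I. wt (g i))"
    by (simp add: sum.reindex sum_mono del: sum_constant)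
  also have "\<dots> \<le> (\<Sum>g\<in>?I \<rightarrow>\<^sub>E {..<k}. \<Prod>i\<in>?I. wt (g i))"
    using sub by (intro sum_mono2 finite_PiE prod_nonneg) (auto simp: wt_def)
  also have "\<dots> = (\<Prod>i\<in>?I. \<Sum>a<k. wt a)" by (subst prod_sum_PiE) auto
  also have "\<dots> = (\<Sum>a<k. wt a) ^ n" by simp
  also have "\<dots> \<le> (1 + real k / 2 ^ p) ^ n"
  proof (rule power_mono)
    have "(\<Sum>a<k. wt a) = wt 0 + (\<Sum>a\<in>{..<k} - {0}. wt a)" using k by (intro sum.remove) auto
    also have "(\<Sum>a\<in>{..<k} - {0}. wt a) = (\<Sum>a\<in>{..<k} - {0}. 1 / 2 ^ p)" by (rule sum.cong) (auto simp: wt_def)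
    also have "\<dots> \<le> real k / 2 ^ p" using k by (simp add: divide_right_mono)
    finally show "(\<Sum>a<k. wt a) \<le> 1 + real k / 2 ^ p" by (simp add: wt_def)
  qed (simp add: sum_nonneg wt_def)
  finally show ?thesis by (simp add: field_simps)
qed

text \<open>If \<open>l\<close> outgrows \<open>C * r\<close>, a word of length \<open>n\<close> has
  at most \<open>r0 + 1 + n / C\<close> nonzero letters. The weight exponent \<open>p\<close> is
  chosen so that the product contributes at most \<epsilon>/2 per site; then \<open>C\<close>,
  depending on \<open>p\<close>, and finally \<open>n\<close> keep the cost \<open>p\<close> per
  letter within two further quarters of \<epsilon>.\<close>

lemma words_zero_entropy:
  assumes l: "mono l" and k: "k > 0" and fast: "\<And>C. \<exists>r0. \<forall>r\<ge>r0. C * r \<le> l r" and \<epsilon>: "\<epsilon> > 0"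
  shows "\<exists>n\<ge>1. log 2 (real (card (words k l n))) \<le> \<epsilon> * real n"
proof -
  obtain p :: nat where "4 * real k / \<epsilon> < 2 ^ p" using real_arch_pow[of 2] by auto
  then have p: "2 * real k / 2 ^ p \<le> \<epsilon> / 2" using \<epsilon> by (simp add: field_simps)
  obtain C :: nat where C: "4 * real p / \<epsilon> < real C" using reals_Archimedean2 by blast
  then have C0: "C > 0" using \<epsilon> by (cases C) (auto simp: divide_less_0_iff)
  have pC: "real p / real C \<le> \<epsilon> / 4" using C C0 \<epsilon> by (simp add: field_simps)
  obtain r0 where r0: "\<And>r. r \<ge> r0 \<Longrightarrow> C * r \<le> l r" using fast[of C] by blast
  obtain n :: nat where n: "4 * (real p * real (r0 + 1)) / \<epsilon> < real n" using reals_Archimedean2 by blast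
  moreover have "0 \<le> 4 * (real p * real (r0 + 1)) / \<epsilon>" using \<epsilon> by simp
  ultimately have n0: "n \<ge> 1" by (cases n) auto
  have pn: "real p * real (r0 + 1) \<le> \<epsilon> / 4 * real n" using n \<epsilon> by (simp add: field_simps)
  define s where "s = r0 + 1 + n div C"
  have small: "card X \<le> s" if X: "X \<subseteq> {0..<int n}" and sp: "spaced l X" for X
  proof (cases "X = {}")
    case False
    let ?X = "X"
    have fin: "finite ?X" using X by (rule finite_subset) simp
    define x y where "x = Min X" and "y = Max X"
    have xy: "x \<in> X" "y \<in> X" using Min_in[OF fin False] Max_in[OF fin False] by (simp_all add: x_def y_def)
    have le: "x \<le> z" "z \<le> y" if "z \<in> X" for z
      using Min_le[OF fin that] Max_ge[OF fin that] by (simp_all add: x_def y_def)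
    have "?X \<inter> {x..<y} = ?X - {y}" using le by (force simp: less_le)
    then have c: "card (?X \<inter> {x..<y}) = card ?X - 1" using xy fin by simp
    have "int (l (card ?X - 1)) \<le> y - x" using spacedD[OF sp xy le(1)[OF xy(2)]] unfolding c .
    also have "\<dots> < int n" using subsetD[OF X xy(1)] subsetD[OF X xy(2)] by simp
    finally have ln: "l (card ?X - 1) < n" by simp
    show ?thesis
    proof (cases "r0 \<le> card ?X - 1")
      case True
      then have "C * (card ?X - 1) \<le> n" using r0[OF True] ln by linarith
      then have "card ?X - 1 \<le> n div C" using C0 by (simp add: less_eq_div_iff_mult_less_eq mult.commute)
      then show ?thesis by (simp add: s_def)
    qed (simp add: s_def)
  qed simp
  have "card {i. w i \<noteq> 0} \<le> s" if "w \<in> words k l n" for w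
    using that by (intro small) (simp_all add: words_def)
  from card_words_sparse[where p = p, OF k this]
  have "log 2 (real (card (words k l n))) \<le> log 2 (2 ^ (p * s) * (1 + real k / 2 ^ p) ^ n)"
    using card_words_pos[OF k, of l n] by (subst log_le_cancel_iff) (auto intro!: mult_pos_pos zero_less_power add_pos_nonneg)
  also have "\<dots> = real (p * s) + real n * log 2 (1 + real k / 2 ^ p)"
  proof -
    have "1 + real k / 2 ^ p > 0" by (simp add: add_pos_nonneg)
    then show ?thesis by (simp add: log_mult log_nat_power)
  qed
  also have "log 2 (1 + real k / 2 ^ p) \<le> 2 * (real k / 2 ^ p)"
  proof -
    let ?x = "real k / 2 ^ p"
    have "ln (1 + ?x) \<le> ?x" by (rule ln_add_one_self_le_self) simp
    moreover have "1 / 2 \<le> ln (2::real)" using ln2_ge_two_thirds by simp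
    ultimately have "ln (1 + ?x) \<le> 2 * ?x * ln 2"
      using mult_left_mono[of "1/2" "ln 2" "2 * ?x"] by simp
    then show ?thesis by (simp add: log_def field_simps)
  qed
  also have "real (p * s) \<le> real p * real (r0 + 1) + real p / real C * real n"
  proof -
    have "real (n div C) \<le> real n / real C" by (rule of_nat_div_le_of_nat)
    then have "real p * real (n div C) \<le> real p * (real n / real C)" by (intro mult_left_mono) auto
    then show ?thesis by (simp add: s_def distrib_left)
  qed
  finally have "log 2 (real (card (words k l n))) \<le> real p * real (r0 + 1) + real p / real C * real n
      + real n * (2 * (real k / 2 ^ p))" by (simp add: mult_left_mono)
  also have "\<dots> \<le> \<epsilon> / 4 * real n + \<epsilon> / 4 * real n + real n * (\<epsilon> / 2)"
    using pn pC p by (intro add_mono mult_right_mono mult_left_mono) auto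
  finally have "log 2 (real (card (words k l n))) \<le> \<epsilon> * real n" by (simp add: algebra_simps)
  with n0 show ?thesis by blast
qed

section \<open>Gaps adapted to a target entropy\<close>

text \<open>\<open>full_lam g r\<close> will be the least distance between the ends of a group of \<open>r + 1\<close> nonzero
  letters. It is superadditive up to the sum of the gaps \<open>g q\<close>, which is what gluing provides,
  while \<open>full_lam g r / r\<close> grows with the partial sums of \<open>g q / q\<close>. The term \<open>q = 0\<close> vanishes
  because \<open>r div 0 = 0\<close>.\<close>

definition lam :: "(nat \<Rightarrow> nat) \<Rightarrow> nat \<Rightarrow> nat \<Rightarrow> nat" where
  "lam g j r = (\<Sum>q<Suc j. g q * (r div q))"

definition full_lam :: "(nat \<Rightarrow> nat) \<Rightarrow> nat \<Rightarrow> nat" where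
  "full_lam g r = lam g r r"

lemma mono_lam: "mono (lam g j)"
  unfolding lam_def by (intro monoI sum_mono mult_le_mono2 div_le_mono)

lemma lam_eq_full: "r \<le> j \<Longrightarrow> lam g j r = full_lam g r"
  unfolding full_lam_def lam_def by (rule sum.mono_neutral_right) auto

lemma lam_le_full: "lam g j r \<le> full_lam g r"
proof (cases "r \<le> j")
  case False
  then show ?thesis unfolding full_lam_def lam_def by (intro sum_mono2) auto
qed (simp add: lam_eq_full)

lemma mono_full_lam: "mono (full_lam g)"
proof (rule monoI)
  fix r s :: nat assume "r \<le> s"
  then have "full_lam g r = lam g s r" by (simp add: lam_eq_full)
  also have "\<dots> \<le> full_lam g s"
    unfolding full_lam_def using mono_lam \<open>r \<le> s\<close> by (rule monoD)
  finally show "full_lam g r \<le> full_lam g s" .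
qed

lemma lam_super: "lam g j (s + t + 1) \<le> lam g j s + lam g j t + (\<Sum>q<Suc j. g q)"
proof -
  have "(s + t + 1) div q \<le> s div q + t div q + 1" for q
  proof (cases "q = 0")
    case False
    have "s < Suc (s div q) * q" "t < Suc (t div q) * q"
      using dividend_less_div_times[of q] False by (auto simp: add.commute)
    then have "s + t + 1 < (s div q + t div q + 2) * q"
      unfolding mult_Suc distrib_right by simp
    then have "(s + t + 1) div q < s div q + t div q + 2"
      using False by (simp add: div_less_iff_less_mult)
    then show ?thesis by simp
  qed simp
  then have "lam g j (s + t + 1) \<le> (\<Sum>q<Suc j. g q * (s div q + t div q + 1))"
    unfolding lam_def by (intro sum_mono mult_le_mono2)
  also have "\<dots> = lam g j s + lam g j t + (\<Sum>q<Suc j. g q)"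
    by (simp only: lam_def distrib_left sum.distrib mult_1_right)
  finally show ?thesis .
qed

lemma full_lam_super:
  "full_lam g (s + t + 1) \<le> full_lam g s + full_lam g t + (\<Sum>q<Suc (s + t + 1). g q)"
proof -
  have "lam g (s + t + 1) s = full_lam g s" "lam g (s + t + 1) t = full_lam g t"
    by (simp_all add: lam_eq_full)
  then show ?thesis using lam_super[of g "s + t + 1" s t] unfolding full_lam_def[of g "s + t + 1"] by metis
qed

text \<open>For \<open>1 \<le> q \<le> r\<close> the floor of \<open>r / q\<close> is at least half
  of \<open>r / q\<close>, so \<open>full_lam g r / r\<close> is at least half of each partial sum
  of \<open>g q / q\<close> up to \<open>r\<close>.\<close>

lemma full_lam_fast:
  assumes "\<And>B. \<exists>N. B \<le> (\<Sum>q=1..N. real (g q) / real q)"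
  shows "\<exists>r0. \<forall>r\<ge>r0. C * r \<le> full_lam g r"
proof -
  obtain N where N: "2 * real C \<le> (\<Sum>q=1..N. real (g q) / real q)" using assms by blast
  have "C * r \<le> full_lam g r" if r: "N \<le> r" for r
  proof -
    have "real C * real r \<le> (\<Sum>q=1..N. real (g q) / real q) * (real r / 2)"
      using mult_right_mono[OF N, of "real r / 2"] by simp
    also have "\<dots> = (\<Sum>q=1..N. real (g q) * (real r / (2 * real q)))"
      unfolding sum_distrib_right by (rule sum.cong) auto
    also have "\<dots> \<le> (\<Sum>q=1..N. real (g q) * real (r div q))"
    proof (intro sum_mono mult_left_mono)
      fix q assume q: "q \<in> {1..N}"
      have "r < Suc (r div q) * q" using dividend_less_div_times[of q r] q by (simp add: add.commute)
      moreover have "1 \<le> r div q" using q r div_greater_zero_iff[of r q] by simp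
      then have "Suc (r div q) * q \<le> 2 * (r div q) * q" by (intro mult_le_mono1) simp
      ultimately have "r \<le> 2 * (r div q) * q" by linarith
      then have "real r \<le> real (2 * (r div q) * q)" by (rule of_nat_mono)
      then show "real r / (2 * real q) \<le> real (r div q)" using q by (simp add: field_simps)
    qed simp
    also have "\<dots> = real (\<Sum>q=1..N. g q * (r div q))" by simp
    also have "\<dots> \<le> real (full_lam g r)"
      unfolding full_lam_def lam_def using r by (intro of_nat_mono sum_mono2) auto
    finally have "real (C * r) \<le> real (full_lam g r)" by simp
    then show ?thesis by (simp only: of_nat_le_iff)
  qed
  then show ?thesis by blast
qed

definition spaced_digits :: "(nat \<Rightarrow> nat) \<Rightarrow> nat \<Rightarrow> nat \<Rightarrow> nat \<Rightarrow> bool" where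
  "spaced_digits l k n c \<longleftrightarrow> (\<forall>x<n. \<forall>y<n. digit k c x \<noteq> 0 \<longrightarrow> digit k c y \<noteq> 0 \<longrightarrow> x \<le> y \<longrightarrow>
     l (\<Sum>i<n. of_bool (digit k c i \<noteq> 0 \<and> x \<le> i \<and> i < y)) \<le> y - x)"

lemma card_words_digits:
  assumes k: "k > 0"
  shows "card (words k l n) = (\<Sum>c<k ^ n. of_bool (spaced_digits l k n c))"
proof -
  define w where "w c i = (if 0 \<le> i \<and> i < int n then digit k c (nat i) else 0)" for c i
  have count: "(\<Sum>i<n. of_bool (digit k c i \<noteq> 0 \<and> x \<le> i \<and> i < y)) = card ({i. w c i \<noteq> 0} \<inter> {int x..<int y})"
    if "y < n" for c x y
  proof -
    have "(\<Sum>i<n. of_bool (digit k c i \<noteq> 0 \<and> x \<le> i \<and> i < y)) = card ({..<n} \<inter> {i. digit k c i \<noteq> 0 \<and> x \<le> i \<and> i < y})"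
      by simp
    also have "\<dots> = card (int ` ({..<n} \<inter> {i. digit k c i \<noteq> 0 \<and> x \<le> i \<and> i < y}))"
      by (simp add: card_image)
    also have "int ` ({..<n} \<inter> {i. digit k c i \<noteq> 0 \<and> x \<le> i \<and> i < y}) = {i. w c i \<noteq> 0} \<inter> {int x..<int y}"
    proof (intro equalityI subsetI)
      fix i assume i: "i \<in> {i. w c i \<noteq> 0} \<inter> {int x..<int y}"
      then show "i \<in> int ` ({..<n} \<inter> {i. digit k c i \<noteq> 0 \<and> x \<le> i \<and> i < y})"
        using that by (intro image_eqI[of _ _ "nat i"]) (auto simp: w_def split: if_splits)
    qed (auto simp: w_def)
    finally show ?thesis .
  qed
  have iff: "w c \<in> words k l n \<longleftrightarrow> spaced_digits l k n c" for c
  proof -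
    have "w c \<in> words k l n \<longleftrightarrow> spaced l {i. w c i \<noteq> 0}"
      using k digit_less[OF k] by (auto simp: words_def w_def split: if_splits)
    also have "\<dots> \<longleftrightarrow> spaced_digits l k n c"
    proof
      assume sp: "spaced l {i. w c i \<noteq> 0}"
      show "spaced_digits l k n c"
        unfolding spaced_digits_def
      proof (intro allI impI)
        fix x y assume xy: "x < n" "y < n" "digit k c x \<noteq> 0" "digit k c y \<noteq> 0" "x \<le> y"
        have "int (l (card ({i. w c i \<noteq> 0} \<inter> {int x..<int y}))) \<le> int y - int x"
          using xy by (intro spacedD[OF sp]) (auto simp: w_def)
        then show "l (\<Sum>i<n. of_bool (digit k c i \<noteq> 0 \<and> x \<le> i \<and> i < y)) \<le> y - x"
          unfolding count[OF xy(2)] using xy(5) by linarith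
      qed
    next
      assume sp: "spaced_digits l k n c"
      show "spaced l {i. w c i \<noteq> 0}"
        unfolding spaced_def
      proof (intro ballI impI)
        fix x y assume xy: "x \<in> {i. w c i \<noteq> 0}" "y \<in> {i. w c i \<noteq> 0}" "x \<le> y"
        define x' y' where "x' = nat x" and "y' = nat y"
        have x': "x = int x'" "x' < n" "digit k c x' \<noteq> 0"
          using xy(1) by (auto simp: w_def x'_def split: if_splits)
        have y': "y = int y'" "y' < n" "digit k c y' \<noteq> 0"
          using xy(2) by (auto simp: w_def y'_def split: if_splits)
        have "l (\<Sum>i<n. of_bool (digit k c i \<noteq> 0 \<and> x' \<le> i \<and> i < y')) \<le> y' - x'"
          using sp x' y' xy(3) unfolding spaced_digits_def by auto
        then show "int (l (card ({i. w c i \<noteq> 0} \<inter> {x..<y}))) \<le> y - x"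
          unfolding count[OF y'(2)] x'(1) y'(1) using xy(3) x'(1) y'(1) by linarith
      qed
    qed
    finally show ?thesis .
  qed
  have "bij_betw w {c. c < k ^ n \<and> spaced_digits l k n c} (words k l n)"
    unfolding bij_betw_def
  proof
    show "inj_on w {c. c < k ^ n \<and> spaced_digits l k n c}"
    proof (rule inj_onI)
      fix c c' assume c: "c \<in> {c. c < k ^ n \<and> spaced_digits l k n c}"
        "c' \<in> {c. c < k ^ n \<and> spaced_digits l k n c}" and e: "w c = w c'"
      have "digit k c i = digit k c' i" if "i < n" for i using fun_cong[OF e, of "int i"] that by (simp add: w_def)
      then show "c = c'" using digits_inj[OF k] c by blast
    qed
    show "w ` {c. c < k ^ n \<and> spaced_digits l k n c} = words k l n"
    proof (intro equalityI subsetI)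
      fix v assume v: "v \<in> words k l n"
      then have "v (int i) < k" for i by (simp add: words_def)
      then obtain c where c: "c < k ^ n" "\<And>i. i < n \<Longrightarrow> digit k c i = v (int i)"
        using ex_digits[OF k, of n "\<lambda>i. v (int i)"] by blast
      have "w c = v"
      proof
        fix i
        show "w c i = v i" using c(2)[of "nat i"] words_outside[OF v, of i] by (auto simp: w_def)
      qed
      then show "v \<in> w ` {c. c < k ^ n \<and> spaced_digits l k n c}" using c(1) v iff by blast
    qed (use iff in auto)
  qed
  then have "card (words k l n) = card {c. c < k ^ n \<and> spaced_digits l k n c}"
    by (simp add: bij_betw_same_card)
  also have "\<dots> = (\<Sum>c<k ^ n. of_bool (spaced_digits l k n c))" by (simp add: Int_def)
  finally show ?thesis .
qed

text \<open>The spacing function is allowed to depend on the argument, because the tests apply this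
  to candidate gap sequences that are themselves data.\<close>

lemma recf_card_words:
  assumes l: "recf (\<lambda>z. l (pfst z) (psnd z))" and n: "recf n" and k: "k > 0"
  shows "recf (\<lambda>x. card (words k (l x) (n x)))"
proof -
  have "recp (\<lambda>z. spaced_digits (l (pfst z)) k (n (pfst z)) (psnd z))"
    unfolding spaced_digits_def by (intro recf_intros recf_digit recf_comp2[OF l] recf_comp[OF n])
  then show ?thesis unfolding card_words_digits[OF k] by (intro recf_intros n)
qed

text \<open>The largest number in \<open>1..M\<close> with the property, and 0 by default. The value
  0 is taken without a test: it adds no gap and so cannot lower the entropy already secured.\<close>

definition best :: "(nat \<Rightarrow> bool) \<Rightarrow> nat \<Rightarrow> nat" where
  "best P M = rec_nat 0 (\<lambda>i y. if P (Suc i) then Suc i else y) M"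

lemma best:
  "best P M \<le> M" "best P M \<noteq> 0 \<Longrightarrow> P (best P M)" "best P M < c \<Longrightarrow> c \<le> M \<Longrightarrow> \<not> P c"
proof -
  have "best P M \<le> M \<and> (best P M \<noteq> 0 \<longrightarrow> P (best P M)) \<and> (\<forall>c. best P M < c \<longrightarrow> c \<le> M \<longrightarrow> \<not> P c)"
    unfolding best_def by (induction M) (auto simp: le_Suc_eq)
  then show "best P M \<le> M" "best P M \<noteq> 0 \<Longrightarrow> P (best P M)" "best P M < c \<Longrightarrow> c \<le> M \<Longrightarrow> \<not> P c" by auto
qed

text \<open>\<open>a i / b i\<close> are upper bounds of the target. At stage \<open>j\<close> the largest gap is taken for which
  the words of length \<open>m\<close> still guarantee an entropy above one of the first bounds.\<close>

definition stage_ok ::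
    "(nat \<Rightarrow> nat) \<Rightarrow> (nat \<Rightarrow> nat) \<Rightarrow> (nat \<Rightarrow> nat) \<Rightarrow> nat \<Rightarrow> nat \<Rightarrow> (nat \<Rightarrow> nat) \<Rightarrow> bool" where
  "stage_ok a b f k j h \<longleftrightarrow> (\<exists>i<Suc j.
     2 ^ (a i * (Suc j * Suc (f j) + (\<Sum>q<Suc j. h q))) \<le> card (words k (lam h j) (Suc j * Suc (f j))) ^ b i)"

text \<open>Each gap depends on all earlier ones, so the recursion carries their list;
  \<open>g\<close> is read off from these histories.\<close>

lemma ex_adapted_gaps:
  assumes a: "recf a" and b: "recf b" and f: "recf f" and k: "k > 0"
  obtains g where "recf g"
    "\<And>j. g j = best (\<lambda>v. stage_ok a b f k j (g(j := v))) (f (j div 2) - (\<Sum>q<j. g q))"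
proof -
  \<comment> \<open>The list \<open>c\<close> of settled gaps, with the candidate \<open>v\<close>
    at position \<open>j\<close>. Only positions up to \<open>j\<close> are consulted, where this
    agrees with the updated function.\<close>
  define h where "h c j v q = (if q < j then lnth c q else v)" for c j v q
  define H where "H c j v r = (\<Sum>q<Suc j. h c j v q * (r div q))" for c j v r
  define cnt where "cnt c j v = card (words k (H c j v) (Suc j * Suc (f j)))" for c j v
  define P where "P c j v \<longleftrightarrow> (\<exists>i<Suc j.
     2 ^ (a i * (Suc j * Suc (f j) + (\<Sum>q<Suc j. h c j v q))) \<le> cnt c j v ^ b i)" for c j v
  define B where "B c j = rec_nat 0 (\<lambda>i y. if P c j (Suc i) then Suc i else y) (f (j div 2) - (\<Sum>q<j. lnth c q))" for c j
  define hist where "hist = rec_nat 0 (\<lambda>j c. list_encode (map (\<lambda>i. if i < j then lnth c i else B c j) [0..<Suc j]))"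
  define g where "g j = lnth (hist (Suc j)) j" for j
  note fa = recf_comp[OF a] and fb = recf_comp[OF b] and ff = recf_comp[OF f]
  have h: "recf (\<lambda>x. h (c x) (j x) (v x) (q x))" if "recf c" "recf j" "recf v" "recf q" for c j v q
    unfolding h_def by (intro recf_intros recf_lnth that)
  have H: "recf (\<lambda>x. H (c x) (j x) (v x) (r x))" if "recf c" "recf j" "recf v" "recf r" for c j v r
    by (rule recf_comp4[of H], unfold H_def) (intro recf_intros h, (rule that)+)
  have cnt: "recf (\<lambda>x. cnt (c x) (j x) (v x))" if "recf c" "recf j" "recf v" for c j v
    by (rule recf_comp3[of cnt], unfold cnt_def) (intro recf_card_words[OF _ _ k] recf_intros H ff, (rule that)+)
  have P: "recp (\<lambda>x. P (c x) (j x) (v x))" if "recf c" "recf j" "recf v" for c j v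
    by (rule recf_comp3[of "\<lambda>c j v. of_bool (P c j v)"], unfold P_def)
      (intro recf_intros h cnt fa fb ff, (rule that)+)
  have B: "recf (\<lambda>x. B (c x) (j x))" if "recf c" "recf j" for c j
    by (rule recf_comp2[of B], unfold B_def) (intro recf_intros P recf_lnth ff, (rule that)+)
  have rh: "recf hist" unfolding hist_def by (intro recf_intros recf_lnth recf_map_upt B)
  have g: "recf g" unfolding g_def by (intro recf_lnth recf_comp[OF rh] recf_intros)
  have hist_Suc: "lnth (hist (Suc j)) i = (if i < j then lnth (hist j) i else if i = j then B (hist j) j else 0)" for i j
    by (auto simp: hist_def lnth_list_encode nth_append)
  have hist: "lnth (hist j) i = g i" if "i < j" for i j
    using that
  proof (induction j)
    case (Suc j)
    then show ?case by (cases "i = j") (auto simp: hist_Suc g_def)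
  qed simp
  have gB: "g j = B (hist j) j" for j by (simp add: g_def hist_Suc)
  have hh: "h (hist j) j v q = (g(j := v)) q" if "q \<le> j" for j v q
    using that hist by (auto simp: h_def)
  have HH: "H (hist j) j v = lam (g(j := v)) j" for j v
    unfolding H_def lam_def by (intro ext sum.cong) (auto simp: hh)
  have cc: "cnt (hist j) j v = card (words k (lam (g(j := v)) j) (Suc j * Suc (f j)))" for j v
    unfolding cnt_def HH by (rule refl)
  have ss: "(\<Sum>q<Suc j. h (hist j) j v q) = (\<Sum>q<Suc j. (g(j := v)) q)" for j v
    by (rule sum.cong) (auto simp: hh)
  have PP: "P (hist j) j v \<longleftrightarrow> stage_ok a b f k j (g(j := v))" for j v
    unfolding P_def stage_ok_def cc ss by (rule refl)
  have S: "(\<Sum>q<j. lnth (hist j) q) = (\<Sum>q<j. g q)" for j by (rule sum.cong) (auto simp: hist)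
  have "B (hist j) j = best (\<lambda>v. stage_ok a b f k j (g(j := v))) (f (j div 2) - (\<Sum>q<j. g q))" for j
    unfolding B_def best_def PP S by (rule refl)
  from that[OF g trans[OF gB this]] show thesis .
qed

lemma scaled_le_imp_le:
  fixes B :: real
  shows "B * L \<le> A * M \<Longrightarrow> B > 0 \<Longrightarrow> L \<le> A / B * M"
  by (simp add: field_simps)

text \<open>The assumptions \<open>above\<close> and \<open>least\<close> make \<alpha> the infimum
  of the bounds \<open>a i / b i\<close>. By \<open>alphabet\<close> the words without any
  restriction have entropy at least \<alpha>, from which the construction starts.\<close>

locale adapted_gaps =
  fixes a b f g :: "nat \<Rightarrow> nat" and k :: nat and \<alpha> :: real
  assumes k: "k > 0" and b: "\<And>i. b i > 0" and f: "mono f"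
    and g: "\<And>j. g j = best (\<lambda>v. stage_ok a b f k j (g(j := v))) (f (j div 2) - (\<Sum>q<j. g q))"
    and above: "\<And>i. \<alpha> \<le> real (a i) / real (b i)"
    and least: "\<And>u. \<alpha> < u \<Longrightarrow> \<exists>i. real (a i) / real (b i) < u"
    and nonneg: "0 \<le> \<alpha>" and alphabet: "\<alpha> \<le> log 2 (real k)"
    and diverges: "\<And>B. \<exists>N. B \<le> (\<Sum>n=1..N. real (f n) / real n ^ 2)"
begin

lemma gap_sum: "(\<Sum>q<Suc j. g q) \<le> f (j div 2)"
proof (induction j)
  case 0
  show ?case using best(1)[of _ "f (0 div 2) - (\<Sum>q<0. g q)"] g[of 0] by simp
next
  case (Suc j)
  have "(\<Sum>q<Suc j. g q) \<le> f (Suc j div 2)"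
    using Suc.IH monoD[OF f, of "j div 2" "Suc j div 2"] by (simp add: div_le_mono)
  moreover have "g (Suc j) \<le> f (Suc j div 2) - (\<Sum>q<Suc j. g q)" by (subst g) (rule best(1))
  ultimately show ?case by simp
qed

text \<open>Induction over the stages: a zero gap leaves \<open>lam\<close> unchanged, and a nonzero
  gap has passed the test against some upper bound of \<alpha>, which certifies the claim anew for
  all lengths.\<close>

lemma words_lower: "real n * \<alpha> \<le> log 2 (real (card (words k (lam g j) n)))"
proof -
  have stage: "real n * \<alpha> \<le> log 2 (real (card (words k (lam g j) n)))" if ok: "stage_ok a b f k j g" for j
  proof -
    define m where "m = Suc j * Suc (f j)"
    have m: "m \<ge> 1" by (simp add: m_def)
    obtain i where "2 ^ (a i * (m + (\<Sum>q<Suc j. g q))) \<le> card (words k (lam g j) m) ^ b i"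
      using ok unfolding stage_ok_def m_def by blast
    from card_words_lower[OF mono_lam lam_super k m b this]
    have "real n * (real (a i) / real (b i)) \<le> log 2 (real (card (words k (lam g j) n)))" .
    moreover have "real n * \<alpha> \<le> real n * (real (a i) / real (b i))" using above by (intro mult_left_mono) auto
    ultimately show ?thesis by linarith
  qed
  have base: "real n * \<alpha> \<le> log 2 (real (card (words k (lam h 0) n)))" for h
  proof -
    \<comment> \<open>At level 0 no distance is required, so all \<open>k ^ n\<close> words are
      counted.\<close>
    have "lam h 0 r = 0" for r by (simp add: lam_def)
    then have "2 ^ 0 \<le> (1::nat) \<and> words k (lam h 0) n = {w. (\<forall>i. w i < k) \<and> {i. w i \<noteq> 0} \<subseteq> {0..<int n}}"
      by (auto simp: words_def spaced_def)
    moreover have "bij_betw (\<lambda>w. restrict w {0..<int n}) {w. (\<forall>i. w i < k) \<and> {i. w i \<noteq> 0} \<subseteq> {0..<int n}}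
        ({0..<int n} \<rightarrow>\<^sub>E {..<k})"
      by (rule bij_betw_byWitness[where f' = "\<lambda>w i. if i \<in> {0..<int n} then w i else 0"])
        (use k in \<open>auto simp: fun_eq_iff PiE_def extensional_def Pi_def split: if_splits\<close>)
    ultimately have "card (words k (lam h 0) n) = k ^ n"
      by (simp add: bij_betw_same_card card_PiE)
    then show ?thesis using k alphabet by (simp add: log_nat_power mult_left_mono)
  qed
  show ?thesis
  proof (induction j)
    case 0
    show ?case by (rule base)
  next
    case (Suc j)
    show ?case
    proof (cases "g (Suc j) = 0")
      case True
      then have "lam g (Suc j) = lam g j" by (auto simp: lam_def fun_eq_iff)
      with Suc show ?thesis by simp
    next
      case False
      then have "stage_ok a b f k (Suc j) (g(Suc j := g (Suc j)))"
        using best(2)[of "\<lambda>v. stage_ok a b f k (Suc j) (g(Suc j := v))"] g[of "Suc j"] by metis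
      then show ?thesis by (intro stage) simp
    qed
  qed
qed

text \<open>Groups within a word of length \<open>n\<close> have counts below \<open>n\<close>, and
  there \<open>full_lam g\<close> agrees with \<open>lam g n\<close>.\<close>

lemma full_words_lower: "real n * \<alpha> \<le> log 2 (real (card (words k (full_lam g) n)))"
proof -
  have "words k (lam g n) n = words k (full_lam g) n" by (rule words_cong) (simp add: lam_eq_full)
  then show ?thesis using words_lower[of n n] by simp
qed

text \<open>Summation by parts replaces \<open>g q / q\<close> by the total gap \<open>G q\<close>
  times \<open>1 / q - 1 / (q + 1)\<close>. As \<open>G\<close> is \<open>f n\<close> at both
  \<open>2 * n\<close> and \<open>2 * n + 1\<close>, this pair contributes
  \<open>f n / (2 * n * (n + 1))\<close>, at least a quarter of \<open>f n / n ^ 2\<close>.\<close>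

lemma gap_harmonic:
  assumes "\<And>j. j \<ge> J \<Longrightarrow> (\<Sum>q<Suc j. g q) = f (j div 2)"
  shows "\<exists>N. B \<le> (\<Sum>q=1..N. real (g q) / real q)"
proof -
  define G where "G j = real (\<Sum>q<Suc j. g q)" for j
  have G0: "0 \<le> G j" for j unfolding G_def by (rule of_nat_0_le_iff)
  have abel: "(\<Sum>q=1..N. real (g q) / real q)
      = (\<Sum>q=1..N. G q * (1 / real q - 1 / real (Suc q))) + G N / real (Suc N) - G 0" for N
  proof (induction N)
    case (Suc N)
    have "G (Suc N) = G N + real (g (Suc N))" by (simp add: G_def)
    then have "G (Suc N) / real (Suc N) = G N / real (Suc N) + real (g (Suc N)) / real (Suc N)"
      by (simp only: add_divide_distrib)
    with Suc show ?case by (simp add: right_diff_distrib del: of_nat_Suc)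
  qed (simp add: G_def)
  have pos: "0 \<le> G q * (1 / real q - 1 / real (Suc q))" if "q \<ge> 1" for q
    using that by (intro mult_nonneg_nonneg G0) (auto simp: frac_le simp del: of_nat_Suc)
  have pair: "real (f n) / real n ^ 2 \<le> 4 * (\<Sum>q=2*n..<2*n+2. G q * (1 / real q - 1 / real (Suc q)))"
    if n: "n \<ge> 1" "n \<ge> J" for n
  proof -
    have "{2*n..<2*n+2} = {2 * n, Suc (2 * n)}" by auto
    moreover have "G (2 * n) = real (f n)" "G (Suc (2 * n)) = real (f n)"
      using assms[of "2 * n"] assms[of "Suc (2 * n)"] n by (auto simp: G_def)
    ultimately have "(\<Sum>q=2*n..<2*n+2. G q * (1 / real q - 1 / real (Suc q)))
        = real (f n) * (1 / real (2 * n) - 1 / real (2 * n + 2))"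
      by (simp add: algebra_simps)
    also have "1 / real (2 * n) - 1 / real (2 * n + 2) = 1 / (2 * real n * (real n + 1))"
      using n by (simp add: field_simps)
    finally have eq: "(\<Sum>q=2*n..<2*n+2. G q * (1 / real q - 1 / real (Suc q)))
        = real (f n) * (1 / (2 * real n * (real n + 1)))" .
    have "real n * 1 \<le> real n * real n" using n by (intro mult_left_mono) auto
    then have "2 * real n * (real n + 1) \<le> 4 * real n ^ 2" by (simp add: power2_eq_square distrib_left)
    then have "real (f n) * (1 / (4 * real n ^ 2)) \<le> real (f n) * (1 / (2 * real n * (real n + 1)))"
      using n by (intro mult_left_mono divide_left_mono mult_pos_pos) auto
    moreover have "real (f n) / real n ^ 2 = 4 * (real (f n) * (1 / (4 * real n ^ 2)))" by simp
    ultimately show ?thesis unfolding eq by linarith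
  qed
  define C where "C = (\<Sum>n=1..J. real (f n) / real n ^ 2)"
  \<comment> \<open>\<open>C\<close> pays for the indices up to \<open>J\<close>, \<open>G 0\<close>
    for the boundary term of the summation by parts, and 4 is the factor in
    \<open>pair\<close>.\<close>
  obtain M where M: "4 * (B + G 0) + C \<le> (\<Sum>n=1..M. real (f n) / real n ^ 2)" using diverges by blast
  have "(\<Sum>n=1..M. real (f n) / real n ^ 2) \<le> C + (\<Sum>n=Suc J..M. real (f n) / real n ^ 2)"
  proof -
    have "(\<Sum>n=1..M. real (f n) / real n ^ 2) \<le> (\<Sum>n\<in>{1..J} \<union> {Suc J..M}. real (f n) / real n ^ 2)"
      by (intro sum_mono2) auto
    also have "\<dots> = C + (\<Sum>n=Suc J..M. real (f n) / real n ^ 2)"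
      unfolding C_def by (rule sum.union_disjoint) auto
    finally show ?thesis .
  qed
  also have "(\<Sum>n=Suc J..M. real (f n) / real n ^ 2)
      \<le> (\<Sum>n=Suc J..M. 4 * (\<Sum>q=2*n..<2*n+2. G q * (1 / real q - 1 / real (Suc q))))"
    by (intro sum_mono pair) auto
  also have "\<dots> = 4 * (\<Sum>n=Suc J..M. \<Sum>q=2*n..<2*n+2. G q * (1 / real q - 1 / real (Suc q)))"
    by (rule sum_distrib_left[symmetric])
  also have "(\<Sum>n=Suc J..M. \<Sum>q=2*n..<2*n+2. G q * (1 / real q - 1 / real (Suc q)))
      = (\<Sum>q\<in>(\<Union>n\<in>{Suc J..M}. {2*n..<2*n+2}). G q * (1 / real q - 1 / real (Suc q)))"
    by (rule sum.UNION_disjoint[symmetric]) auto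
  also have "\<dots> \<le> (\<Sum>q=1..2*M+1. G q * (1 / real q - 1 / real (Suc q)))"
    by (intro sum_mono2 pos) auto
  finally have "B + G 0 \<le> (\<Sum>q=1..2*M+1. G q * (1 / real q - 1 / real (Suc q)))" using M by simp
  moreover have "0 \<le> G (2*M+1) / real (Suc (2*M+1))" using G0 by simp
  ultimately have "B \<le> (\<Sum>q=1..2*M+1. real (g q) / real q)" unfolding abel by linarith
  then show ?thesis by blast
qed

lemma entropy_upper:
  assumes h: "\<And>n. n \<ge> 1 \<Longrightarrow> h * real n \<le> log 2 (real (card (words k (full_lam g) n)))"
  shows "h \<le> \<alpha>"
proof (cases "\<exists>J. \<forall>j\<ge>J. (\<Sum>q<Suc j. g q) = f (j div 2)")
  case True
  then obtain J where J: "\<And>j. j \<ge> J \<Longrightarrow> (\<Sum>q<Suc j. g q) = f (j div 2)" by blast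
  have "\<exists>N. B \<le> (\<Sum>q=1..N. real (g q) / real q)" for B by (rule gap_harmonic) (rule J)
  then have fast: "\<exists>r0. \<forall>r\<ge>r0. C * r \<le> full_lam g r" for C by (rule full_lam_fast)
  have "h \<le> \<epsilon>" if \<epsilon>: "\<epsilon> > 0" for \<epsilon>
  proof -
    obtain n where n: "n \<ge> 1" "log 2 (real (card (words k (full_lam g) n))) \<le> \<epsilon> * real n"
      using words_zero_entropy[OF mono_full_lam k fast \<epsilon>] by blast
    then have "h * real n \<le> \<epsilon> * real n" using h[of n] by linarith
    then show ?thesis using n(1) by (simp add: mult_le_cancel_right)
  qed
  then have "h \<le> 0" by (rule field_le_epsilon[of h 0, simplified])
  then show ?thesis using nonneg by linarith
next
  case False
  \<comment> \<open>Here the gaps have not exhausted \<open>f\<close>, so \<open>g j + 1\<close> was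
    rejected because of the count and not because of the limit on the gaps. One factor
    \<open>1 + 1 / j\<close> is the price of that additional unit, the other that of the total gap
    in the test.\<close>
  have key: "h \<le> real (a i) / real (b i) * (1 + 1 / real j) ^ 2"
    if j: "j \<ge> 1" "i \<le> j" and ne: "(\<Sum>q<Suc j. g q) \<noteq> f (j div 2)" for i j
  proof -
    let ?h = "g(j := Suc (g j))" and ?m = "Suc j * Suc (f j)"
    have "(\<Sum>q<j. g q) + g j < f (j div 2)" using gap_sum[of j] ne by simp
    then have lt: "Suc (g j) \<le> f (j div 2) - (\<Sum>q<j. g q)" by simp
    have "best (\<lambda>v. stage_ok a b f k j (g(j := v))) (f (j div 2) - (\<Sum>q<j. g q)) < Suc (g j)"
      using g[of j] by simp
    from best(3)[OF this lt] have ns: "\<not> stage_ok a b f k j ?h" .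
    have "i < Suc j" using j(2) by simp
    then have "\<not> 2 ^ (a i * (?m + (\<Sum>q<Suc j. ?h q))) \<le> card (words k (lam ?h j) ?m) ^ b i"
      using ns unfolding stage_ok_def by blast
    then have less: "card (words k (lam ?h j) ?m) ^ b i < 2 ^ (a i * (?m + (\<Sum>q<Suc j. ?h q)))"
      by (simp only: not_le)
    let ?c = "card (words k (lam ?h j) ?m)" and ?G = "\<Sum>q<Suc j. ?h q"
    have c: "?c > 0" by (rule card_words_pos[OF k])
    have "real (?c ^ b i) \<le> real (2 ^ (a i * (?m + ?G)))" using less by (intro of_nat_mono) simp
    then have "log 2 (real (?c ^ b i)) \<le> log 2 (real (2 ^ (a i * (?m + ?G))))"
      using c by (subst log_le_cancel_iff) simp_all
    then have "real (b i) * log 2 (real ?c) \<le> real (a i * (?m + ?G))"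
      using c by (simp add: log_nat_power del: of_nat_mult of_nat_add)
    then have lc: "log 2 (real ?c) \<le> real (a i) / real (b i) * real (?m + ?G)"
      unfolding of_nat_mult by (rule scaled_le_imp_le) (simp add: b)
    \<comment> \<open>One more unit of gap at level \<open>j\<close> is exactly what inserting a
      zero after every \<open>j\<close> letters provides; it turns length \<open>m * j\<close> into
      \<open>m * (j + 1)\<close>.\<close>
    have lam': "(\<lambda>r. lam g j r + r div j) = lam ?h j"
      by (rule ext) (simp add: lam_def algebra_simps)
    have len: "?m * j + ?m * j div j = ?m * Suc j" using j(1) by simp
    have "card (words k (lam g j) (?m * j)) \<le> card (words k (lam ?h j) (?m * Suc j))"
      by (rule card_words_insert[of j k "lam g j" "?m * j", unfolded lam' len]) (use j(1) in simp)
    also have "\<dots> \<le> ?c ^ Suc j" by (rule card_words_mult[OF mono_lam _ k]) simp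
    finally have w: "card (words k (lam g j) (?m * j)) \<le> ?c ^ Suc j" .
    have "card (words k (full_lam g) (?m * j)) \<le> card (words k (lam g j) (?m * j))"
      by (intro card_mono words_antimono lam_le_full) simp
    with w have "card (words k (full_lam g) (?m * j)) \<le> ?c ^ Suc j" by linarith
    then have "real (card (words k (full_lam g) (?m * j))) \<le> real (?c ^ Suc j)" by (rule of_nat_mono)
    then have "log 2 (real (card (words k (full_lam g) (?m * j)))) \<le> log 2 (real (?c ^ Suc j))"
      using card_words_pos[OF k] c by (subst log_le_cancel_iff) simp_all
    also have "\<dots> = real (Suc j) * log 2 (real ?c)" using c by (simp add: log_nat_power del: power_Suc)
    also have "\<dots> \<le> real (Suc j) * (real (a i) / real (b i) * real (?m + ?G))" using lc by (intro mult_left_mono) auto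
    finally have "h * real (?m * j) \<le> real (Suc j) * (real (a i) / real (b i) * real (?m + ?G))"
      using h[of "?m * j"] j(1) by (simp del: of_nat_mult)
    also have "\<dots> \<le> real (Suc j) * (real (a i) / real (b i) * (real ?m * (1 + 1 / real j)))"
    proof (intro mult_left_mono)
      have "(\<Sum>q<j. ?h q) = (\<Sum>q<j. g q)" by (rule sum.cong) auto
      then have "?G \<le> f (j div 2)" using lt by simp
      also have "\<dots> \<le> f j" by (intro monoD[OF f]) simp
      finally have "?G \<le> f j" .
      \<comment> \<open>This is the reason for the test length \<open>Suc j * Suc (f j)\<close>: it
        is at least \<open>j\<close> times the total gap.\<close>
      then have "?G * j \<le> f j * j" by (rule mult_le_mono1)
      also have "\<dots> \<le> ?m" by simp
      finally have "real (?G * j) \<le> real ?m" by (rule of_nat_mono)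
      then have "real ?G * real j \<le> real ?m" unfolding of_nat_mult[symmetric] .
      moreover have "0 < real j" using j(1) by simp
      ultimately have "real ?G \<le> real ?m / real j" by (simp only: pos_le_divide_eq)
      then show "real (?m + ?G) \<le> real ?m * (1 + 1 / real j)" by (simp add: distrib_left)
    qed auto
    also have "\<dots> = real (a i) / real (b i) * (1 + 1 / real j) ^ 2 * real (?m * j)"
    proof -
      have "real (Suc j) = (1 + 1 / real j) * real j" using j(1) by (simp add: field_simps)
      then show ?thesis by (simp only: of_nat_mult power2_eq_square mult_ac)
    qed
    finally show ?thesis
      by (rule mult_right_le_imp_le) (use j(1) in \<open>simp only: of_nat_0_less_iff nat_0_less_mult_iff, simp\<close>)
  qed
  have "h \<le> real (a i) / real (b i)" for i
  proof (rule ccontr)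
    let ?r = "real (a i) / real (b i)"
    assume "\<not> h \<le> ?r"
    moreover have "(\<lambda>j. ?r * (1 + 1 / real j) ^ 2) \<longlonglongrightarrow> ?r * (1 + 0) ^ 2"
      by (intro tendsto_intros lim_1_over_n)
    ultimately have "eventually (\<lambda>j. ?r * (1 + 1 / real j) ^ 2 < h) sequentially"
      by (intro order_tendstoD) auto
    then obtain J where J: "\<And>j. j \<ge> J \<Longrightarrow> ?r * (1 + 1 / real j) ^ 2 < h"
      unfolding eventually_sequentially by blast
    obtain j where "j \<ge> max J (max 1 i)" "(\<Sum>q<Suc j. g q) \<noteq> f (j div 2)" using False by blast
    with key[of j i] J[of j] show False by simp
  qed
  then show ?thesis using least[of h] by (metis not_less)
qed

end

section \<open>The subshift of independent spaced rows\<close>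

text \<open>Letting the lines parallel to the first axis vary independently turns a one-dimensional system
  into a \<open>d\<close>-dimensional one with the same entropy and the same irreducibility.\<close>

definition spaced_rows :: "nat \<Rightarrow> nat \<Rightarrow> (nat \<Rightarrow> nat) \<Rightarrow> (int list \<Rightarrow> nat) set" where
  "spaced_rows e k l = {x \<in> Zd (Suc e) \<rightarrow>\<^sub>E {..<k}. \<forall>t\<in>Zd e. spaced l {i. x (i # t) \<noteq> 0}}"

lemma Cons_in_Zd [simp]: "i # t \<in> Zd (Suc e) \<longleftrightarrow> t \<in> Zd e"
  by (simp add: Zd_def)

lemma Zd_SucE:
  assumes "j \<in> Zd (Suc e)"
  obtains i t where "j = i # t" "t \<in> Zd e"
  using assms by (cases j) (auto simp: Zd_def)

text \<open>A violation of the spacing rule is witnessed by two points of one row and the finitely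
  many sites between them, so every configuration outside has a cylinder neighbourhood
  outside.\<close>

lemma closedin_rows: "closedin (product_topology (\<lambda>_. discrete_topology {..<k}) (Zd (Suc e))) (spaced_rows e k l)"
proof -
  let ?T = "product_topology (\<lambda>_. discrete_topology {..<k}) (Zd (Suc e))"
  have top: "topspace ?T = Zd (Suc e) \<rightarrow>\<^sub>E {..<k}" by simp
  have "\<exists>N. openin ?T N \<and> x \<in> N \<and> N \<subseteq> topspace ?T - spaced_rows e k l" if x: "x \<in> topspace ?T - spaced_rows e k l" for x
  proof -
    have xP: "x \<in> Zd (Suc e) \<rightarrow>\<^sub>E {..<k}" using x top by blast
    then obtain t where t: "t \<in> Zd e" "\<not> spaced l {i. x (i # t) \<noteq> 0}" using x by (auto simp: spaced_rows_def)
    let ?X = "\<lambda>x. {i. x (i # t) \<noteq> (0::nat)}"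
    obtain a b where ab: "a \<in> ?X x" "b \<in> ?X x" "a \<le> b" "\<not> int (l (card (?X x \<inter> {a..<b}))) \<le> b - a"
      using t(2) unfolding spaced_def by blast
    define F where "F = (\<lambda>i. i # t) ` {a..b}"
    define N where "N = (\<Pi>\<^sub>E i\<in>Zd (Suc e). if i \<in> F then {x i} else {..<k})"
    have F: "F \<subseteq> Zd (Suc e)" "finite F" using t by (auto simp: F_def)
    have less: "x i < k" if "i \<in> F" for i using xP F that by fastforce
    have "openin ?T N"
      unfolding N_def
    proof (rule product_topology_basis)
      show "openin (discrete_topology {..<k}) (if i \<in> F then {x i} else {..<k})" for i using less by simp
      show "finite {i. (if i \<in> F then {x i} else {..<k}) \<noteq> topspace (discrete_topology {..<k})}"
        by (rule finite_subset[OF _ F(2)]) auto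
    qed
    moreover have "x \<in> N" using xP by (auto simp: N_def PiE_iff)
    moreover have "N \<subseteq> topspace ?T - spaced_rows e k l"
    proof
      fix y assume y: "y \<in> N"
      have "y i < k" if "i \<in> Zd (Suc e)" for i
        using PiE_mem[OF y[unfolded N_def] that] less by (auto split: if_splits)
      moreover have "y \<in> extensional (Zd (Suc e))" using y by (simp add: N_def PiE_def)
      ultimately have "y \<in> topspace ?T" unfolding top by (simp add: PiE_def Pi_def)
      moreover have "y \<notin> spaced_rows e k l"
      proof
        assume "y \<in> spaced_rows e k l"
        then have sp: "spaced l (?X y)" using t by (auto simp: spaced_rows_def)
        have eq: "y (i # t) = x (i # t)" if "a \<le> i" "i \<le> b" for i
        proof -
          have "i # t \<in> F" using that by (auto simp: F_def)
          then show ?thesis using PiE_mem[OF y[unfolded N_def], of "i # t"] F by auto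
        qed
        have "?X y \<inter> {a..<b} = ?X x \<inter> {a..<b}" using eq by auto
        moreover have "a \<in> ?X y" "b \<in> ?X y" using ab eq by auto
        ultimately show False using spacedD[OF sp _ _ ab(3)] ab(4) by simp
      qed
      ultimately show "y \<in> topspace ?T - spaced_rows e k l" by blast
    qed
    ultimately show ?thesis by blast
  qed
  then have "openin ?T (topspace ?T - spaced_rows e k l)" by (subst openin_subopen) blast
  moreover have "spaced_rows e k l \<subseteq> topspace ?T" unfolding top by (auto simp: spaced_rows_def)
  ultimately show ?thesis by (simp only: closedin_def)
qed

lemma subshift_rows: "subshift (Suc e) k (spaced_rows e k l)"
  unfolding subshift_def
proof (intro conjI ballI)
  fix v x assume v: "v \<in> Zd (Suc e)" and x: "x \<in> spaced_rows e k l"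
  obtain c u where cu: "v = c # u" "u \<in> Zd e" using v by (rule Zd_SucE)
  let ?y = "shift (Suc e) v x"
  have x': "x \<in> Zd (Suc e) \<rightarrow>\<^sub>E {..<k}" using x by (simp add: spaced_rows_def)
  have "?y \<in> Zd (Suc e) \<rightarrow>\<^sub>E {..<k}"
    unfolding shift_def restrict_PiE_iff using PiE_mem[OF x'] map2_in_Zd[OF _ v] by blast
  moreover have "spaced l {i. ?y (i # t) \<noteq> 0}" if t: "t \<in> Zd e" for t
  proof -
    let ?t = "map2 (+) t u"
    have "{i. ?y (i # t) \<noteq> 0} = (\<lambda>i. i + (- c)) ` {i. x (i # ?t) \<noteq> 0}"
    proof (intro equalityI subsetI)
      fix i assume "i \<in> {i. ?y (i # t) \<noteq> 0}"
      then show "i \<in> (\<lambda>i. i + (- c)) ` {i. x (i # ?t) \<noteq> 0}"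
        using t by (intro image_eqI[of _ _ "i + c"]) (auto simp: shift_apply cu)
    qed (use t in \<open>auto simp: shift_apply cu\<close>)
    moreover have "spaced l {i. x (i # ?t) \<noteq> 0}" using x map2_in_Zd[OF t cu(2)] by (simp add: spaced_rows_def)
    ultimately show ?thesis by (simp only: spaced_translate)
  qed
  ultimately show "?y \<in> spaced_rows e k l" by (simp add: spaced_rows_def)
qed (rule closedin_rows)

lemma rows_zero_outside:
  assumes l: "mono l" and x: "x \<in> spaced_rows e k l" and k: "k > 0"
  shows "(\<lambda>i\<in>Zd (Suc e). if i \<in> A then x i else 0) \<in> spaced_rows e k l" (is "?y \<in> _")
proof -
  have "x \<in> Zd (Suc e) \<rightarrow>\<^sub>E {..<k}" using x by (simp add: spaced_rows_def)
  from PiE_mem[OF this] have "?y \<in> Zd (Suc e) \<rightarrow>\<^sub>E {..<k}" using k by (simp add: restrict_PiE_iff)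
  moreover have "spaced l {i. ?y (i # t) \<noteq> 0}" if t: "t \<in> Zd e" for t
  proof (rule spaced_subset[OF l])
    show "spaced l {i. x (i # t) \<noteq> 0}" using x t by (simp add: spaced_rows_def)
    show "{i. ?y (i # t) \<noteq> 0} \<subseteq> {i. x (i # t) \<noteq> 0}" using t by (auto split: if_splits)
  qed
  ultimately show ?thesis by (simp add: spaced_rows_def)
qed

lemma rows_nonempty: "k > 0 \<Longrightarrow> spaced_rows e k l \<noteq> {}"
proof -
  assume "k > 0"
  then have "(\<lambda>i\<in>Zd (Suc e). 0) \<in> spaced_rows e k l" by (simp add: spaced_rows_def restrict_PiE_iff)
  then show ?thesis by blast
qed

subsection \<open>Irreducibility\<close>

lemma dist_max_row: "t \<in> Zd e \<Longrightarrow> dist_max (a # t) (b # t) = nat \<bar>a - b\<bar>"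
proof (rule antisym)
  show "dist_max (a # t) (b # t) \<le> nat \<bar>a - b\<bar>"
  proof (rule dist_max_le)
    fix m assume "m < length (a # t)"
    show "\<bar>(a # t) ! m - (b # t) ! m\<bar> \<le> int (nat \<bar>a - b\<bar>)" by (cases m) auto
  qed simp
  show "nat \<bar>a - b\<bar> \<le> dist_max (a # t) (b # t)" using dist_max_ge[of 0 "a # t" "b # t"] by simp
qed

lemma card_le_spread:
  fixes A :: "int set"
  assumes "finite A" "\<And>a b. a \<in> A \<Longrightarrow> b \<in> A \<Longrightarrow> nat \<bar>a - b\<bar> \<le> D"
  shows "card A \<le> D + 1"
proof (cases "A = {}")
  case False
  have "A \<subseteq> {Min A..Max A}" using assms(1) by auto
  then have "card A \<le> card {Min A..Max A}" by (intro card_mono) auto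
  also have "\<dots> = nat (Max A - Min A + 1)" by simp
  also have "\<dots> \<le> D + 1"
    using assms(2)[OF Max_in[OF assms(1) False] Min_in[OF assms(1) False]] by linarith
  finally show ?thesis .
qed simp

text \<open>A group of \<open>r + 1\<close> nonzero letters of a line in \<open>U \<union> V\<close> forces one of the two diameters to be at
  least \<open>r div 2\<close>; this is why the gaps up to level \<open>r\<close> may add up to \<open>f (r div 2)\<close>.\<close>

lemma irreducible_rows:
  assumes f: "mono f" "f 0 > 0" and gap: "\<And>j. (\<Sum>q<Suc j. g q) \<le> f (j div 2)" and k: "k > 0"
  shows "irreducible (Suc e) f (spaced_rows e k (full_lam g))"
  unfolding irreducible_def
proof (intro allI impI ballI)
  fix U V u v
  let ?S = "spaced_rows e k (full_lam g)" and ?D = "max (diam U) (diam V)"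
  assume UV: "finite U \<and> U \<noteq> {} \<and> U \<subseteq> Zd (Suc e) \<and> finite V \<and> V \<noteq> {} \<and> V \<subseteq> Zd (Suc e)"
    and u: "u \<in> lang_on ?S U" and v: "v \<in> lang_on ?S V" and sep: "f ?D \<le> set_dist U V"
  have fin: "finite U" "finite V" using UV by auto
  obtain x where x: "x \<in> ?S" "u = pattern_at x U" using u by (auto simp: lang_on_def)
  obtain y where y: "y \<in> ?S" "v = pattern_at y V" using v by (auto simp: lang_on_def)
  have far: "f ?D \<le> dist_max i j" if "i \<in> U" "j \<in> V" for i j
    using sep set_dist_le[OF fin that] by linarith
  \<comment> \<open>Positivity of \<open>f\<close> forces \<open>U\<close> and \<open>V\<close>
    apart, so that the two patterns can be superposed on a background of zeros.\<close>
  have fpos: "f ?D > 0" using f(2) monoD[OF f(1), of 0 ?D] by simp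
  have disj: "i \<notin> V" if "i \<in> U" for i
  proof
    assume i: "i \<in> V"
    have "i \<in> Zd (Suc e)" using UV that by blast
    then obtain a t where at: "i = a # t" "t \<in> Zd e" by (rule Zd_SucE)
    then show False using far[OF that i] fpos dist_max_row[of t e a a] by simp
  qed
  define z where "z = (\<lambda>i\<in>Zd (Suc e). if i \<in> U then x i else if i \<in> V then y i else 0)"
  have "x \<in> Zd (Suc e) \<rightarrow>\<^sub>E {..<k}" "y \<in> Zd (Suc e) \<rightarrow>\<^sub>E {..<k}" using x y by (simp_all add: spaced_rows_def)
  from this[THEN PiE_mem] have "z \<in> Zd (Suc e) \<rightarrow>\<^sub>E {..<k}" using k by (simp add: z_def restrict_PiE_iff)
  moreover have "spaced (full_lam g) {i. z (i # t) \<noteq> 0}" if t: "t \<in> Zd e" for t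
  proof -
    define A where "A = {i. i # t \<in> U \<and> x (i # t) \<noteq> 0}"
    define B where "B = {i. i # t \<in> V \<and> y (i # t) \<noteq> 0}"
    have inj: "inj_on (\<lambda>i. i # t) C" for C by (simp add: inj_on_def)
    have sub: "(\<lambda>i. i # t) ` A \<subseteq> U" "(\<lambda>i. i # t) ` B \<subseteq> V" by (auto simp: A_def B_def)
    have finAB: "finite A" "finite B"
      using finite_imageD[OF finite_subset[OF sub(1) fin(1)] inj]
        finite_imageD[OF finite_subset[OF sub(2) fin(2)] inj] .
    have eq: "{i. z (i # t) \<noteq> 0} = A \<union> B"
      using t disj by (auto simp: z_def A_def B_def split: if_splits)
    have "spaced (full_lam g) (A \<union> B)"
    proof (rule spaced_Un)
      have "spaced (full_lam g) {i. x (i # t) \<noteq> 0}" using x(1) t by (simp add: spaced_rows_def)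
      then show "spaced (full_lam g) A" by (rule spaced_subset[OF mono_full_lam]) (auto simp: A_def)
      have "spaced (full_lam g) {i. y (i # t) \<noteq> 0}" using y(1) t by (simp add: spaced_rows_def)
      then show "spaced (full_lam g) B" by (rule spaced_subset[OF mono_full_lam]) (auto simp: B_def)
      show "int (f ?D) \<le> \<bar>a - b\<bar>" if "a \<in> A" "b \<in> B" for a b
      proof -
        have "f ?D \<le> dist_max (a # t) (b # t)" using that by (intro far) (auto simp: A_def B_def)
        then show ?thesis unfolding dist_max_row[OF t] by linarith
      qed
      show "full_lam g (s + r + 1) \<le> full_lam g s + full_lam g r + f ?D" if sr: "s + r + 2 \<le> card (A \<union> B)" for s r
      proof -
        have "nat \<bar>a - b\<bar> \<le> diam U" if "a \<in> A" "b \<in> A" for a b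
          using diam_ge[OF fin(1), of "a # t" "b # t"] that by (simp add: A_def dist_max_row[OF t])
        then have "card A \<le> diam U + 1" by (rule card_le_spread[OF finAB(1)])
        moreover have "nat \<bar>a - b\<bar> \<le> diam V" if "a \<in> B" "b \<in> B" for a b
          using diam_ge[OF fin(2), of "a # t" "b # t"] that by (simp add: B_def dist_max_row[OF t])
        then have "card B \<le> diam V + 1" by (rule card_le_spread[OF finAB(2)])
        \<comment> \<open>A row meets each of the two supports in at most \<open>?D + 1\<close>
          sites, hence \<open>s + r + 2 \<le> 2 * ?D + 2\<close>.\<close>
        ultimately have "(s + r + 1) div 2 \<le> ?D" using sr card_Un_le[of A B] by linarith
        then have "f ((s + r + 1) div 2) \<le> f ?D" by (rule monoD[OF f(1)])
        then have "(\<Sum>q<Suc (s + r + 1). g q) \<le> f ?D" using gap[of "s + r + 1"] by linarith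
        then show ?thesis using full_lam_super[of g s r] by linarith
      qed
    qed (rule finAB)+
    then show ?thesis unfolding eq .
  qed
  ultimately have "z \<in> ?S" by (simp add: spaced_rows_def)
  moreover have "pattern_at z U = u" "pattern_at z V = v"
    using UV disj by (auto simp: x y pattern_at_eq_iff z_def)
  ultimately show "\<exists>x\<in>?S. pattern_at x U = u \<and> pattern_at x V = v" by blast
qed

subsection \<open>Entropy\<close>

lemma mem_box_Cons: "i # t \<in> box (Suc e) n \<longleftrightarrow> 0 \<le> i \<and> i < int n \<and> t \<in> box e n"
  by (auto simp: box_def)

text \<open>A pattern on the box amounts to a family of words, one for each of its
  \<open>n ^ e\<close> rows, and by the zero extension every such family occurs.\<close>

lemma card_lang_rows:
  assumes l: "mono l" and k: "k > 0"
  shows "card (lang_on (spaced_rows e k l) (box (Suc e) n)) = card (words k l n) ^ (n ^ e)"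
proof -
  let ?B = "box (Suc e) n" and ?P = "box e n \<rightarrow>\<^sub>E words k l n"
  define \<Psi> where "\<Psi> \<phi> j = (if j \<in> ?B then Some (\<phi> (tl j) (hd j)) else None)"
    for \<phi> :: "int list \<Rightarrow> int \<Rightarrow> nat" and j
  have "bij_betw \<Psi> ?P (lang_on (spaced_rows e k l) ?B)"
    unfolding bij_betw_def
  proof
    show "inj_on \<Psi> ?P"
    proof (rule inj_onI)
      fix \<phi> \<psi> assume p: "\<phi> \<in> ?P" "\<psi> \<in> ?P" and eq: "\<Psi> \<phi> = \<Psi> \<psi>"
      show "\<phi> = \<psi>"
      proof (rule PiE_ext[OF p])
        fix t assume t: "t \<in> box e n"
        show "\<phi> t = \<psi> t"
        proof
          fix i
          show "\<phi> t i = \<psi> t i"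
          proof (cases "0 \<le> i \<and> i < int n")
            case True
            then show ?thesis using fun_cong[OF eq, of "i # t"] t by (simp add: \<Psi>_def mem_box_Cons)
          next
            case False
            then show ?thesis
              using words_outside[OF PiE_mem[OF p(1) t], of i] words_outside[OF PiE_mem[OF p(2) t], of i] by auto
          qed
        qed
      qed
    qed
    show "\<Psi> ` ?P = lang_on (spaced_rows e k l) ?B"
    proof (intro equalityI subsetI)
      fix q assume "q \<in> \<Psi> ` ?P"
      then obtain \<phi> where \<phi>: "\<phi> \<in> ?P" "q = \<Psi> \<phi>" by blast
      define x where "x = (\<lambda>j\<in>Zd (Suc e). if tl j \<in> box e n then \<phi> (tl j) (hd j) else 0)"
      have \<phi>w: "\<phi> t \<in> words k l n" if "t \<in> box e n" for t using PiE_mem[OF \<phi>(1) that] .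
      then have "\<phi> t i < k" if "t \<in> box e n" for t i using that by (simp add: words_def)
      then have "x \<in> Zd (Suc e) \<rightarrow>\<^sub>E {..<k}" using k by (simp add: x_def restrict_PiE_iff)
      moreover have "spaced l {i. x (i # t) \<noteq> 0}" if t: "t \<in> Zd e" for t
      proof (cases "t \<in> box e n")
        case True
        then have "{i. x (i # t) \<noteq> 0} = {i. \<phi> t i \<noteq> 0}" using t by (simp add: x_def)
        then show ?thesis using \<phi>w[OF True] by (simp add: words_def)
      next
        case False
        then have "{i. x (i # t) \<noteq> 0} = {}" using t by (simp add: x_def)
        then show ?thesis by simp
      qed
      ultimately have "x \<in> spaced_rows e k l" by (simp add: spaced_rows_def)
      moreover have "q = pattern_at x ?B"
      proof
        fix j
        show "q j = pattern_at x ?B j"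
        proof (cases "j \<in> ?B")
          case True
          then have "j \<in> Zd (Suc e)" using box_subset_Zd by blast
          then obtain i t where "j = i # t" "t \<in> Zd e" by (rule Zd_SucE)
          then show ?thesis using True by (simp add: \<phi> \<Psi>_def pattern_at_def x_def mem_box_Cons)
        qed (simp add: \<phi> \<Psi>_def pattern_at_def)
      qed
      ultimately show "q \<in> lang_on (spaced_rows e k l) ?B" by (auto simp: lang_on_def)
    next
      fix q assume "q \<in> lang_on (spaced_rows e k l) ?B"
      then obtain x where x: "x \<in> spaced_rows e k l" "q = pattern_at x ?B" by (auto simp: lang_on_def)
      define \<phi> where "\<phi> = (\<lambda>t\<in>box e n. \<lambda>i. if 0 \<le> i \<and> i < int n then x (i # t) else 0)"
      have "(\<lambda>i. if 0 \<le> i \<and> i < int n then x (i # t) else 0) \<in> words k l n" (is "?w \<in> _") if t: "t \<in> box e n" for t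
      proof -
        have tZ: "t \<in> Zd e" using t box_subset_Zd by blast
        have "x (i # t) < k" for i using subshift_less[OF subshift_rows x(1), of "i # t"] tZ by simp
        moreover have "spaced l {i. ?w i \<noteq> 0}"
        proof (rule spaced_subset[OF l])
          show "spaced l {i. x (i # t) \<noteq> 0}" using x(1) tZ by (simp add: spaced_rows_def)
        qed auto
        ultimately show ?thesis using k by (auto simp: words_def)
      qed
      then have "\<phi> \<in> ?P" by (simp add: \<phi>_def restrict_PiE_iff)
      moreover have "q = \<Psi> \<phi>"
      proof
        fix j
        show "q j = \<Psi> \<phi> j"
        proof (cases "j \<in> ?B")
          case True
          then have "j \<in> Zd (Suc e)" using box_subset_Zd by blast
          then obtain i t where "j = i # t" "t \<in> Zd e" by (rule Zd_SucE)
          then show ?thesis using True by (simp add: x \<Psi>_def pattern_at_def \<phi>_def mem_box_Cons)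
        qed (simp add: x \<Psi>_def pattern_at_def)
      qed
      ultimately show "q \<in> \<Psi> ` ?P" by blast
    qed
  qed
  then have "card (lang_on (spaced_rows e k l) ?B) = card ?P" by (simp add: bij_betw_same_card)
  then show ?thesis by (simp add: card_PiE card_box)
qed

lemma entropy_rows:
  assumes l: "mono l" and k: "k > 0"
  shows "(\<lambda>n. log 2 (real (card (words k l n))) / real n) \<longlonglongrightarrow> entropy (Suc e) (spaced_rows e k l)"
    and "n \<ge> 1 \<Longrightarrow> entropy (Suc e) (spaced_rows e k l) * real n \<le> log 2 (real (card (words k l n)))"
proof -
  have eq: "log 2 (real (card (lang_on (spaced_rows e k l) (box (Suc e) n)))) / real n ^ Suc e
      = log 2 (real (card (words k l n))) / real n" if "n \<ge> 1" for n
  proof -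
    have "log 2 (real (card (words k l n) ^ (n ^ e))) = real (n ^ e) * log 2 (real (card (words k l n)))"
      using card_words_pos[OF k, of l n] by (simp add: log_nat_power)
    then show ?thesis using that by (simp add: card_lang_rows[OF l k] field_simps)
  qed
  show "(\<lambda>n. log 2 (real (card (words k l n))) / real n) \<longlonglongrightarrow> entropy (Suc e) (spaced_rows e k l)"
    using entropy_limit(1)[OF subshift_rows[of e k l] rows_nonempty[OF k]]
    by (rule Lim_transform_eventually) (rule eventually_sequentiallyI[of 1], rule eq)
  assume n: "n \<ge> 1"
  have "entropy (Suc e) (spaced_rows e k l) \<le> log 2 (real (card (words k l n))) / real n"
    using entropy_limit(3)[OF subshift_rows[of e k l] rows_nonempty[OF k] n] unfolding eq[OF n] .
  then show "entropy (Suc e) (spaced_rows e k l) * real n \<le> log 2 (real (card (words k l n)))"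
    using n by (simp add: pos_le_divide_eq)
qed

subsection \<open>Decidability\<close>

definition zero_ext :: "nat \<Rightarrow> (int list \<rightharpoonup> nat) \<Rightarrow> int list \<Rightarrow> nat" where
  "zero_ext d p = (\<lambda>i\<in>Zd d. case p i of None \<Rightarrow> 0 | Some a \<Rightarrow> a)"

lemma language_rows:
  assumes l: "mono l" and k: "k > 0" and p: "finite (dom p)" "dom p \<subseteq> Zd (Suc e)"
  shows "p \<in> language (Suc e) (spaced_rows e k l) \<longleftrightarrow> zero_ext (Suc e) p \<in> spaced_rows e k l"
proof
  assume "p \<in> language (Suc e) (spaced_rows e k l)"
  then obtain x where x: "x \<in> spaced_rows e k l" "p = pattern_at x (dom p)"
    unfolding language_iff[OF p] by (auto simp: lang_on_def)
  have "p i = (if i \<in> dom p then Some (x i) else None)" for i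
    by (subst x(2)) (simp add: pattern_at_def restrict_map_def)
  then have "zero_ext (Suc e) p = (\<lambda>i\<in>Zd (Suc e). if i \<in> dom p then x i else 0)"
    unfolding zero_ext_def by (intro restrict_ext) (metis option.simps(4,5))
  then show "zero_ext (Suc e) p \<in> spaced_rows e k l" using rows_zero_outside[OF l x(1) k] by simp
next
  assume z: "zero_ext (Suc e) p \<in> spaced_rows e k l"
  have "p = pattern_at (zero_ext (Suc e) p) (dom p)"
    using p(2) by (auto simp: fun_eq_iff pattern_at_def restrict_map_def zero_ext_def split: option.split)
  then show "p \<in> language (Suc e) (spaced_rows e k l)"
    unfolding language_iff[OF p] using z by (auto simp: lang_on_def)
qed

text \<open>The condition is transferred from integers to positions in the listing, where all
  quantifiers are bounded. As a listing has no repetitions, letters between two sites may be counted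
  by counting entries.\<close>

lemma zero_ext_rows_iff:
  fixes ps :: "(int list \<times> nat) list"
  assumes ps: "pattern_listing (Suc e) k ps" and k: "k > 0"
  defines "P \<equiv> \<lambda>m. fst (ps ! m)" and "A \<equiv> \<lambda>m. snd (ps ! m)" and "L \<equiv> length ps"
  shows "zero_ext (Suc e) (map_of ps) \<in> spaced_rows e k l \<longleftrightarrow>
    (\<forall>m<L. \<forall>m'<L. A m \<noteq> 0 \<longrightarrow> A m' \<noteq> 0 \<longrightarrow> tl (P m) = tl (P m') \<longrightarrow> hd (P m) \<le> hd (P m') \<longrightarrow>
      int (l (\<Sum>i<L. of_bool (A i \<noteq> 0 \<and> tl (P i) = tl (P m) \<and> hd (P m) \<le> hd (P i) \<and> hd (P i) < hd (P m'))))
        \<le> hd (P m') - hd (P m))"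
proof -
  let ?z = "zero_ext (Suc e) (map_of ps)"
  have dist: "distinct (map fst ps)" and sub: "set ps \<subseteq> Zd (Suc e) \<times> {..<k}"
    using ps by (simp_all add: pattern_listing_def)
  have PA: "P m \<in> Zd (Suc e)" "A m < k" if "m < L" for m
    using subsetD[OF sub nth_mem, of m] that by (auto simp: P_def A_def L_def mem_Times_iff)
  have Pc: "P m = hd (P m) # tl (P m)" if "m < L" for m using PA(1)[OF that] by (auto simp: Zd_def length_Suc_conv)
  have tlZ: "tl (P m) \<in> Zd e" if "m < L" for m using PA(1)[OF that] by (simp add: Zd_def)
  have injP: "m = m'" if "m < L" "m' < L" "P m = P m'" for m m'
    using dist that by (auto simp: P_def L_def distinct_conv_nth)
  have zP: "?z (P m) = A m" if "m < L" for m
  proof -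
    have "(P m, A m) \<in> set ps" using that by (simp add: P_def A_def L_def)
    then have "map_of ps (P m) = Some (A m)" using dist by (rule map_of_is_SomeI[rotated])
    then show ?thesis using PA(1)[OF that] by (simp add: zero_ext_def)
  qed
  have z0: "\<exists>m<L. j = P m" if j: "?z j \<noteq> 0" "j \<in> Zd (Suc e)" for j
  proof -
    obtain a where "map_of ps j = Some a" using j by (cases "map_of ps j") (auto simp: zero_ext_def)
    then have "(j, a) \<in> set ps" by (rule map_of_SomeD)
    then obtain m where "m < length ps" "ps ! m = (j, a)" by (auto simp: in_set_conv_nth)
    then show ?thesis by (intro exI[of _ m]) (simp add: L_def P_def)
  qed
  have zPiE: "?z \<in> Zd (Suc e) \<rightarrow>\<^sub>E {..<k}"
  proof -
    have "?z j < k" if "j \<in> Zd (Suc e)" for j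
      using z0[OF _ that] zP PA(2) k by (cases "?z j = 0") auto
    then show ?thesis by (simp add: zero_ext_def restrict_PiE_iff)
  qed
  define X where "X t = {i. ?z (i # t) \<noteq> 0}" for t
  have X: "i \<in> X t \<longleftrightarrow> (\<exists>m<L. A m \<noteq> 0 \<and> P m = i # t)" if "t \<in> Zd e" for i t
  proof
    assume "i \<in> X t"
    then show "\<exists>m<L. A m \<noteq> 0 \<and> P m = i # t" using z0[of "i # t"] zP that by (auto simp: X_def)
  next
    assume "\<exists>m<L. A m \<noteq> 0 \<and> P m = i # t"
    then obtain m where "m < L" "A m \<noteq> 0" "P m = i # t" by blast
    then show "i \<in> X t" using zP[of m] by (simp add: X_def)
  qed
  have card: "card (X (tl (P m)) \<inter> {hd (P m)..<y})
      = (\<Sum>i<L. of_bool (A i \<noteq> 0 \<and> tl (P i) = tl (P m) \<and> hd (P m) \<le> hd (P i) \<and> hd (P i) < y))"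
    if m: "m < L" for m y
  proof -
    let ?I = "{i. i < L \<and> A i \<noteq> 0 \<and> tl (P i) = tl (P m) \<and> hd (P m) \<le> hd (P i) \<and> hd (P i) < y}"
    have "bij_betw (\<lambda>i. hd (P i)) ?I (X (tl (P m)) \<inter> {hd (P m)..<y})"
      unfolding bij_betw_def
    proof
      show "inj_on (\<lambda>i. hd (P i)) ?I"
      proof (rule inj_onI)
        fix i i' assume i: "i \<in> ?I" "i' \<in> ?I" and eq: "hd (P i) = hd (P i')"
        have iL: "i < L" "i' < L" using i by auto
        have "P i = hd (P i) # tl (P m)" "P i' = hd (P i') # tl (P m)"
          using Pc[OF iL(1)] Pc[OF iL(2)] i by auto
        then have "P i = P i'" using eq by simp
        then show "i = i'" by (rule injP[OF iL])
      qed
      show "(\<lambda>i. hd (P i)) ` ?I = X (tl (P m)) \<inter> {hd (P m)..<y}"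
      proof (intro equalityI subsetI)
        fix a assume "a \<in> (\<lambda>i. hd (P i)) ` ?I"
        then obtain i where i: "i \<in> ?I" "a = hd (P i)" by blast
        then have "P i = a # tl (P m)" using Pc[of i] by simp
        then show "a \<in> X (tl (P m)) \<inter> {hd (P m)..<y}" using i X[OF tlZ[OF m]] by auto
      next
        fix a assume a: "a \<in> X (tl (P m)) \<inter> {hd (P m)..<y}"
        then obtain i where "i < L" "A i \<noteq> 0" "P i = a # tl (P m)" using X[OF tlZ[OF m]] by auto
        then show "a \<in> (\<lambda>i. hd (P i)) ` ?I" using a by (intro image_eqI[of _ _ i]) auto
      qed
    qed
    then have "card (X (tl (P m)) \<inter> {hd (P m)..<y}) = card ?I" by (simp add: bij_betw_same_card)
    also have "\<dots> = (\<Sum>i<L. of_bool (A i \<noteq> 0 \<and> tl (P i) = tl (P m) \<and> hd (P m) \<le> hd (P i) \<and> hd (P i) < y))"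
      by (simp add: Int_def)
    finally show ?thesis .
  qed
  have "?z \<in> spaced_rows e k l \<longleftrightarrow> (\<forall>t\<in>Zd e. spaced l (X t))" using zPiE by (simp add: spaced_rows_def X_def)
  also have "\<dots> \<longleftrightarrow> (\<forall>m<L. \<forall>m'<L. A m \<noteq> 0 \<longrightarrow> A m' \<noteq> 0 \<longrightarrow> tl (P m) = tl (P m') \<longrightarrow> hd (P m) \<le> hd (P m') \<longrightarrow>
      int (l (card (X (tl (P m)) \<inter> {hd (P m)..<hd (P m')}))) \<le> hd (P m') - hd (P m))"
  proof
    assume sp: "\<forall>t\<in>Zd e. spaced l (X t)"
    show "\<forall>m<L. \<forall>m'<L. A m \<noteq> 0 \<longrightarrow> A m' \<noteq> 0 \<longrightarrow> tl (P m) = tl (P m') \<longrightarrow> hd (P m) \<le> hd (P m') \<longrightarrow>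
      int (l (card (X (tl (P m)) \<inter> {hd (P m)..<hd (P m')}))) \<le> hd (P m') - hd (P m)"
    proof (intro allI impI)
      fix m m' assume m: "m < L" "m' < L" "A m \<noteq> 0" "A m' \<noteq> 0" "tl (P m) = tl (P m')" "hd (P m) \<le> hd (P m')"
      have "hd (P m) \<in> X (tl (P m))" using X[OF tlZ[OF m(1)]] m Pc[OF m(1)] by blast
      moreover have "hd (P m') \<in> X (tl (P m))" using X[OF tlZ[OF m(1)]] m Pc[OF m(2)] by auto
      ultimately show "int (l (card (X (tl (P m)) \<inter> {hd (P m)..<hd (P m')}))) \<le> hd (P m') - hd (P m)"
        using sp tlZ[OF m(1)] m(6) by (intro spacedD) auto
    qed
  next
    assume R: "\<forall>m<L. \<forall>m'<L. A m \<noteq> 0 \<longrightarrow> A m' \<noteq> 0 \<longrightarrow> tl (P m) = tl (P m') \<longrightarrow> hd (P m) \<le> hd (P m') \<longrightarrow>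
      int (l (card (X (tl (P m)) \<inter> {hd (P m)..<hd (P m')}))) \<le> hd (P m') - hd (P m)"
    show "\<forall>t\<in>Zd e. spaced l (X t)"
      unfolding spaced_def
    proof (intro ballI impI)
      fix t x y assume t: "t \<in> Zd e" and xy: "x \<in> X t" "y \<in> X t" "x \<le> y"
      obtain m where m: "m < L" "A m \<noteq> 0" "P m = x # t" using xy(1) X[OF t] by blast
      obtain m' where m': "m' < L" "A m' \<noteq> 0" "P m' = y # t" using xy(2) X[OF t] by blast
      show "int (l (card (X t \<inter> {x..<y}))) \<le> y - x"
        using R[rule_format, OF m(1) m'(1) m(2) m'(2)] m(3) m'(3) xy(3) by simp
    qed
  qed
  also have "\<dots> \<longleftrightarrow> (\<forall>m<L. \<forall>m'<L. A m \<noteq> 0 \<longrightarrow> A m' \<noteq> 0 \<longrightarrow> tl (P m) = tl (P m') \<longrightarrow> hd (P m) \<le> hd (P m') \<longrightarrow>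
      int (l (\<Sum>i<L. of_bool (A i \<noteq> 0 \<and> tl (P i) = tl (P m) \<and> hd (P m) \<le> hd (P i) \<and> hd (P i) < hd (P m'))))
        \<le> hd (P m') - hd (P m))"
    by (intro all_cong imp_cong refl) (subst card, assumption, rule refl)
  finally show ?thesis .
qed

text \<open>An integer is treated as the difference of two natural numbers; comparisons of
  coordinates then become inequalities between sums of naturals.\<close>

definition ipos :: "nat \<Rightarrow> nat" where "ipos c = (if c mod 2 = 0 then c div 2 else 0)"
definition ineg :: "nat \<Rightarrow> nat" where "ineg c = (if c mod 2 = 0 then 0 else Suc (c div 2))"

lemma int_encode_pos_neg: "int (ipos (int_encode i)) - int (ineg (int_encode i)) = i"
proof -
  have "int (ipos c) - int (ineg c) = int_decode c" for c
    by (auto simp: ipos_def ineg_def int_decode_def sum_decode_def even_iff_mod_2_eq_zero)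
  then show ?thesis by simp
qed

lemma recf_ipos: "recf f \<Longrightarrow> recf (\<lambda>x. ipos (f x))" and recf_ineg: "recf f \<Longrightarrow> recf (\<lambda>x. ineg (f x))"
  unfolding ipos_def ineg_def by (intro recf_intros; assumption)+

text \<open>The condition on listings is evaluated directly on the code. Two sites lie in the same
  row if the codes of their remaining coordinates agree, by injectivity of the list coding.\<close>

lemma decides_rows:
  assumes g: "recf g" and k: "k > 0"
  shows "\<exists>M. decides_language (Suc e) k M (spaced_rows e k (full_lam g))"
proof -
  let ?l = "full_lam g"
  define hp where "hp c m = ipos (lhd (pfst (lnth c m)))" for c m
  define hn where "hn c m = ineg (lhd (pfst (lnth c m)))" for c m
  define tc where "tc c m = ltl (pfst (lnth c m))" for c m
  define V where "V c m = psnd (lnth c m)" for c m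
  define D where "D c = (of_bool (\<forall>m<llen c. \<forall>m'<llen c. V c m \<noteq> 0 \<longrightarrow> V c m' \<noteq> 0 \<longrightarrow> tc c m = tc c m' \<longrightarrow>
      hp c m + hn c m' \<le> hp c m' + hn c m \<longrightarrow>
      ?l (\<Sum>i<llen c. of_bool (V c i \<noteq> 0 \<and> tc c i = tc c m \<and> hp c m + hn c i \<le> hp c i + hn c m \<and>
           hp c i + hn c m' < hp c m' + hn c i))
        \<le> (hp c m' + hn c m) - (hp c m + hn c m')) :: nat)" for c
  have rl: "recf (\<lambda>x. ?l (r x))" if "recf r" for r
    by (rule recf_comp[of ?l], unfold full_lam_def lam_def) (intro recf_intros recf_comp[OF g], rule that)
  have rhp: "recf (\<lambda>x. hp (c x) (m x))" "recf (\<lambda>x. hn (c x) (m x))" "recf (\<lambda>x. tc (c x) (m x))"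
    "recf (\<lambda>x. V (c x) (m x))" if "recf c" "recf m" for c m
    unfolding hp_def hn_def tc_def V_def by (intro recf_ipos recf_ineg recf_intros recf_list_intros that)+
  have "recf D" unfolding D_def by (intro recf_intros rl rhp recf_llen)
  then have "computable D" by (rule recf_computable)
  then obtain M where M: "\<And>n. tm_computes M n (D n)" unfolding computable_def by blast
  have "D (listing_code ps) = (if map_of ps \<in> language (Suc e) (spaced_rows e k ?l) then 1 else 0)"
    if ps: "pattern_listing (Suc e) k ps" for ps
  proof -
    let ?c = "listing_code ps" and ?L = "length ps"
    have dist: "distinct (map fst ps)" and sub: "set ps \<subseteq> Zd (Suc e) \<times> {..<k}"
      using ps by (simp_all add: pattern_listing_def)
    have "fst ` set ps \<subseteq> Zd (Suc e)" using sub by auto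
    then have dom: "finite (dom (map_of ps))" "dom (map_of ps) \<subseteq> Zd (Suc e)"
      by (simp_all add: dom_map_of_conv_image_fst)
    have len: "llen ?c = ?L" by (simp add: listing_code_def)
    let ?P = "\<lambda>m. fst (ps ! m)" and ?A = "\<lambda>m. snd (ps ! m)"
    have nth: "lnth ?c m = ppair (list_encode (map int_encode (?P m))) (?A m)" if "m < ?L" for m
      using that by (simp add: listing_code_def lnth_list_encode ppair_def split: prod.split)
    have ne: "?P m \<noteq> []" if "m < ?L" for m
      using subsetD[OF sub nth_mem[OF that]] by (auto simp: Zd_def mem_Times_iff)
    have V: "V ?c m = ?A m" if "m < ?L" for m using that by (simp add: V_def nth)
    have tc: "tc ?c m = list_encode (map int_encode (tl (?P m)))" if "m < ?L" for m
      using that by (simp add: tc_def nth map_tl)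
    have tc_eq: "tc ?c m = tc ?c m' \<longleftrightarrow> tl (?P m) = tl (?P m')" if "m < ?L" "m' < ?L" for m m'
    proof -
      have "inj int_encode" by (rule inj_int_encode)
      then show ?thesis using that by (simp add: tc list_encode_eq inj_map_eq_map)
    qed
    have h: "int (hp ?c m) - int (hn ?c m) = hd (?P m)" if "m < ?L" for m
    proof -
      have "lhd (list_encode (map int_encode (?P m))) = int_encode (hd (?P m))"
        using ne[OF that] by (simp add: lhd_list_encode hd_map)
      then show ?thesis using that by (simp add: hp_def hn_def nth int_encode_pos_neg)
    qed
    have le: "hp ?c m + hn ?c m' \<le> hp ?c m' + hn ?c m \<longleftrightarrow> hd (?P m) \<le> hd (?P m')"
      and less: "hp ?c m + hn ?c m' < hp ?c m' + hn ?c m \<longleftrightarrow> hd (?P m) < hd (?P m')" if "m < ?L" "m' < ?L" for m m'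
      using h[OF that(1)] h[OF that(2)] by linarith+
    have sums: "(\<Sum>i<?L. of_bool (V ?c i \<noteq> 0 \<and> tc ?c i = tc ?c m \<and> hp ?c m + hn ?c i \<le> hp ?c i + hn ?c m \<and>
           hp ?c i + hn ?c m' < hp ?c m' + hn ?c i))
       = (\<Sum>i<?L. of_bool (?A i \<noteq> 0 \<and> tl (?P i) = tl (?P m) \<and> hd (?P m) \<le> hd (?P i) \<and> hd (?P i) < hd (?P m')))"
      if "m < ?L" "m' < ?L" for m m'
      using that by (intro sum.cong) (simp_all add: V tc_eq le less)
    have diff: "n \<le> (hp ?c m' + hn ?c m) - (hp ?c m + hn ?c m') \<longleftrightarrow> int n \<le> hd (?P m') - hd (?P m)"
      if "m < ?L" "m' < ?L" "hd (?P m) \<le> hd (?P m')" for m m' n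
      using h[OF that(1)] h[OF that(2)] that(3) by linarith
    have step: "(V ?c m \<noteq> 0 \<longrightarrow> V ?c m' \<noteq> 0 \<longrightarrow> tc ?c m = tc ?c m' \<longrightarrow>
      hp ?c m + hn ?c m' \<le> hp ?c m' + hn ?c m \<longrightarrow>
      ?l (\<Sum>i<?L. of_bool (V ?c i \<noteq> 0 \<and> tc ?c i = tc ?c m \<and> hp ?c m + hn ?c i \<le> hp ?c i + hn ?c m \<and>
           hp ?c i + hn ?c m' < hp ?c m' + hn ?c i))
        \<le> (hp ?c m' + hn ?c m) - (hp ?c m + hn ?c m'))
     \<longleftrightarrow> (?A m \<noteq> 0 \<longrightarrow> ?A m' \<noteq> 0 \<longrightarrow> tl (?P m) = tl (?P m') \<longrightarrow> hd (?P m) \<le> hd (?P m') \<longrightarrow>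
      int (?l (\<Sum>i<?L. of_bool (?A i \<noteq> 0 \<and> tl (?P i) = tl (?P m) \<and> hd (?P m) \<le> hd (?P i) \<and> hd (?P i) < hd (?P m'))))
        \<le> hd (?P m') - hd (?P m))" if "m < ?L" "m' < ?L" for m m'
      by (intro imp_cong) (use that in \<open>simp_all only: V tc_eq le sums diff\<close>)
    have "D ?c = of_bool (zero_ext (Suc e) (map_of ps) \<in> spaced_rows e k ?l)"
      unfolding D_def len zero_ext_rows_iff[OF ps k]
      by (intro arg_cong[of _ _ of_bool] all_cong step)
    then show ?thesis by (simp add: language_rows[OF mono_full_lam k dom])
  qed
  then show ?thesis unfolding decides_language_def using M by metis
qed

section \<open>Realising entropies\<close>

lemma realize_Pi1:
  assumes fm: "mono f" and fc: "computable f" and f0: "f 0 > 0"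
    and div: "\<And>B. \<exists>N. B \<le> (\<Sum>n=1..N. real (f n) / real n ^ 2)"
    and \<alpha>: "\<alpha> \<ge> 0" "Pi1_computable \<alpha>"
  obtains k \<Sigma> where "(k, \<Sigma>) \<in> irreducible_decidable_class (Suc e) f" "entropy (Suc e) \<Sigma> = \<alpha>"
proof -
  obtain u where "computable u" and bdd: "bdd_below (range (\<lambda>n. real_of_rat (rat_of_code (u n))))"
    and inf: "\<alpha> = (INF n. real_of_rat (rat_of_code (u n)))"
    using \<alpha>(2) unfolding Pi1_computable_def computable_rat_seq_def by auto
  have u: "recf u" and rf: "recf f" using \<open>computable u\<close> fc by (simp_all add: computable_recf)
  \<comment> \<open>An even code stands for a nonnegative numerator. Odd codes, which stand for
    negative ones, cannot occur because all bounds are at least \<alpha> and \<alpha> is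
    nonnegative.\<close>
  define a where "a i = pfst (u i) div 2" for i
  define b where "b i = Suc (psnd (u i))" for i
  have ra: "recf a" and rb: "recf b" unfolding a_def b_def by (intro recf_intros recf_comp[OF u])+
  have above: "\<alpha> \<le> real_of_rat (rat_of_code (u i))" for i
    unfolding inf using bdd by (intro cINF_lower) auto
  have ab: "real_of_rat (rat_of_code (u i)) = real (a i) / real (b i)" for i
  proof (cases "even (pfst (u i))")
    case True
    then show ?thesis by (simp add: rat_of_code_numerator a_def b_def)
  next
    case False
    then have "real_of_rat (rat_of_code (u i)) = - real (Suc (pfst (u i) div 2)) / real (b i)"
      by (simp add: rat_of_code_numerator b_def)
    also have "\<dots> < 0" by (simp add: b_def divide_neg_pos)
    finally show ?thesis using above[of i] \<alpha>(1) by linarith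
  qed
  \<comment> \<open>The alphabet is chosen large enough for the unrestricted words to reach the
    target.\<close>
  obtain k :: nat where k: "2 powr \<alpha> < real k" using reals_Archimedean2 by blast
  then have k0: "k > 0" by (cases k) (auto simp: powr_def not_less)
  have "\<alpha> = log 2 (2 powr \<alpha>)" by simp
  also have "\<dots> \<le> log 2 (real k)" using k k0 by (subst log_le_cancel_iff) auto
  finally have alphabet: "\<alpha> \<le> log 2 (real k)" .
  obtain g where rg: "recf g"
    and gdef: "\<And>j. g j = best (\<lambda>v. stage_ok a b f k j (g(j := v))) (f (j div 2) - (\<Sum>q<j. g q))"
    using ex_adapted_gaps[OF ra rb rf k0] by blast
  interpret adapted_gaps a b f g k \<alpha>
  proof
    show "\<exists>i. real (a i) / real (b i) < v" if "\<alpha> < v" for v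
      using that bdd unfolding inf by (subst (asm) cINF_less_iff) (auto simp: ab)
    show "g j = best (\<lambda>v. stage_ok a b f k j (g(j := v))) (f (j div 2) - (\<Sum>q<j. g q))" for j by (rule gdef)
  qed (use k0 fm above ab \<alpha>(1) alphabet div in \<open>auto simp: b_def\<close>)
  let ?S = "spaced_rows e k (full_lam g)"
  have "irreducible (Suc e) f ?S" by (rule irreducible_rows[OF fm f0 gap_sum k0])
  moreover have "decidable_subshift (Suc e) k ?S"
    unfolding decidable_subshift_def using subshift_rows decides_rows[OF rg k0] by blast
  ultimately have "(k, ?S) \<in> irreducible_decidable_class (Suc e) f"
    using rows_nonempty[OF k0] by (simp add: irreducible_decidable_class_def)
  moreover have "entropy (Suc e) ?S = \<alpha>"
  proof (rule antisym)
    show "entropy (Suc e) ?S \<le> \<alpha>" by (rule entropy_upper[OF entropy_rows(2)[OF mono_full_lam k0]])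
    have "\<alpha> \<le> log 2 (real (card (words k (full_lam g) n))) / real n" if "n \<ge> 1" for n
      using full_words_lower[of n] that by (simp add: pos_le_divide_eq mult.commute)
    then show "\<alpha> \<le> entropy (Suc e) ?S"
      by (intro LIMSEQ_le_const[OF entropy_rows(1)[OF mono_full_lam k0]] exI[of _ 1]) blast
  qed
  ultimately show thesis using that by blast
qed

theorem mainTheorem1:
  fixes f :: "nat \<Rightarrow> nat" and d :: nat
  assumes "mono f" and "d \<ge> 1"
  shows "(converges_at_computable_rate (\<lambda>n. real (f n) / real n ^ 2) \<longrightarrow>
            entropy_algorithm_exists d (irreducible_decidable_class d f))
    \<and> (filterlim (\<lambda>N. \<Sum>n=1..N. real (f n) / real n ^ 2) at_top sequentially
          \<and> computable f \<and> f 0 > 0 \<longrightarrow>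
         {entropy d \<Sigma> | k \<Sigma>. (k, \<Sigma>) \<in> irreducible_decidable_class d f}
             = {\<alpha>. \<alpha> \<ge> 0 \<and> Pi1_computable \<alpha>}
         \<and> \<not> entropy_algorithm_exists d (irreducible_decidable_class d f))"
proof (intro conjI impI; (elim conjE)?)
  show "entropy_algorithm_exists d (irreducible_decidable_class d f)"
    if "converges_at_computable_rate (\<lambda>n. real (f n) / real n ^ 2)"
    using entropy_algorithm_of_rate[OF assms that] .
next
  assume lim: "filterlim (\<lambda>N. \<Sum>n=1..N. real (f n) / real n ^ 2) at_top sequentially"
    and f: "computable f" "f 0 > 0"
  \<comment> \<open>One axis carries the spacing rule; the other \<open>e\<close> coordinates number
    the rows.\<close>
  obtain e where d: "d = Suc e" using assms(2) by (cases d) auto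
  have "\<exists>N. B \<le> (\<Sum>n=1..N. real (f n) / real n ^ 2)" for B
    using lim unfolding filterlim_at_top eventually_sequentially by blast
  note realize = realize_Pi1[OF assms(1) f this, where e = e, folded d]
  show "{entropy d \<Sigma> | k \<Sigma>. (k, \<Sigma>) \<in> irreducible_decidable_class d f} = {\<alpha>. \<alpha> \<ge> 0 \<and> Pi1_computable \<alpha>}"
  proof (intro equalityI subsetI)
    fix \<alpha> assume "\<alpha> \<in> {entropy d \<Sigma> | k \<Sigma>. (k, \<Sigma>) \<in> irreducible_decidable_class d f}"
    then obtain k \<Sigma> where "\<alpha> = entropy d \<Sigma>" "decidable_subshift d k \<Sigma>" "\<Sigma> \<noteq> {}"
      by (auto simp: irreducible_decidable_class_def)
    moreover from this have "subshift d k \<Sigma>" by (simp add: decidable_subshift_def)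
    ultimately show "\<alpha> \<in> {\<alpha>. \<alpha> \<ge> 0 \<and> Pi1_computable \<alpha>}"
      using entropy_Pi1 entropy_limit(2) by blast
  next
    fix \<alpha> assume "\<alpha> \<in> {\<alpha>. \<alpha> \<ge> 0 \<and> Pi1_computable \<alpha>}"
    then show "\<alpha> \<in> {entropy d \<Sigma> | k \<Sigma>. (k, \<Sigma>) \<in> irreducible_decidable_class d f}"
      using realize[of \<alpha>] by blast
  qed
  show "\<not> entropy_algorithm_exists d (irreducible_decidable_class d f)"
  proof
    assume alg: "entropy_algorithm_exists d (irreducible_decidable_class d f)"
    show False
    proof (rule ex_Pi1_not_approximable)
      fix \<alpha> assume \<alpha>: "\<alpha> \<ge> 0" "Pi1_computable \<alpha>"
        and no: "\<And>g. recf g \<Longrightarrow> \<exists>m. \<not> \<bar>\<alpha> - real_of_rat (rat_of_code (g m))\<bar> \<le> 1 / 2 ^ m"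
      obtain k \<Sigma> where S: "(k, \<Sigma>) \<in> irreducible_decidable_class d f" "entropy d \<Sigma> = \<alpha>"
        using realize[OF \<alpha>] by blast
      then obtain M where "decides_language d k M \<Sigma>"
        by (auto simp: irreducible_decidable_class_def decidable_subshift_def)
      from entropy_approximable[OF alg S(1) this] obtain g where
        "recf g" "\<And>m. \<bar>\<alpha> - real_of_rat (rat_of_code (g m))\<bar> \<le> 1 / 2 ^ m" unfolding S(2) by blast
      with no show False by blast
    qed
  qed
qed

end
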